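(* Let $A=\mathcal{A}(E,\sigma)$ be a geometric algebra over $k$. Then, as sets of isomorphism classes of graded algebras, (1) ${\rm Twist}(A)=\{ \mathcal{A}(E,\tau|_E\,\sigma) \mid \tau \in M(E,\sigma) \}/_{\cong}$; (2) ${\rm Twist}_{\rm alg}(A)=\{ \mathcal{A}(E,\tau|_E\,\sigma) \mid \tau \in Z(E,\sigma) \}/_{\cong}$.
   Context: $k$ is an algebraically closed field of characteristic zero; graded algebras are $\mathbb{N}$-graded $k$-algebras. Twisting systems. A twisting system on a graded algebra $A$ is a family $\theta=\{\theta_n\}_{n\in\mathbb{Z}}$ of graded $k$-linear automorphisms of $A$ with $\theta_n(a\,\theta_m(b))=\theta_n(a)\,\theta_{n+m}(b)$ for all $l,m,n$ and $a\in A_m$, $b\in A_l$. The twisted algebra $A^{\theta}$ is the graded vector space $A$ with new multiplication $a\ast b=a\,\theta_m(b)$ for $a\in A_m$, $b\in A_l$. $\theta$ is algebraic if $\theta_{m+n}=\theta_m\circ\theta_n$ for all $m,n\in\mathbb{Z}$. ${\rm TS}^{\mathbb{Z}}(A)$ is the set of twisting systems on $A$; ${\rm TS}^{\mathbb{Z}}_0(A)=\{\theta\in {\rm TS}^{\mathbb{Z}}(A)\mid \theta_0={\rm id}_A\}$; ${\rm TS}^{\mathbb{Z}}_{\rm alg}(A)=\{\theta\in{\rm TS}^{\mathbb{Z}}_0(A)\mid\theta\text{ algebraic}\}$. ${\rm Twist}(A)=\{A^\theta\mid\theta\in{\rm TS}^{\mathbb{Z}}(A)\}/_{\cong}$ and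 ${\rm Twist}_{\rm alg}(A)=\{A^\theta\mid\theta\in{\rm TS}^{\mathbb{Z}}_{\rm alg}(A)\}/_{\cong}$, where $\cong$ is isomorphism of graded algebras. Geometric algebras. Let $V$ be a finite-dimensional $k$-vector space and $A=T(V)/(R)$, $R\subset V\otimes V$, a quadratic algebra. Elements of $V\otimes V$ are viewed as bilinear functions on $V^*\times V^*$, and $\mathcal{V}(R)=\{(p,q)\in\mathbb{P}(V^* )\times\mathbb{P}(V^* )\mid g(p,q)=0\ \forall g\in R\}$. A geometric pair $(E,\sigma)$ is a projective variety $E\subset\mathbb{P}(V^* )$ (reduced, not necessarily irreducible) with $\sigma\in{\rm Aut}_k E$. Write $\mathcal{A}(E,\sigma)=T(V)/(R)$ with $R=\{g\in V\otimes V\mid g(p,\sigma(p))=0\ \forall p\in E\}$. $A$ is a geometric algebra, written $A=\mathcal{A}(E,\sigma)$, if there is a geometric pair $(E,\sigma)$ with both $\mathcal{V}(R)=\{(p,\sigma(p))\mid p\in E\}$ and $R=\{g\in V\otimes V\mid g(p,\sigma(p))=0\ \forall p\in E\}$. Sets of automorphisms. ${\rm Aut}_k(E\uparrow\mathbb{P}(V^* ))=\{\tau\in{\rm Aut}_kE\mid\tau=\overline{\tau}|_E\text{ for some }\overline{\tau}\in{\rm Aut}_k\mathbb{P}(V^* )\}$; ${\rm Aut}_k(\mathbb{P}(V^* )\downarrow E)=\{\tau\in{\rm Aut}_k\mathbb{P}(V^* )\mid\tau|_E\in{\rm Aut}_kE\}$; $Z(E,\sigma)=\{\tau\in{\rm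 Aut}_k(\mathbb{P}(V^* )\downarrow E)\mid\sigma\tau|_E\sigma^{-1}=\tau|_E\}$; $M(E,\sigma)=\{\tau\in{\rm Aut}_k(\mathbb{P}(V^* )\downarrow E)\mid(\tau|_E\sigma)^i\sigma^{-i}\in{\rm Aut}_k(E\uparrow\mathbb{P}(V^* ))\ \forall i\in\mathbb{Z}\}$. *)

theory Defs
  imports
    "HOL-Algebra.Algebra"
    "HOL-Algebra.Algebraic_Closure_Type"
begin

section \<open>Graded algebras\<close>

text \<open>The ground field is a type \<open>'k\<close>; its algebras are records whose multiplication need not be
  commutative (so the library locale \<open>algebra\<close>, which assumes a commutative ring, does not apply).\<close>

record ('k, 'a) graded_alg = "('k, 'a) module" +
  grade :: "nat \<Rightarrow> 'a set"

definition is_decomposition ::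
    "('k, 'a, 'm) graded_alg_scheme \<Rightarrow> 'a \<Rightarrow> (nat \<Rightarrow> 'a) \<Rightarrow> bool" where
  "is_decomposition A a c \<longleftrightarrow>
     (\<forall>n. c n \<in> grade A n) \<and> finite {n. c n \<noteq> \<zero>\<^bsub>A\<^esub>} \<and>
     a = (\<Oplus>\<^bsub>A\<^esub>n\<in>{n. c n \<noteq> \<zero>\<^bsub>A\<^esub>}. c n)"

locale graded_algebra = ring A + module "ring_of_type_algebra :: 'k ring" A
  for A :: "('k::field, 'a, 'm) graded_alg_scheme" (structure) +
  assumes smult_mult_left:
      "\<lbrakk>a \<in> carrier A; b \<in> carrier A\<rbrakk> \<Longrightarrow> (c \<odot> a) \<otimes> b = c \<odot> (a \<otimes> b)"
    and smult_mult_right: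
      "\<lbrakk>a \<in> carrier A; b \<in> carrier A\<rbrakk> \<Longrightarrow> a \<otimes> (c \<odot> b) = c \<odot> (a \<otimes> b)"
    and grade_subgroup: "additive_subgroup (grade A n) A"
    and grade_smult: "a \<in> grade A n \<Longrightarrow> c \<odot> a \<in> grade A n"
    and grade_one: "\<one> \<in> grade A 0"
    and grade_mult: "\<lbrakk>a \<in> grade A m; b \<in> grade A n\<rbrakk> \<Longrightarrow> a \<otimes> b \<in> grade A (m + n)"
    and decomposition: "a \<in> carrier A \<Longrightarrow> \<exists>!c. is_decomposition A a c"

text \<open>The degree \<open>n\<close> part of an element is \<open>hcomp A a n\<close>.\<close>

definition hcomp :: "('k, 'a, 'm) graded_alg_scheme \<Rightarrow> 'a \<Rightarrow> nat \<Rightarrow> 'a" where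
  "hcomp A a = (THE c. is_decomposition A a c)"

definition graded_iso ::
    "('k, 'a) graded_alg \<Rightarrow> ('k, 'b) graded_alg \<Rightarrow> ('a \<Rightarrow> 'b) set" where
  "graded_iso A B = {\<phi> \<in> ring_iso A B.
     (\<forall>c. \<forall>a\<in>carrier A. \<phi> (c \<odot>\<^bsub>A\<^esub> a) = c \<odot>\<^bsub>B\<^esub> \<phi> a) \<and>
     (\<forall>n. \<phi> ` grade A n = grade B n)}"

text \<open>Isomorphism of graded algebras as a relation, so that \<open>\<A> // graded_iso_rel\<close> is the set of
  isomorphism classes of the members of \<open>\<A>\<close>. A class contains all isomorphic graded algebras over
  the given type, whether or not they belong to \<open>\<A>\<close>; hence classes obtained from
  different families \<open>\<A>\<close> can be compared.\<close>

definition graded_iso_rel :: "(('k::field, 'a) graded_alg \<times> ('k, 'a) graded_alg) set" where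
  "graded_iso_rel =
     {(A, B). graded_algebra A \<and> graded_algebra B \<and> graded_iso A B \<noteq> {}}"


section \<open>Twisting systems\<close>

definition graded_linear_aut :: "('k, 'a) graded_alg \<Rightarrow> ('a \<Rightarrow> 'a) set" where
  "graded_linear_aut A = {\<phi> \<in> Bij (carrier A).
     (\<forall>a\<in>carrier A. \<forall>b\<in>carrier A. \<phi> (a \<oplus>\<^bsub>A\<^esub> b) = \<phi> a \<oplus>\<^bsub>A\<^esub> \<phi> b) \<and>
     (\<forall>c. \<forall>a\<in>carrier A. \<phi> (c \<odot>\<^bsub>A\<^esub> a) = c \<odot>\<^bsub>A\<^esub> \<phi> a) \<and>
     (\<forall>n. \<phi> ` grade A n = grade A n)}"

definition TS :: "('k, 'a) graded_alg \<Rightarrow> (int \<Rightarrow> 'a \<Rightarrow> 'a) set" where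
  "TS A = {\<theta>. (\<forall>n. \<theta> n \<in> graded_linear_aut A) \<and>
     (\<forall>(n::int) (m::nat) (l::nat). \<forall>a\<in>grade A m. \<forall>b\<in>grade A l.
        \<theta> n (a \<otimes>\<^bsub>A\<^esub> \<theta> (int m) b) = \<theta> n a \<otimes>\<^bsub>A\<^esub> \<theta> (n + int m) b)}"

definition TS0 :: "('k, 'a) graded_alg \<Rightarrow> (int \<Rightarrow> 'a \<Rightarrow> 'a) set" where
  "TS0 A = {\<theta> \<in> TS A. \<theta> 0 = (\<lambda>a\<in>carrier A. a)}"

definition TS_alg :: "('k, 'a) graded_alg \<Rightarrow> (int \<Rightarrow> 'a \<Rightarrow> 'a) set" where
  "TS_alg A = {\<theta> \<in> TS0 A. \<forall>m n. \<theta> (m + n) = compose (carrier A) (\<theta> m) (\<theta> n)}"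

text \<open>The rule \<open>a * b = a \<otimes> \<theta>\<^sub>m b\<close> for \<open>a\<close> of degree \<open>m\<close> is extended additively to all \<open>a\<close>.
  When \<open>\<theta>\<^sub>0\<close> is not the identity, the unit of the new multiplication is \<open>\<theta>\<^sub>0\<^sup>-\<^sup>1(1)\<close> rather
  than \<open>1\<close>.\<close>

definition twisted_mult ::
    "('k, 'a) graded_alg \<Rightarrow> (int \<Rightarrow> 'a \<Rightarrow> 'a) \<Rightarrow> 'a \<Rightarrow> 'a \<Rightarrow> 'a" where
  "twisted_mult A \<theta> a b =
     (\<Oplus>\<^bsub>A\<^esub>m\<in>{m. hcomp A a m \<noteq> \<zero>\<^bsub>A\<^esub>}. hcomp A a m \<otimes>\<^bsub>A\<^esub> \<theta> (int m) b)"

definition twisted_algebra ::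
    "('k, 'a) graded_alg \<Rightarrow> (int \<Rightarrow> 'a \<Rightarrow> 'a) \<Rightarrow> ('k, 'a) graded_alg" where
  "twisted_algebra A \<theta> =
     A\<lparr>monoid.mult := twisted_mult A \<theta>, monoid.one := inv_into (carrier A) (\<theta> 0) \<one>\<^bsub>A\<^esub>\<rparr>"

definition Twist :: "('k::field, 'a) graded_alg \<Rightarrow> ('k, 'a) graded_alg set set" where
  "Twist A = {twisted_algebra A \<theta> | \<theta>. \<theta> \<in> TS A} // graded_iso_rel"

definition Twist_alg :: "('k::field, 'a) graded_alg \<Rightarrow> ('k, 'a) graded_alg set set" where
  "Twist_alg A = {twisted_algebra A \<theta> | \<theta>. \<theta> \<in> TS_alg A} // graded_iso_rel"


section \<open>Quadratic algebras\<close>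

text \<open>\<open>V\<close> is the vector space with finite basis \<open>B\<close> (of any size, including 0). An element of
  \<open>T(V)\<close> is given by its coefficients on the words over \<open>B\<close>, the word \<open>[x\<^sub>1, \<dots>, x\<^sub>n]\<close> standing
  for \<open>x\<^sub>1 \<otimes> \<dots> \<otimes> x\<^sub>n\<close>.\<close>

definition tensor_carrier :: "'x set \<Rightarrow> ('x list \<Rightarrow> 'k::field) set" where
  "tensor_carrier B = {f. finite {w. f w \<noteq> 0} \<and> (\<forall>w. f w \<noteq> 0 \<longrightarrow> set w \<subseteq> B)}"

definition tensor_algebra :: "'x set \<Rightarrow> ('k::field, 'x list \<Rightarrow> 'k) graded_alg" where
  "tensor_algebra B =
     \<lparr>carrier = tensor_carrier B,
      monoid.mult = (\<lambda>f g w. \<Sum>i\<le>length w. f (take i w) * g (drop i w)),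
      monoid.one = (\<lambda>w. if w = [] then 1 else 0),
      ring.zero = (\<lambda>w. 0),
      ring.add = (\<lambda>f g w. f w + g w),
      module.smult = (\<lambda>c f w. c * f w),
      grade = (\<lambda>n. {f \<in> tensor_carrier B. \<forall>w. f w \<noteq> 0 \<longrightarrow> length w = n})\<rparr>"

text \<open>The quotient of a graded algebra by a (homogeneous) two-sided ideal; the ring operations are
  those of the library's factor ring, whose elements are cosets.\<close>

definition quotient_algebra ::
    "('k, 'a) graded_alg \<Rightarrow> 'a set \<Rightarrow> ('k, 'a set) graded_alg" where
  "quotient_algebra T I =
     \<lparr>carrier = carrier (T Quot I),
      monoid.mult = monoid.mult (T Quot I),
      monoid.one = monoid.one (T Quot I),
      ring.zero = ring.zero (T Quot I),
      ring.add = ring.add (T Quot I),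
      module.smult = (\<lambda>c Y. \<Union>f\<in>Y. I +>\<^bsub>T\<^esub> (c \<odot>\<^bsub>T\<^esub> f)),
      grade = (\<lambda>n. (\<lambda>f. I +>\<^bsub>T\<^esub> f) ` grade T n)\<rparr>"

definition quadratic_algebra ::
    "'x set \<Rightarrow> ('x list \<Rightarrow> 'k::field) set \<Rightarrow> ('k, ('x list \<Rightarrow> 'k) set) graded_alg" where
  "quadratic_algebra B R =
     quotient_algebra (tensor_algebra B) (Idl\<^bsub>tensor_algebra B\<^esub> R)"


section \<open>Projective varieties and their automorphisms\<close>

text \<open>A linear form on \<open>V\<close> is identified with its values on the basis \<open>B\<close>, extended by 0; that is,
  \<open>V\<^sup>*\<close> carries the dual basis of \<open>B\<close>. Points of \<open>\<P>(V\<^sup>*)\<close> are lines in \<open>V\<^sup>*\<close>.\<close>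

definition dual_space :: "'x set \<Rightarrow> ('x \<Rightarrow> 'k::field) set" where
  "dual_space B = {u. \<forall>x. x \<notin> B \<longrightarrow> u x = 0}"

definition line :: "('x \<Rightarrow> 'k::field) \<Rightarrow> ('x \<Rightarrow> 'k) set" where
  "line u = {(\<lambda>x. c * u x) | c. True}"

definition proj_space :: "'x set \<Rightarrow> ('x \<Rightarrow> 'k::field) set set" where
  "proj_space B = {line u | u. u \<in> dual_space B \<and> u \<noteq> (\<lambda>x. 0)}"

text \<open>Homogeneous polynomials of degree \<open>d\<close> in the coordinates indexed by \<open>B\<close>, as functions.\<close>

definition homogeneous_poly :: "'x set \<Rightarrow> nat \<Rightarrow> (('x \<Rightarrow> 'k::field) \<Rightarrow> 'k) set" where
  "homogeneous_poly B d =
     {(\<lambda>u. \<Sum>m\<in>{m. (\<forall>x. x \<notin> B \<longrightarrow> m x = 0) \<and> (\<Sum>x\<in>B. m x) = d}. a m * (\<Prod>x\<in>B. u x ^ m x))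
      | a :: ('x \<Rightarrow> nat) \<Rightarrow> 'k. True}"

definition projective_variety :: "'x set \<Rightarrow> ('x \<Rightarrow> 'k::field) set set \<Rightarrow> bool" where
  "projective_variety B E \<longleftrightarrow>
     (\<exists>S \<subseteq> (\<Union>d. homogeneous_poly B d).
        E = {p \<in> proj_space B. \<forall>F\<in>S. \<forall>u\<in>p. F u = 0})"

text \<open>Morphisms between projective varieties in \<open>\<P>(V\<^sup>*)\<close>: near each point the map is given by
  homogeneous polynomials of a common degree without common zeros. The neighbourhood is \<open>E - Z\<close>
  with \<open>Z\<close> Zariski closed, and \<open>F x\<close> is the coordinate of the map at \<open>x \<in> B\<close>.\<close>

definition regular_map ::
    "'x set \<Rightarrow> ('x \<Rightarrow> 'k::field) set set \<Rightarrow> ('x \<Rightarrow> 'k) set set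
      \<Rightarrow> (('x \<Rightarrow> 'k) set \<Rightarrow> ('x \<Rightarrow> 'k) set) \<Rightarrow> bool" where
  "regular_map B E E' f \<longleftrightarrow> f \<in> E \<rightarrow> E' \<and>
     (\<forall>p\<in>E. \<exists>Z d F. projective_variety B Z \<and> p \<notin> Z \<and>
        (\<forall>x\<in>B. F x \<in> homogeneous_poly B d) \<and>
        (\<forall>q\<in>E - Z. \<forall>u\<in>q. u \<noteq> (\<lambda>x. 0) \<longrightarrow>
           (\<exists>x\<in>B. F x u \<noteq> 0) \<and> f q = line (\<lambda>x. if x \<in> B then F x u else 0)))"

text \<open>\<open>Aut\<^sub>k E\<close>, as a subset of the library's group \<open>BijGroup E\<close> of bijections of \<open>E\<close> (functions that
  are \<open>undefined\<close> outside \<open>E\<close>).\<close>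

definition Aut_var ::
    "'x set \<Rightarrow> ('x \<Rightarrow> 'k::field) set set \<Rightarrow> (('x \<Rightarrow> 'k) set \<Rightarrow> ('x \<Rightarrow> 'k) set) set" where
  "Aut_var B E = {f \<in> carrier (BijGroup E).
     regular_map B E E f \<and> regular_map B E E (inv\<^bsub>BijGroup E\<^esub> f)}"

definition Aut_up ::
    "'x set \<Rightarrow> ('x \<Rightarrow> 'k::field) set set \<Rightarrow> (('x \<Rightarrow> 'k) set \<Rightarrow> ('x \<Rightarrow> 'k) set) set" where
  "Aut_up B E = {\<tau> \<in> Aut_var B E. \<exists>\<tau>'\<in>Aut_var B (proj_space B). \<tau> = restrict \<tau>' E}"

definition Aut_down ::
    "'x set \<Rightarrow> ('x \<Rightarrow> 'k::field) set set \<Rightarrow> (('x \<Rightarrow> 'k) set \<Rightarrow> ('x \<Rightarrow> 'k) set) set" where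
  "Aut_down B E = {\<tau> \<in> Aut_var B (proj_space B). restrict \<tau> E \<in> Aut_var B E}"

definition Z_set ::
    "'x set \<Rightarrow> ('x \<Rightarrow> 'k::field) set set \<Rightarrow> (('x \<Rightarrow> 'k) set \<Rightarrow> ('x \<Rightarrow> 'k) set)
      \<Rightarrow> (('x \<Rightarrow> 'k) set \<Rightarrow> ('x \<Rightarrow> 'k) set) set" where
  "Z_set B E \<sigma> = {\<tau> \<in> Aut_down B E.
     \<sigma> \<otimes>\<^bsub>BijGroup E\<^esub> restrict \<tau> E \<otimes>\<^bsub>BijGroup E\<^esub> inv\<^bsub>BijGroup E\<^esub> \<sigma> = restrict \<tau> E}"

definition M_set ::
    "'x set \<Rightarrow> ('x \<Rightarrow> 'k::field) set set \<Rightarrow> (('x \<Rightarrow> 'k) set \<Rightarrow> ('x \<Rightarrow> 'k) set)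
      \<Rightarrow> (('x \<Rightarrow> 'k) set \<Rightarrow> ('x \<Rightarrow> 'k) set) set" where
  "M_set B E \<sigma> = {\<tau> \<in> Aut_down B E. \<forall>i::int.
     (restrict \<tau> E \<otimes>\<^bsub>BijGroup E\<^esub> \<sigma>) [^]\<^bsub>BijGroup E\<^esub> i \<otimes>\<^bsub>BijGroup E\<^esub> \<sigma> [^]\<^bsub>BijGroup E\<^esub> (- i)
       \<in> Aut_up B E}"


section \<open>Geometric algebras\<close>

text \<open>The bilinear form on \<open>V\<^sup>*\<close> given by \<open>g \<in> V \<otimes> V\<close>.\<close>

definition bilinear_value ::
    "'x set \<Rightarrow> ('x list \<Rightarrow> 'k::field) \<Rightarrow> ('x \<Rightarrow> 'k) \<Rightarrow> ('x \<Rightarrow> 'k) \<Rightarrow> 'k" where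
  "bilinear_value B g u v = (\<Sum>x\<in>B. \<Sum>y\<in>B. g [x, y] * u x * v y)"

definition vanishes_at ::
    "'x set \<Rightarrow> ('x list \<Rightarrow> 'k::field) \<Rightarrow> ('x \<Rightarrow> 'k) set \<Rightarrow> ('x \<Rightarrow> 'k) set \<Rightarrow> bool" where
  "vanishes_at B g p q \<longleftrightarrow> (\<forall>u\<in>p. \<forall>v\<in>q. bilinear_value B g u v = 0)"

definition zero_locus ::
    "'x set \<Rightarrow> ('x list \<Rightarrow> 'k::field) set \<Rightarrow> (('x \<Rightarrow> 'k) set \<times> ('x \<Rightarrow> 'k) set) set" where
  "zero_locus B R = {(p, q) \<in> proj_space B \<times> proj_space B. \<forall>g\<in>R. vanishes_at B g p q}"

definition geometric_pair ::
    "'x set \<Rightarrow> ('x \<Rightarrow> 'k::field) set set \<Rightarrow> (('x \<Rightarrow> 'k) set \<Rightarrow> ('x \<Rightarrow> 'k) set) \<Rightarrow> bool" where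
  "geometric_pair B E \<sigma> \<longleftrightarrow> projective_variety B E \<and> \<sigma> \<in> Aut_var B E"

definition geometric_relations ::
    "'x set \<Rightarrow> ('x \<Rightarrow> 'k::field) set set \<Rightarrow> (('x \<Rightarrow> 'k) set \<Rightarrow> ('x \<Rightarrow> 'k) set)
      \<Rightarrow> ('x list \<Rightarrow> 'k) set" where
  "geometric_relations B E \<sigma> =
     {g \<in> grade (tensor_algebra B) 2. \<forall>p\<in>E. vanishes_at B g p (\<sigma> p)}"

text \<open>The algebra \<open>\<A>(E, \<sigma>)\<close>, and the property that \<open>T(V)/(R)\<close> is geometric with associated
  pair \<open>(E, \<sigma>)\<close>.\<close>

definition geometric_alg ::
    "'x set \<Rightarrow> ('x \<Rightarrow> 'k::field) set set \<Rightarrow> (('x \<Rightarrow> 'k) set \<Rightarrow> ('x \<Rightarrow> 'k) set)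
      \<Rightarrow> ('k, ('x list \<Rightarrow> 'k) set) graded_alg" where
  "geometric_alg B E \<sigma> = quadratic_algebra B (geometric_relations B E \<sigma>)"

definition is_geometric ::
    "'x set \<Rightarrow> ('x list \<Rightarrow> 'k::field) set \<Rightarrow> ('x \<Rightarrow> 'k) set set
      \<Rightarrow> (('x \<Rightarrow> 'k) set \<Rightarrow> ('x \<Rightarrow> 'k) set) \<Rightarrow> bool" where
  "is_geometric B R E \<sigma> \<longleftrightarrow> geometric_pair B E \<sigma> \<and>
     zero_locus B R = {(p, \<sigma> p) | p. p \<in> E} \<and> R = geometric_relations B E \<sigma>"

end

theory Submission
  imports Defs
begin

text \<open>In degree 1 a normalised twisting system \<open>\<theta>\<close> of \<open>A = \<A>(E, \<sigma>)\<close> is a family of matrices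
  \<open>m\<^sub>n\<close>, and letting \<open>m\<^sub>i\<close> act on the \<open>i\<close>-th letter of a word identifies \<open>A\<^sup>\<theta>\<close> with
  \<open>T(V)/(R')\<close>, where \<open>R' = (m\<^sub>n \<otimes> m\<^sub>n\<^sub>+\<^sub>1)\<^sup>-\<^sup>1 R\<close> for every \<open>n\<close>; conversely every such
  family comes from a twisting system. Comparing the zero loci of \<open>R'\<close> for all \<open>n\<close> gives
  \<open>m\<^sub>n\<^sub>+\<^sub>1 \<sigma> = m\<^sub>1 \<sigma> m\<^sub>n\<close> on \<open>E\<close>, that is, \<open>m\<^sub>n = (m\<^sub>1 \<sigma>)\<^sup>n \<sigma>\<^sup>-\<^sup>n\<close>, which is the
  condition defining \<open>M(E, \<sigma>)\<close>.

  The converse needs that automorphisms of projective space are linear. Along a map from \<open>k\<^sup>3\<close>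
  a regular map is given by one tuple of polynomials without common factor. For mutually inverse
  \<open>f\<close> and \<open>g\<close>, a one-parameter family that joins \<open>f(\<ell>)\<close> to a multiple covering of a line
  \<open>\<ell>\<close> shows that \<open>f\<close> has degree 1 on \<open>\<ell>\<close>; hence \<open>f\<close> is linear on lines and planes, and these
  linear maps are glued.\<close>

section \<open>Polynomials in three variables\<close>

text \<open>Three variables suffice in every dimension. Two of them parametrise a projective line;
  the third is the interpolation parameter of the degree argument, or the third coordinate of a
  plane. Planes are what additivity of a linear lift needs: a lift is normalised at a base vector
  \<open>w\<close>, so comparing \<open>u\<close>, \<open>v\<close> and \<open>u + v\<close>
  involves the span of \<open>u\<close>, \<open>v\<close> and \<open>w\<close>. A fixed number of
  variables also makes the polynomial ring one type, whatever \<open>B\<close> is. The condition on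
  \<open>R'\<close> is imposed for every \<open>n\<close> because, in the ideal generated by
  \<open>R'\<close>, a relation can start at any position \<open>n\<close> of a word, where the
  letterwise action applies \<open>m\<^sub>n\<close> and \<open>m\<^sub>n\<^sub>+\<^sub>1\<close>.
  The action on \<open>E\<close> leaves a freedom in each matrix, at least a scalar factor. The
  relations do not see it, so for \<open>M(E, \<sigma>)\<close> the matrices are chosen separately
  for each \<open>n\<close>. An algebraic system needs honest equations
  \<open>m\<^sub>a\<^sub>+\<^sub>b = m\<^sub>a m\<^sub>b\<close>, so for
  \<open>Z(E, \<sigma>)\<close> all of them are powers of one matrix.\<close>

lemma range_to_ac: "x \<in> range (to_ac :: 'k::alg_closed_field \<Rightarrow> _)"
proof -
  obtain p :: "'k Polynomial.poly" where p: "p \<noteq> 0" "Polynomial.poly (map_poly to_ac p) x = 0"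
    using alg_closure_algebraic .
  show ?thesis
    using p
  proof (induction "Polynomial.degree p" arbitrary: p)
    case 0
    then obtain c where "p = [:c:]" "c \<noteq> 0"
      by (metis degree_eq_zeroE pCons_0_0)
    with 0 show ?case by (simp add: map_poly_pCons)
  next
    case (Suc n)
    \<comment> \<open>The root \<open>a\<close> lies in the ground field. Either \<open>x\<close>
      equals \<open>to_ac a\<close>, or it is a root of the cofactor, whose degree is
      smaller.\<close>
    then obtain a where "Polynomial.poly p a = 0"
      using alg_closed_imp_poly_has_root[of p] by auto
    then obtain q where q: "p = [:-a, 1:] * q"
      by (metis dvdE poly_eq_0_iff_dvd)
    have q0: "q \<noteq> 0" using Suc.prems q by auto
    have deg: "Polynomial.degree q = n"
      using Suc.hyps(2) q0 by (simp add: q degree_mult_eq del: mult_pCons_left)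
    have "map_poly to_ac p = [:- to_ac a, 1:] * map_poly to_ac q"
      unfolding q
      by (rule poly_eqI) (simp add: coeff_map_poly coeff_pCons split: nat.splits)
    then have "Polynomial.poly ([:- to_ac a, 1:] * map_poly to_ac q) x = 0"
      using Suc.prems(2) by (simp only:)
    then have "(x - to_ac a) * Polynomial.poly (map_poly to_ac q) x = 0"
      by (simp add: algebra_simps)
    then show ?case using Suc.hyps(1)[of q] deg q0 by auto
  qed
qed

lemma to_ac_of_ac_alg_closed [simp]: "to_ac (of_ac x) = (x :: 'k::alg_closed_field alg_closure)"
  by (rule to_ac_of_ac[OF range_to_ac])

lemma of_ac_add [simp]: "of_ac (x + y) = of_ac x + of_ac (y :: 'k::alg_closed_field alg_closure)"
  and of_ac_mult [simp]: "of_ac (x * y) = of_ac x * of_ac y"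
  by (rule of_ac_eqI, simp)+

lemma of_ac_eq_0_iff [simp]: "of_ac x = 0 \<longleftrightarrow> x = (0 :: 'k::alg_closed_field alg_closure)"
  by (metis of_ac_0 to_ac_0 to_ac_of_ac_alg_closed)

text \<open>The field is replaced by its isomorphic algebraic closure, because the library provides
  the type class instances that make iterated polynomials factorial only for the latter.\<close>

type_synonym 'k p1 = "'k alg_closure Polynomial.poly"
type_synonym 'k p3 = "'k alg_closure Polynomial.poly Polynomial.poly Polynomial.poly"

definition ev1 :: "'k::alg_closed_field p1 \<Rightarrow> 'k \<Rightarrow> 'k" where
  "ev1 p t = of_ac (Polynomial.poly p (to_ac t))"

text \<open>The variables are evaluated from the outside in: the outermost at \<open>a\<close>, the
  middle one at \<open>b\<close>, the innermost at \<open>c\<close>. The first one often has a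
  separate role, as interpolation parameter or as an idle variable.\<close>

definition ev3 :: "'k::alg_closed_field p3 \<Rightarrow> 'k \<Rightarrow> 'k \<Rightarrow> 'k \<Rightarrow> 'k" where
  "ev3 p a b c = of_ac (Polynomial.poly (Polynomial.poly (Polynomial.poly p [:[:to_ac a:]:]) [:to_ac b:]) (to_ac c))"

lemma ev1_simps [simp]:
  "ev1 (p + q) t = ev1 p t + ev1 q t" "ev1 (p * q) t = ev1 p t * ev1 q t"
  "ev1 0 t = 0" "ev1 1 t = 1" "ev1 [:k:] t = of_ac k" "ev1 [:0, 1:] t = t"
  by (simp_all add: ev1_def)

lemma ev3_simps [simp]:
  "ev3 (p + q) a b c = ev3 p a b c + ev3 q a b c" "ev3 (p * q) a b c = ev3 p a b c * ev3 q a b c"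
  "ev3 0 a b c = 0" "ev3 1 a b c = 1"
  by (simp_all add: ev3_def)

lemma ev3_gen [simp]:
  "ev3 [:[:[:k:]:]:] a b c = of_ac k" "ev3 [:0, 1:] a b c = a"
  "ev3 [:[:0, 1:]:] a b c = b" "ev3 [:[:[:0, 1:]:]:] a b c = c"
  by (simp_all add: ev3_def)

lemma ev1_diff [simp]: "ev1 (p - q) t = ev1 p t - ev1 q t"
  by (metis add_diff_cancel diff_add_cancel ev1_simps(1))

lemma ev3_diff [simp]: "ev3 (p - q) a b c = ev3 p a b c - ev3 q a b c"
  by (metis add_diff_cancel diff_add_cancel ev3_simps(1))

lemma ev1_power [simp]: "ev1 (p ^ n) t = ev1 p t ^ n"
  by (induction n) simp_all

lemma ev3_power [simp]: "ev3 (p ^ n) a b c = ev3 p a b c ^ n"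
  by (induction n) simp_all

lemma ev3_sum: "ev3 (sum f A) a b c = (\<Sum>i\<in>A. ev3 (f i) a b c)"
  by (induction A rule: infinite_finite_induct) simp_all

lemma ev3_prod: "ev3 (prod f A) a b c = (\<Prod>i\<in>A. ev3 (f i) a b c)"
  by (induction A rule: infinite_finite_induct) simp_all

text \<open>In characteristic zero the positive integers are infinitely many roots. The point 0 is
  left out so that identities containing \<open>1 / t\<close> can be compared directly.\<close>

lemma ev1_eq_0:
  fixes p :: "'k::{alg_closed_field, field_char_0} p1"
  assumes "\<And>t. t \<noteq> 0 \<Longrightarrow> ev1 p t = 0"
  shows "p = 0"
proof (rule ccontr)
  assume "p \<noteq> 0"
  then have "finite {x. Polynomial.poly p x = 0}" by (rule poly_roots_finite)
  moreover have "range (\<lambda>n. of_nat (Suc n) :: 'k alg_closure) \<subseteq> {x. Polynomial.poly p x = 0}"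
  proof safe
    fix n
    have "ev1 p (of_nat (Suc n)) = 0" by (rule assms) (simp del: of_nat_Suc)
    then show "Polynomial.poly p (of_nat (Suc n)) = 0"
      unfolding ev1_def to_ac_of_nat of_ac_eq_0_iff .
  qed
  moreover have "infinite (range (\<lambda>n. of_nat (Suc n) :: 'k alg_closure))"
    by (rule range_inj_infinite) (simp add: inj_def del: of_nat_Suc)
  ultimately show False by (blast dest: finite_subset)
qed

lemma ev1_eqI:
  fixes p :: "'k::{alg_closed_field, field_char_0} p1"
  assumes "\<And>t. t \<noteq> 0 \<Longrightarrow> ev1 p t = ev1 q t"
  shows "p = q"
  using ev1_eq_0[of "p - q"] assms by simp

text \<open>An arbitrary infinite set of test points is allowed because the coefficients may
  themselves be polynomials, while only constants are substituted.\<close>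

lemma poly_eq_0_everywhere:
  fixes p :: "'a::{idom, ring_char_0} Polynomial.poly"
  assumes "\<And>t. t \<in> S \<Longrightarrow> Polynomial.poly p t = 0" "infinite S"
  shows "p = 0"
proof (rule ccontr)
  assume "p \<noteq> 0"
  then have "finite {t. Polynomial.poly p t = 0}" by (rule poly_roots_finite)
  moreover have "S \<subseteq> {t. Polynomial.poly p t = 0}" using assms(1) by blast
  ultimately show False using assms(2) finite_subset by blast
qed

lemma infinite_range_to_ac: "infinite (range (to_ac :: 'k::{alg_closed_field,field_char_0} \<Rightarrow> _))"
proof -
  have "range (to_ac :: 'k \<Rightarrow> _) = UNIV" using range_to_ac by blast
  then show ?thesis by (simp add: infinite_UNIV_char_0)
qed

lemma ev3_eq_0:
  fixes p :: "'k::{alg_closed_field, field_char_0} p3"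
  assumes "\<And>a b c. ev3 p a b c = 0"
  shows "p = 0"
proof (rule poly_eq_0_everywhere)
  show "infinite ((\<lambda>x. [:[:x:]:]) ` range (to_ac :: 'k \<Rightarrow> _))"
    using infinite_range_to_ac by (subst finite_image_iff) (auto intro!: inj_onI)
  fix u :: "'k alg_closure Polynomial.poly Polynomial.poly" assume "u \<in> (\<lambda>x. [:[:x:]:]) ` range (to_ac :: 'k \<Rightarrow> _)"
  then obtain a :: 'k where u: "u = [:[:to_ac a:]:]" by auto
  show "Polynomial.poly p u = 0"
  proof (rule poly_eq_0_everywhere)
    show "infinite ((\<lambda>x. [:x:]) ` range (to_ac :: 'k \<Rightarrow> _))"
      using infinite_range_to_ac by (subst finite_image_iff) (auto intro!: inj_onI)
    fix v :: "'k alg_closure Polynomial.poly" assume "v \<in> (\<lambda>x. [:x:]) ` range (to_ac :: 'k \<Rightarrow> _)"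
    then obtain b :: 'k where v: "v = [:to_ac b:]" by auto
    show "Polynomial.poly (Polynomial.poly p u) v = 0"
    proof (rule poly_eq_0_everywhere[OF _ infinite_range_to_ac])
      fix w :: "'k alg_closure" assume "w \<in> range to_ac"
      then obtain c where "w = to_ac c" by auto
      with assms[of a b c] show "Polynomial.poly (Polynomial.poly (Polynomial.poly p u) v) w = 0"
        by (simp add: ev3_def u v)
    qed
  qed
qed

text \<open>Iterated induction on \<open>pCons\<close> generates the ring from constants, the three
  variables, sums and products. Each claim that a composition is again a polynomial then only needs
  closure under sums and products.\<close>

lemma p3_induct:
  fixes p :: "'k::alg_closed_field p3"
  assumes c: "\<And>k. P [:[:[:k:]:]:]" and X: "P [:0, 1:]" and Y: "P [:[:0, 1:]:]" and Z: "P [:[:[:0, 1:]:]:]"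
    and add: "\<And>p q. P p \<Longrightarrow> P q \<Longrightarrow> P (p + q)" and mult: "\<And>p q. P p \<Longrightarrow> P q \<Longrightarrow> P (p * q)"
  shows "P p"
proof -
  have 1: "P [:[:r:]:]" for r
  proof (induction r)
    case 0 then show ?case using c[of 0] by simp
  next
    case (pCons k r)
    have "[:[:pCons k r:]:] = [:[:[:k:]:]:] + [:[:[:0, 1:]:]:] * [:[:r:]:]" by simp
    then show ?case using pCons c Z add mult by metis
  qed
  have 2: "P [:s:]" for s
  proof (induction s)
    case 0 then show ?case using 1[of 0] by simp
  next
    case (pCons k r)
    have "[:pCons k r:] = [:[:k:]:] + [:[:0, 1:]:] * [:r:]" by simp
    then show ?case using pCons 1 Y add mult by metis
  qed
  show ?thesis
  proof (induction p)
    case 0 then show ?case using 2[of 0] by simp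
  next
    case (pCons k r)
    have "pCons k r = [:k:] + [:0, 1:] * r" by simp
    then show ?case using pCons 2 X add mult by metis
  qed
qed

lemma ev3_curve:
  fixes p :: "'k::alg_closed_field p3"
  shows "\<exists>r. \<forall>t. ev1 r t = ev3 p (ev1 \<alpha> t) (ev1 \<beta> t) (ev1 \<gamma> t)"
proof (induction p rule: p3_induct)
  case (1 k) show ?case by (rule exI[of _ "[:k:]"]) simp
next
  case (5 p q)
  then obtain r s where "\<forall>t. ev1 r t = ev3 p (ev1 \<alpha> t) (ev1 \<beta> t) (ev1 \<gamma> t)"
    "\<forall>t. ev1 s t = ev3 q (ev1 \<alpha> t) (ev1 \<beta> t) (ev1 \<gamma> t)" by auto
  then show ?case by (intro exI[of _ "r + s"]) simp
next
  case (6 p q)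
  then obtain r s where "\<forall>t. ev1 r t = ev3 p (ev1 \<alpha> t) (ev1 \<beta> t) (ev1 \<gamma> t)"
    "\<forall>t. ev1 s t = ev3 q (ev1 \<alpha> t) (ev1 \<beta> t) (ev1 \<gamma> t)" by auto
  then show ?case by (intro exI[of _ "r * s"]) simp
qed auto

lemma ev3_affine_line:
  fixes p :: "'k::alg_closed_field p3"
  shows "\<exists>r. \<forall>t. ev1 r t = ev3 p (a + t * a') (b + t * b') (c + t * c')"
proof -
  have "ev1 [:to_ac k, to_ac k':] t = k + t * k'" for k k' t :: 'k
    by (simp add: ev1_def)
  then show ?thesis using ev3_curve[of p "[:to_ac a, to_ac a':]" "[:to_ac b, to_ac b':]" "[:to_ac c, to_ac c':]"]
    by simp
qed

lemma ev3_subst: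
  fixes p :: "'k::alg_closed_field p3"
  shows "\<exists>q. \<forall>a b c. ev3 q a b c = ev3 p (ev3 \<alpha> a b c) (ev3 \<beta> a b c) (ev3 \<gamma> a b c)"
proof (induction p rule: p3_induct)
  case (1 k) show ?case by (rule exI[of _ "[:[:[:k:]:]:]"]) simp
next
  case (5 p q)
  then obtain r s where "\<forall>a b c. ev3 r a b c = ev3 p (ev3 \<alpha> a b c) (ev3 \<beta> a b c) (ev3 \<gamma> a b c)"
    "\<forall>a b c. ev3 s a b c = ev3 q (ev3 \<alpha> a b c) (ev3 \<beta> a b c) (ev3 \<gamma> a b c)" by auto
  then show ?case by (intro exI[of _ "r + s"]) simp
next
  case (6 p q)
  then obtain r s where "\<forall>a b c. ev3 r a b c = ev3 p (ev3 \<alpha> a b c) (ev3 \<beta> a b c) (ev3 \<gamma> a b c)"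
    "\<forall>a b c. ev3 s a b c = ev3 q (ev3 \<alpha> a b c) (ev3 \<beta> a b c) (ev3 \<gamma> a b c)" by auto
  then show ?case by (intro exI[of _ "r * s"]) simp
qed auto

lemma p1_nonvanishing_const:
  fixes p :: "'k::alg_closed_field p1"
  assumes "\<And>t. ev1 p t \<noteq> 0"
  shows "\<exists>k. k \<noteq> 0 \<and> p = [:to_ac k:]"
proof -
  have "Polynomial.degree p = 0"
  proof (rule ccontr)
    assume "Polynomial.degree p \<noteq> 0"
    then obtain x where "Polynomial.poly p x = 0" using alg_closed_imp_poly_has_root by blast
    then have "ev1 p (of_ac x) = 0" by (simp add: ev1_def)
    with assms show False by blast
  qed
  then obtain k where "p = [:k:]" by (metis degree_eq_zeroE)
  moreover from this have "k \<noteq> 0" using assms[of 0] by auto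
  ultimately show ?thesis by (intro exI[of _ "of_ac k"]) auto
qed

text \<open>The only possible root is 0, so the variable can be split off until a constant remains.
  The exponent found in this way is the degree of a homogeneous tuple, read off from its scaling
  factor.\<close>

lemma p1_no_nonzero_root:
  fixes p :: "'k::alg_closed_field p1"
  assumes "\<And>t. t \<noteq> 0 \<Longrightarrow> ev1 p t \<noteq> 0"
  shows "\<exists>k n. \<forall>t. ev1 p t = k * t ^ n"
  using assms
proof (induction "Polynomial.degree p" arbitrary: p)
  case 0
  then obtain k where "p = [:k:]" by (metis degree_eq_zeroE)
  then show ?case by (intro exI[of _ "of_ac k"] exI[of _ 0]) simp
next
  case (Suc n)
  then obtain x where x: "Polynomial.poly p x = 0" using alg_closed_imp_poly_has_root[of p] by auto
  then have "ev1 p (of_ac x) = 0" by (simp add: ev1_def)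
  with Suc.prems[of "of_ac x"] have "of_ac x = 0" by blast
  then have "[:- 0, 1:] dvd p" using x by (simp only: of_ac_eq_0_iff poly_eq_0_iff_dvd)
  then obtain q where "p = [:- 0, 1:] * q" by (rule dvdE)
  then have q: "p = [:0, 1:] * q" by (simp only: minus_zero)
  have "q \<noteq> 0" using Suc.hyps(2) q by auto
  then have "Polynomial.degree q = n"
    using Suc.hyps(2) by (simp add: q degree_mult_eq del: mult_pCons_left)
  moreover have *: "ev1 p t = t * ev1 q t" for t by (simp only: q ev1_simps)
  ultimately obtain k m where "\<forall>t. ev1 q t = k * t ^ m"
    using Suc.hyps(1)[of q] Suc.prems by auto
  then show ?case using * by (intro exI[of _ k] exI[of _ "Suc m"]) auto
qed

text \<open>On each line through the origin a unit restricts to a one-variable polynomial without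
  roots, which is constant over an algebraically closed field.\<close>

lemma ev3_unit_const:
  fixes p :: "'k::{alg_closed_field, field_char_0} p3"
  assumes "p dvd 1"
  shows "ev3 p a b c = ev3 p 0 0 0" and "ev3 p 0 0 0 \<noteq> 0"
proof -
  obtain q where q: "1 = p * q" using assms by (auto simp: dvd_def)
  have 1: "ev3 p x y z * ev3 q x y z = 1" for x y z
    by (metis q ev3_simps(2,4))
  then show "ev3 p 0 0 0 \<noteq> 0" by (metis mult_zero_left zero_neq_one)
  obtain r where r: "\<forall>t. ev1 r t = ev3 p (0 + t * a) (0 + t * b) (0 + t * c)" using ev3_affine_line by blast
  have "ev1 r t \<noteq> 0" for t using 1 r by (metis mult_zero_left zero_neq_one)
  then obtain k where "r = [:to_ac k:]" using p1_nonvanishing_const by blast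
  then show "ev3 p a b c = ev3 p 0 0 0" using r[rule_format, of 0] r[rule_format, of 1] by simp
qed

text \<open>Common divisors are units. This is weaker than generating the unit ideal: two of the
  variables form such a tuple although both vanish at the origin.\<close>

definition unimodular :: "'x set \<Rightarrow> ('x \<Rightarrow> 'r::comm_semiring_1) \<Rightarrow> bool" where
  "unimodular B F \<longleftrightarrow> (\<forall>d. (\<forall>x\<in>B. d dvd F x) \<longrightarrow> d dvd 1)"

text \<open>For a fixed \<open>y\<close> with \<open>F y\<close> nonzero, \<open>F y\<close> divides
  every \<open>G y * F x\<close>, hence their gcd, which is \<open>G y\<close> up to a unit because
  the gcd of the \<open>F x\<close> is a unit. The quotient of \<open>G y\<close> by
  \<open>F y\<close> is the common factor \<open>h\<close>.\<close>

lemma unimodular_dvd_proportional: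
  fixes F G :: "'x \<Rightarrow> 'r::factorial_ring_gcd"
  assumes "unimodular B F" and eq: "\<And>x y. \<lbrakk>x \<in> B; y \<in> B\<rbrakk> \<Longrightarrow> F x * G y = F y * G x"
  shows "\<exists>h. \<forall>x\<in>B. G x = h * F x"
proof (cases "\<exists>y\<in>B. F y \<noteq> 0")
  case True
  then obtain y where y: "y \<in> B" "F y \<noteq> 0" by auto
  have "F y dvd G y"
  proof -
    have "F y dvd Gcd ((\<lambda>x. G y * F x) ` B)"
    proof (rule Gcd_greatest, elim imageE, hypsubst)
      fix x assume "x \<in> B"
      have "G y * F x = F y * G x" using eq[OF \<open>x \<in> B\<close> y(1)] by (simp add: mult.commute)
      then show "F y dvd G y * F x" by simp
    qed
    also have "Gcd ((\<lambda>x. G y * F x) ` B) = normalize (G y * Gcd (F ` B))"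
    proof -
      have "(\<lambda>x. G y * F x) ` B = (*) (G y) ` (F ` B)" by (simp add: image_image)
      then show ?thesis by (simp only: Gcd_mult)
    qed
    also have "\<dots> dvd G y * Gcd (F ` B)" by simp
    also have "Gcd (F ` B) dvd 1"
      using assms(1)[unfolded unimodular_def, rule_format, of "Gcd (F ` B)"] by (simp add: Gcd_dvd)
    then have "G y * Gcd (F ` B) dvd G y * 1" by (rule mult_dvd_mono[OF dvd_refl])
    finally show ?thesis by simp
  qed
  then obtain h where h: "G y = F y * h" by auto
  have "G x = h * F x" if "x \<in> B" for x
  proof -
    have "F y * G x = F y * (h * F x)" unfolding eq[OF that y(1), symmetric] h by (simp only: ac_simps)
    then show ?thesis by (rule mult_left_cancel[OF y(2), THEN iffD1])
  qed
  then show ?thesis by blast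
next
  case False
  \<comment> \<open>If all \<open>F x\<close> were 0, then 0 would be a common divisor and hence a
    unit.\<close>
  then have "0 dvd (1 :: 'r)" using assms(1) unfolding unimodular_def by auto
  then have "(1::'r) = 0" by simp
  then have "False" by simp
  then show ?thesis ..
qed

lemma unimodular_factor:
  fixes G :: "'x \<Rightarrow> 'r::factorial_ring_gcd"
  assumes "\<exists>x\<in>B. G x \<noteq> 0"
  shows "\<exists>d F. d \<noteq> 0 \<and> unimodular B F \<and> (\<forall>x\<in>B. G x = d * F x)"
proof -
  define d where "d = Gcd (G ` B)"
  have d0: "d \<noteq> 0" using assms by (auto simp: d_def)
  define F where "F = (\<lambda>x. G x div d)"
  have F: "G x = d * F x" if "x \<in> B" for x
    using that by (simp add: F_def d_def dvd_mult_div_cancel Gcd_dvd)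
  have "unimodular B F" unfolding unimodular_def
  proof (intro allI impI)
    fix e assume "\<forall>x\<in>B. e dvd F x"
    then have "\<forall>x\<in>B. d * e dvd G x" using F by (auto intro: mult_dvd_mono)
    then have "d * e dvd Gcd (G ` B)" by (intro Gcd_greatest) blast
    then have "d * e dvd d * 1" by (simp only: d_def mult_1_right)
    then show "e dvd 1" using d0 dvd_mult_cancel_left[of d e 1] by blast
  qed
  with d0 F show ?thesis by blast
qed

text \<open>The ratio \<open>h\<close> is a mere function at the start. Without common roots the
  tuple \<open>Q\<close> is unimodular, so \<open>h\<close> is a polynomial; having no roots itself,
  it is constant.\<close>

lemma proportional_p1:
  fixes P Q :: "'x \<Rightarrow> 'k::{alg_closed_field, field_char_0} p1"
  assumes Q: "\<And>t. \<exists>x\<in>B. ev1 (Q x) t \<noteq> 0"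
    and h: "\<And>t. h t \<noteq> 0" "\<And>x t. x \<in> B \<Longrightarrow> ev1 (P x) t = h t * ev1 (Q x) t"
  shows "\<exists>k. k \<noteq> 0 \<and> (\<forall>t. h t = k)"
proof -
  have "unimodular B Q" unfolding unimodular_def
  proof (intro allI impI)
    fix d assume d: "\<forall>x\<in>B. d dvd Q x"
    have "ev1 d t \<noteq> 0" for t
    proof -
      obtain x where "x \<in> B" "ev1 (Q x) t \<noteq> 0" using Q by blast
      moreover with d have "d dvd Q x" by blast
      moreover then obtain e where "Q x = d * e" by (rule dvdE)
      ultimately show ?thesis by auto
    qed
    then obtain k where "k \<noteq> 0" "d = [:to_ac k:]" using p1_nonvanishing_const by blast
    then show "d dvd 1" by (simp add: is_unit_pCons_iff dvd_field_iff)
  qed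
  moreover have "Q x * P y = Q y * P x" if "x \<in> B" "y \<in> B" for x y
    by (rule ev1_eqI) (simp add: h that)
  ultimately obtain g where g: "\<forall>x\<in>B. P x = g * Q x"
    using unimodular_dvd_proportional by blast
  have eq: "ev1 g t = h t" for t
  proof -
    obtain x where x: "x \<in> B" "ev1 (Q x) t \<noteq> 0" using Q by blast
    then have "ev1 g t * ev1 (Q x) t = h t * ev1 (Q x) t" using g h(2)[OF x(1), of t] x(1) by simp
    then show ?thesis using x by simp
  qed
  then have "\<And>t. ev1 g t \<noteq> 0" using h by simp
  then obtain k where "k \<noteq> 0" "g = [:to_ac k:]" using p1_nonvanishing_const by blast
  then show ?thesis using eq by (intro exI[of _ k]) (auto simp flip: eq)
qed

section \<open>Regular maps along polynomial maps\<close>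

definition ev_tuple :: "'x set \<Rightarrow> ('x \<Rightarrow> 'k::alg_closed_field p3) \<Rightarrow> 'k \<Rightarrow> 'k \<Rightarrow> 'k \<Rightarrow> 'x \<Rightarrow> 'k" where
  "ev_tuple B F a b c = (\<lambda>x. if x \<in> B then ev3 (F x) a b c else 0)"

lemma ev_tuple_dual [simp]: "ev_tuple B F a b c \<in> dual_space B"
  by (simp add: ev_tuple_def dual_space_def)

lemma mem_line: "u \<in> line u"
  unfolding line_def by (rule CollectI, rule exI[of _ 1]) simp

lemma line_scale: "c \<noteq> (0::'k::field) \<Longrightarrow> line (\<lambda>x. c * u x) = line u"
  unfolding line_def
proof safe
  fix d assume c: "c \<noteq> 0"
  show "\<exists>ca. (\<lambda>x. d * (c * u x)) = (\<lambda>x. ca * u x) \<and> True" by (rule exI[of _ "d * c"]) (simp add: mult.assoc)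
  show "\<exists>ca. (\<lambda>x. d * u x) = (\<lambda>x. ca * (c * u x)) \<and> True" using c by (intro exI[of _ "d / c"]) simp
qed

lemma line_eqD:
  assumes "line u = line v" "v \<noteq> (\<lambda>x. 0)"
  shows "\<exists>c::'k::field. c \<noteq> 0 \<and> v = (\<lambda>x. c * u x)"
proof -
  have "v \<in> line u" using mem_line[of v] assms(1) by simp
  then obtain c where c: "v = (\<lambda>x. c * u x)" by (auto simp: line_def)
  with assms(2) have "c \<noteq> 0" by auto
  with c show ?thesis by blast
qed

lemma line_cong_mem: "v \<in> line u \<Longrightarrow> v \<noteq> (\<lambda>x. 0) \<Longrightarrow> line v = line (u :: _ \<Rightarrow> 'k::field)"
proof -
  assume "v \<in> line u" and nz: "v \<noteq> (\<lambda>x. 0)"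
  then obtain c where c: "v = (\<lambda>x. c * u x)" by (auto simp: line_def)
  with nz have "c \<noteq> 0" by auto
  then show "line v = line u" unfolding c by (rule line_scale)
qed

lemma line_in_proj: "u \<in> dual_space B \<Longrightarrow> u \<noteq> (\<lambda>x. 0) \<Longrightarrow> line u \<in> proj_space B"
  by (auto simp: proj_space_def)

lemma proj_spaceE:
  assumes "p \<in> proj_space B"
  obtains u where "u \<in> dual_space B" "u \<noteq> (\<lambda>x. 0)" "p = line u"
  using assms by (auto simp: proj_space_def)

lemma hom_poly_scale:
  assumes "F \<in> homogeneous_poly B d"
  shows "F (\<lambda>x. c * u x) = c ^ d * F u"
proof -
  obtain a where F: "F = (\<lambda>u. \<Sum>m\<in>{m. (\<forall>x. x \<notin> B \<longrightarrow> m x = 0) \<and> (\<Sum>x\<in>B. m x) = d}. a m * (\<Prod>x\<in>B. u x ^ m x))"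
    using assms by (auto simp: homogeneous_poly_def)
  show ?thesis unfolding F sum_distrib_left
    by (intro sum.cong refl) (auto simp: power_mult_distrib prod.distrib power_sum)
qed

lemma hom_poly_pull:
  assumes "F \<in> homogeneous_poly B d"
  shows "\<exists>q. \<forall>a b c. ev3 q a b c = F (ev_tuple B L a b c)"
proof -
  obtain k where F: "F = (\<lambda>u. \<Sum>m\<in>{m. (\<forall>x. x \<notin> B \<longrightarrow> m x = 0) \<and> (\<Sum>x\<in>B. m x) = d}. k m * (\<Prod>x\<in>B. u x ^ m x))"
    using assms by (auto simp: homogeneous_poly_def)
  define q where "q = (\<Sum>m\<in>{m. (\<forall>x. x \<notin> B \<longrightarrow> m x = 0) \<and> (\<Sum>x\<in>B. m x) = d}.
    [:[:[:to_ac (k m):]:]:] * (\<Prod>x\<in>B. L x ^ m x))"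
  have "ev3 q a b c = F (ev_tuple B L a b c)" for a b c
    unfolding q_def F by (simp only: ev3_sum ev3_simps ev3_gen ev3_prod ev3_power of_ac_to_ac ev_tuple_def if_True cong: prod.cong)
  then show ?thesis by blast
qed

lemma ev_tuple_nonzero: "ev_tuple B F a b c \<noteq> (\<lambda>x. 0) \<longleftrightarrow> (\<exists>x\<in>B. ev3 (F x) a b c \<noteq> 0)"
  by (auto simp: ev_tuple_def fun_eq_iff)

text \<open>The closed set \<open>Z\<close> of the local description is traded for the zero set of
  one polynomial \<open>s\<close>, the pullback of an equation of \<open>Z\<close> that fails at the
  given point. The map is thus described on a principal open set of the parameter space.\<close>

lemma regular_local_pullback:
  fixes f :: "('x \<Rightarrow> 'k::{alg_closed_field, field_char_0}) set \<Rightarrow> ('x \<Rightarrow> 'k) set"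
  assumes f: "regular_map B (proj_space B) (proj_space B) f" and L: "ev_tuple B L a b c \<noteq> (\<lambda>x. 0)"
  shows "\<exists>G s. ev3 s a b c \<noteq> 0 \<and> (\<forall>a b c. ev_tuple B L a b c \<noteq> (\<lambda>x. 0) \<longrightarrow> ev3 s a b c \<noteq> 0 \<longrightarrow>
    ev_tuple B G a b c \<noteq> (\<lambda>x. 0) \<and> f (line (ev_tuple B L a b c)) = line (ev_tuple B G a b c))"
proof -
  define p where "p = line (ev_tuple B L a b c)"
  have p: "p \<in> proj_space B" unfolding p_def by (rule line_in_proj[OF ev_tuple_dual L])
  have "\<forall>p\<in>proj_space B. \<exists>Z d F. projective_variety B Z \<and> p \<notin> Z \<and>
        (\<forall>x\<in>B. F x \<in> homogeneous_poly B d) \<and>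
        (\<forall>q\<in>proj_space B - Z. \<forall>u\<in>q. u \<noteq> (\<lambda>x. 0) \<longrightarrow>
           (\<exists>x\<in>B. F x u \<noteq> 0) \<and> f q = line (\<lambda>x. if x \<in> B then F x u else 0))"
    using f unfolding regular_map_def by (rule conjunct2)
  from bspec[OF this p] obtain Z d F where Z: "projective_variety B Z" "p \<notin> Z" and F: "\<forall>x\<in>B. F x \<in> homogeneous_poly B d"
    and fF: "\<forall>q\<in>proj_space B - Z. \<forall>u\<in>q. u \<noteq> (\<lambda>x. 0) \<longrightarrow>
           (\<exists>x\<in>B. F x u \<noteq> 0) \<and> f q = line (\<lambda>x. if x \<in> B then F x u else 0)"
    by (elim exE conjE)
  obtain S where S: "S \<subseteq> (\<Union>d. homogeneous_poly B d)" "Z = {p \<in> proj_space B. \<forall>F\<in>S. \<forall>u\<in>p. F u = 0}"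
    using Z(1) unfolding projective_variety_def by blast
  obtain H u where H: "H \<in> S" "u \<in> p" "H u \<noteq> 0" using Z(2) S(2) p by blast
  obtain e where e: "H \<in> homogeneous_poly B e" using S(1) H(1) by blast
  obtain s where s: "\<forall>a b c. ev3 s a b c = H (ev_tuple B L a b c)" using hom_poly_pull[OF e] by blast
  have "\<forall>x\<in>B. \<exists>q. \<forall>a b c. ev3 q a b c = F x (ev_tuple B L a b c)" using hom_poly_pull F by blast
  then obtain G where G: "\<forall>x\<in>B. \<forall>a b c. ev3 (G x) a b c = F x (ev_tuple B L a b c)" by metis
  \<comment> \<open>The equation is known to fail at some representative \<open>u\<close> of the
    point; homogeneity moves this to the representative given by \<open>L\<close>.\<close>
  obtain k where "u = (\<lambda>x. k * ev_tuple B L a b c x)" using H(2) by (auto simp: p_def line_def)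
  then have "ev3 s a b c \<noteq> 0" using H(3) hom_poly_scale[OF e] s by auto
  moreover have "ev_tuple B G a' b' c' \<noteq> (\<lambda>x. 0) \<and> f (line (ev_tuple B L a' b' c')) = line (ev_tuple B G a' b' c')"
    if nz: "ev_tuple B L a' b' c' \<noteq> (\<lambda>x. 0)" and s0: "ev3 s a' b' c' \<noteq> 0" for a' b' c'
  proof -
    have "line (ev_tuple B L a' b' c') \<in> proj_space B - Z"
      using line_in_proj[OF ev_tuple_dual nz] s0 s H(1) mem_line unfolding S(2) by fastforce
    then have "(\<exists>x\<in>B. F x (ev_tuple B L a' b' c') \<noteq> 0) \<and>
       f (line (ev_tuple B L a' b' c')) = line (\<lambda>x. if x \<in> B then F x (ev_tuple B L a' b' c') else 0)"
      using fF mem_line nz by blast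
    moreover have "(\<lambda>x. if x \<in> B then F x (ev_tuple B L a' b' c') else 0) = ev_tuple B G a' b' c'"
      using G by (auto simp: ev_tuple_def[of B G] fun_eq_iff)
    ultimately show ?thesis using G by (auto simp: ev_tuple_nonzero)
  qed
  ultimately show ?thesis by blast
qed

lemma p3_nonzero_iff:
  "(p :: 'k::{alg_closed_field, field_char_0} p3) \<noteq> 0 \<longleftrightarrow> (\<exists>a b c. ev3 p a b c \<noteq> 0)"
  using ev3_eq_0 by fastforce

text \<open>Proportionality is recorded by vanishing 2 by 2 minors, since polynomial identities
  extend from an open set to all arguments.\<close>

lemma ev_tuple_line_eqD:
  assumes "line (ev_tuple B F a b c) = line (ev_tuple B G a' b' c')"
    and "ev_tuple B G a' b' c' \<noteq> (\<lambda>x. 0)" and "x \<in> B" "y \<in> B"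
  shows "ev3 (F x) a b c * ev3 (G y) a' b' c' = ev3 (F y) a b c * ev3 (G x) a' b' c'"
proof -
  obtain k where "ev_tuple B G a' b' c' = (\<lambda>x. k * ev_tuple B F a b c x)" using line_eqD[OF assms(1,2)] by blast
  then have "ev3 (G z) a' b' c' = k * ev3 (F z) a b c" if "z \<in> B" for z
    using that by (auto simp: ev_tuple_def fun_eq_iff dest: spec[of _ z])
  then show ?thesis using assms(3,4) by simp
qed

text \<open>One local description, divided by its gcd, serves everywhere. Any other local
  description \<open>G\<close> is proportional to it and therefore a polynomial multiple
  \<open>h * F\<close>, so \<open>F\<close> cannot vanish where \<open>G\<close> does not.\<close>

lemma regular_pullback:
  fixes f :: "('x \<Rightarrow> 'k::{alg_closed_field, field_char_0}) set \<Rightarrow> ('x \<Rightarrow> 'k) set"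
  assumes f: "regular_map B (proj_space B) (proj_space B) f" and L: "ev_tuple B L a0 b0 c0 \<noteq> (\<lambda>x. 0)"
  shows "\<exists>F. unimodular B F \<and> (\<forall>a b c. ev_tuple B L a b c \<noteq> (\<lambda>x. 0) \<longrightarrow>
    ev_tuple B F a b c \<noteq> (\<lambda>x. 0) \<and> f (line (ev_tuple B L a b c)) = line (ev_tuple B F a b c))"
proof -
  obtain z where z: "z \<in> B" "ev3 (L z) a0 b0 c0 \<noteq> 0" using L by (auto simp: ev_tuple_nonzero)
  obtain G0 s0 where s0: "ev3 s0 a0 b0 c0 \<noteq> 0"
    and G0: "\<And>a b c. ev_tuple B L a b c \<noteq> (\<lambda>x. 0) \<Longrightarrow> ev3 s0 a b c \<noteq> 0 \<Longrightarrow>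
    ev_tuple B G0 a b c \<noteq> (\<lambda>x. 0) \<and> f (line (ev_tuple B L a b c)) = line (ev_tuple B G0 a b c)"
    using regular_local_pullback[OF f L] by blast
  have "\<exists>x\<in>B. G0 x \<noteq> 0" using G0[OF L s0] p3_nonzero_iff unfolding ev_tuple_nonzero by blast
  from unimodular_factor[OF this] obtain d F where d: "d \<noteq> 0" and F: "unimodular B F" "\<forall>x\<in>B. G0 x = d * F x"
    by (elim exE conjE)
  have "ev_tuple B F a b c \<noteq> (\<lambda>x. 0) \<and> f (line (ev_tuple B L a b c)) = line (ev_tuple B F a b c)"
    if nz: "ev_tuple B L a b c \<noteq> (\<lambda>x. 0)" for a b c
  proof -
    obtain G s where s: "ev3 s a b c \<noteq> 0"
      and G: "\<And>a b c. ev_tuple B L a b c \<noteq> (\<lambda>x. 0) \<Longrightarrow> ev3 s a b c \<noteq> 0 \<Longrightarrow>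
        ev_tuple B G a b c \<noteq> (\<lambda>x. 0) \<and> f (line (ev_tuple B L a b c)) = line (ev_tuple B G a b c)"
      using regular_local_pullback[OF f nz] by blast
    have "F x * G y = F y * G x" if xy: "x \<in> B" "y \<in> B" for x y
    proof -
      \<comment> \<open>The minor vanishes wherever both local descriptions are valid. The
        additional factors make the product vanish at all remaining points too, and then they cancel
        because they are nonzero polynomials.\<close>
      have "d * s * s0 * L z * (F x * G y - F y * G x) = 0"
      proof (rule ev3_eq_0)
        fix a b c
        show "ev3 (d * s * s0 * L z * (F x * G y - F y * G x)) a b c = 0"
        proof (cases "ev3 s a b c = 0 \<or> ev3 s0 a b c = 0 \<or> ev3 (L z) a b c = 0")
          case False
          then have nz: "ev_tuple B L a b c \<noteq> (\<lambda>x. 0)" using z(1) by (auto simp: ev_tuple_nonzero)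
          have "line (ev_tuple B G0 a b c) = line (ev_tuple B G a b c)" using G[OF nz] G0[OF nz] False by simp
          from ev_tuple_line_eqD[OF this _ xy] G[OF nz] False
          have "ev3 (G0 x) a b c * ev3 (G y) a b c = ev3 (G0 y) a b c * ev3 (G x) a b c" by blast
          then have "ev3 d a b c * (ev3 (F x) a b c * ev3 (G y) a b c) = ev3 d a b c * (ev3 (F y) a b c * ev3 (G x) a b c)"
            using F(2) xy by (simp add: mult.assoc)
          then show ?thesis by auto
        qed auto
      qed
      moreover have "s \<noteq> 0" "s0 \<noteq> 0" "L z \<noteq> 0" using s s0 z p3_nonzero_iff by blast+
      ultimately show ?thesis using d by simp
    qed
    then obtain h where h: "\<forall>x\<in>B. G x = h * F x" using unimodular_dvd_proportional[OF F(1)] by blast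
    then have *: "ev_tuple B G a b c = (\<lambda>x. ev3 h a b c * ev_tuple B F a b c x)" by (auto simp: ev_tuple_def fun_eq_iff)
    have nzG: "ev_tuple B G a b c \<noteq> (\<lambda>x. 0)" using G[OF nz s] by blast
    then have h0: "ev3 h a b c \<noteq> 0" using * by auto
    then have "line (ev_tuple B G a b c) = line (ev_tuple B F a b c)" unfolding * by (rule line_scale)
    then show ?thesis using G[OF nz s] nzG * by fastforce
  qed
  with F(1) show ?thesis by blast
qed

lemma ev3_subst_scale:
  fixes p :: "'k::alg_closed_field p3"
  shows "\<exists>q. \<forall>a b d. ev3 q a b d = ev3 p (c ^ e * a) (c * b) (c * d)"
  using ev3_subst[where p = p and \<alpha> = "[:[:[:to_ac (c ^ e):]:]:] * [:0, 1:]"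
      and \<beta> = "[:[:[:to_ac c:]:]:] * [:[:0, 1:]:]" and \<gamma> = "[:[:[:to_ac c:]:]:] * [:[:[:0, 1:]:]:]"] by (simp only: ev3_simps ev3_gen of_ac_to_ac)

text \<open>The number \<open>e\<close> is the weight of the first variable: 1 for a coordinate, 0
  for a parameter. Scaling the arguments does not move the point, so it changes \<open>F\<close> by
  a polynomial factor \<open>h c\<close>. This factor is a unit, hence a constant depending on
  \<open>c\<close>, and as a function of \<open>c\<close> it is a monomial whose exponent is the
  degree \<open>D\<close>.\<close>

lemma regular_pullback_homogeneous:
  fixes f :: "('x \<Rightarrow> 'k::{alg_closed_field, field_char_0}) set \<Rightarrow> ('x \<Rightarrow> 'k) set"
  assumes f: "regular_map B (proj_space B) (proj_space B) f" and L: "ev_tuple B L a0 b0 c0 \<noteq> (\<lambda>x. 0)"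
    and hom: "\<And>c a b d. c \<noteq> 0 \<Longrightarrow> ev_tuple B L (c ^ e * a) (c * b) (c * d) = (\<lambda>x. c ^ j * ev_tuple B L a b d x)"
  shows "\<exists>F D. (\<forall>a b c. ev_tuple B L a b c \<noteq> (\<lambda>x. 0) \<longrightarrow>
      ev_tuple B F a b c \<noteq> (\<lambda>x. 0) \<and> f (line (ev_tuple B L a b c)) = line (ev_tuple B F a b c)) \<and>
    (\<forall>c a b d. c \<noteq> 0 \<longrightarrow> ev_tuple B F (c ^ e * a) (c * b) (c * d) = (\<lambda>x. c ^ D * ev_tuple B F a b d x))"
proof -
  obtain z where z: "z \<in> B" "ev3 (L z) a0 b0 c0 \<noteq> 0" using L by (auto simp: ev_tuple_nonzero)
  obtain F where un: "unimodular B F" and F: "\<And>a b c. ev_tuple B L a b c \<noteq> (\<lambda>x. 0) \<Longrightarrow>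
    ev_tuple B F a b c \<noteq> (\<lambda>x. 0) \<and> f (line (ev_tuple B L a b c)) = line (ev_tuple B F a b c)"
    using regular_pullback[OF f L] by blast
  obtain y where y: "y \<in> B" "ev3 (F y) a0 b0 c0 \<noteq> 0" using F[OF L] by (auto simp: ev_tuple_nonzero)
  have y0: "F y \<noteq> 0" using y p3_nonzero_iff by blast
  have "\<exists>h. \<forall>x\<in>B. \<forall>a b d. ev3 (F x) (c ^ e * a) (c * b) (c * d) = ev3 h a b d * ev3 (F x) a b d"
    if c: "c \<noteq> 0" for c
  proof -
    have "\<forall>x. \<exists>q. \<forall>a b d. ev3 q a b d = ev3 (F x) (c ^ e * a) (c * b) (c * d)" using ev3_subst_scale by blast
    then obtain Fc where Fc: "\<And>x a b d. ev3 (Fc x) a b d = ev3 (F x) (c ^ e * a) (c * b) (c * d)" by metis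
    have "F x * Fc x' = F x' * Fc x" if xy: "x \<in> B" "x' \<in> B" for x x'
    proof -
      have "L z * (F x * Fc x' - F x' * Fc x) = 0"
      proof (rule ev3_eq_0)
        fix a b d
        show "ev3 (L z * (F x * Fc x' - F x' * Fc x)) a b d = 0"
        proof (cases "ev3 (L z) a b d = 0")
          case False
          then have nz: "ev_tuple B L a b d \<noteq> (\<lambda>x. 0)" using z(1) by (auto simp: ev_tuple_nonzero)
          then obtain w where w: "ev_tuple B L a b d w \<noteq> 0" by auto
          have nz': "ev_tuple B L (c ^ e * a) (c * b) (c * d) \<noteq> (\<lambda>x. 0)"
            unfolding hom[OF c] using c w by (auto dest!: fun_cong[of _ _ w])
          have "line (ev_tuple B L (c ^ e * a) (c * b) (c * d)) = line (ev_tuple B L a b d)"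
            unfolding hom[OF c] using c by (intro line_scale) simp
          then have "line (ev_tuple B F a b d) = line (ev_tuple B F (c ^ e * a) (c * b) (c * d))"
            using F[OF nz] F[OF nz'] by simp
          from ev_tuple_line_eqD[OF this _ xy] F[OF nz'] show ?thesis by (simp add: Fc)
        qed auto
      qed
      moreover have "L z \<noteq> 0" using z p3_nonzero_iff by blast
      ultimately show ?thesis by simp
    qed
    from unimodular_dvd_proportional[OF un this] obtain h where "\<forall>x\<in>B. Fc x = h * F x" by blast
    then have "\<forall>x\<in>B. \<forall>a b d. ev3 (F x) (c ^ e * a) (c * b) (c * d) = ev3 h a b d * ev3 (F x) a b d"
      using Fc by (metis ev3_simps(2))
    then show ?thesis by blast
  qed
  then obtain h where h: "\<And>c x a b d. c \<noteq> 0 \<Longrightarrow> x \<in> B \<Longrightarrow>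
      ev3 (F x) (c ^ e * a) (c * b) (c * d) = ev3 (h c) a b d * ev3 (F x) a b d" by metis
  define \<mu> where "\<mu> c = ev3 (h c) 0 0 0" for c
  \<comment> \<open>Scaling by \<open>c\<close> and then by \<open>1 / c\<close> returns
    \<open>F\<close>, so the two factors multiply to 1.\<close>
  have unit: "h c dvd 1" if c: "c \<noteq> 0" for c
  proof -
    obtain h' where h': "\<And>a b d. ev3 h' a b d = ev3 (h (1 / c)) (c ^ e * a) (c * b) (c * d)"
      using ev3_subst_scale by metis
    have "(h' * h c - 1) * F y = 0"
    proof (rule ev3_eq_0)
      fix a b d
      have "ev3 (F y) a b d = ev3 (h (1 / c)) (c ^ e * a) (c * b) (c * d) * ev3 (F y) (c ^ e * a) (c * b) (c * d)"
        using h[of "1 / c" y "c ^ e * a" "c * b" "c * d"] c y by (simp add: power_one_over)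
      also have "\<dots> = ev3 h' a b d * ev3 (h c) a b d * ev3 (F y) a b d"
        using h[OF c y(1)] h' by simp
      finally show "ev3 ((h' * h c - 1) * F y) a b d = 0" by (simp add: algebra_simps)
    qed
    then have "1 = h c * h'" using y0 by (simp add: mult.commute)
    then show ?thesis by (rule dvdI)
  qed
  have \<mu>: "ev3 (F x) (c ^ e * a) (c * b) (c * d) = \<mu> c * ev3 (F x) a b d" if "c \<noteq> 0" "x \<in> B" for c x a b d
    using h[OF that] ev3_unit_const(1)[OF unit[OF that(1)]] by (simp add: \<mu>_def)
  have \<mu>0: "\<mu> c \<noteq> 0" if "c \<noteq> 0" for c using ev3_unit_const(2)[OF unit[OF that]] by (simp add: \<mu>_def)
  \<comment> \<open>Along the curve through \<open>(a0, b0, c0)\<close> with these weights, the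
    scaling factor times the fixed nonzero value of \<open>F y\<close> is a polynomial in
    \<open>t\<close>. The value at \<open>t = 1\<close> then shows that the monomial has coefficient
    1 after division by that value.\<close>
  obtain r where r: "\<And>t. ev1 r t = ev3 (F y) (t ^ e * a0) (t * b0) (t * c0)"
    using ev3_curve[of "F y" "[:0, 1:] ^ e * [:to_ac a0:]" "[:0, 1:] * [:to_ac b0:]" "[:0, 1:] * [:to_ac c0:]"]
    by (auto simp only: ev1_simps ev1_power of_ac_to_ac)
  have "ev1 r t \<noteq> 0" if "t \<noteq> 0" for t using \<mu>[OF that y(1)] \<mu>0[OF that] y(2) r by simp
  then obtain k D where kD: "\<And>t. ev1 r t = k * t ^ D" using p1_no_nonzero_root by metis
  have \<mu>D: "\<mu> c * ev3 (F y) a0 b0 c0 = k * c ^ D" if "c \<noteq> 0" for c using \<mu>[OF that y(1)] r kD by metis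
  have "k = ev3 (F y) a0 b0 c0" using kD[of 1] r[of 1] by simp
  then have "\<mu> c = c ^ D" if "c \<noteq> 0" for c using \<mu>D[OF that] y(2) by simp
  then have "ev_tuple B F (c ^ e * a) (c * b) (c * d) = (\<lambda>x. c ^ D * ev_tuple B F a b d x)" if "c \<noteq> 0" for c a b d
    using \<mu>[OF that] that by (auto simp: ev_tuple_def fun_eq_iff)
  with F show ?thesis by blast
qed

text \<open>A vector-valued form of degree \<open>D\<close> in two variables without zeros away from
  the origin. Polynomiality is demanded only in the two affine charts \<open>s = 1\<close> and
  \<open>t = 1\<close>, where ratios of forms are compared.\<close>

definition binary_form :: "'x set \<Rightarrow> nat \<Rightarrow> ('k::alg_closed_field \<Rightarrow> 'k \<Rightarrow> 'x \<Rightarrow> 'k) \<Rightarrow> bool" where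
  "binary_form B D \<phi> \<longleftrightarrow>
    (\<forall>x\<in>B. \<exists>p. \<forall>t. ev1 p t = \<phi> 1 t x) \<and> (\<forall>x\<in>B. \<exists>p. \<forall>t. ev1 p t = \<phi> t 1 x) \<and>
    (\<forall>c s t. c \<noteq> 0 \<longrightarrow> \<phi> (c * s) (c * t) = (\<lambda>x. c ^ D * \<phi> s t x)) \<and>
    (\<forall>s t. s \<noteq> 0 \<or> t \<noteq> 0 \<longrightarrow> (\<exists>x\<in>B. \<phi> s t x \<noteq> 0))"

lemma binary_formD:
  assumes "binary_form B D \<phi>"
  shows "\<forall>x\<in>B. \<exists>p. \<forall>t. ev1 p t = \<phi> 1 t x" "\<forall>x\<in>B. \<exists>p. \<forall>t. ev1 p t = \<phi> t 1 x"
    "c \<noteq> 0 \<Longrightarrow> \<phi> (c * s) (c * t) = (\<lambda>x. c ^ D * \<phi> s t x)"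
    "\<exists>x\<in>B. \<phi> 1 t x \<noteq> 0" "\<exists>x\<in>B. \<phi> t 1 x \<noteq> 0"
  using assms unfolding binary_form_def by simp_all

lemma binary_form_ratio:
  fixes P Q :: "'k::{alg_closed_field, field_char_0} \<Rightarrow> 'x \<Rightarrow> 'k"
  assumes "\<forall>x\<in>B. \<exists>p. \<forall>t. ev1 p t = P t x" "\<forall>x\<in>B. \<exists>p. \<forall>t. ev1 p t = Q t x"
    and nzP: "\<And>t. \<exists>x\<in>B. P t x \<noteq> 0" and nzQ: "\<And>t. \<exists>x\<in>B. Q t x \<noteq> 0"
    and eq: "\<And>t. line (P t) = line (Q t)"
  shows "\<exists>k. k \<noteq> 0 \<and> (\<forall>t x. P t x = k * Q t x)"
proof -
  obtain p where p: "\<And>x t. x \<in> B \<Longrightarrow> ev1 (p x) t = P t x" using assms(1) by metis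
  obtain q where q: "\<And>x t. x \<in> B \<Longrightarrow> ev1 (q x) t = Q t x" using assms(2) by metis
  have "\<forall>t. \<exists>h. h \<noteq> 0 \<and> P t = (\<lambda>x. h * Q t x)"
    using line_eqD[OF eq[symmetric]] nzP by (metis (no_types))
  then obtain h where h: "\<And>t. h t \<noteq> 0" "\<And>t. P t = (\<lambda>x. h t * Q t x)" by metis
  have "\<exists>k. k \<noteq> 0 \<and> (\<forall>t. h t = k)"
    by (rule proportional_p1[of B q h p]) (use nzQ q p h in fastforce)+
  then show ?thesis using h(2) by metis
qed

text \<open>On each chart the ratio of the two forms is constant, and the constants agree at
  \<open>(1, 1)\<close>. Evaluation at \<open>(2, 1)\<close>, which is twice
  \<open>(1, 1/2)\<close>, then gives \<open>2^D = 2^D'\<close> in the field, and characteristic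
  zero makes this an equation of integers.\<close>

lemma binary_form_degree_unique:
  fixes \<phi> \<psi> :: "'k::{alg_closed_field, field_char_0} \<Rightarrow> 'k \<Rightarrow> 'x \<Rightarrow> 'k"
  assumes \<phi>: "binary_form B D \<phi>" and \<psi>: "binary_form B D' \<psi>"
    and eq: "\<And>s t. s \<noteq> 0 \<or> t \<noteq> 0 \<Longrightarrow> line (\<phi> s t) = line (\<psi> s t)"
  shows "D = D'"
proof -
  note \<phi>' = binary_formD[OF \<phi>] and \<psi>' = binary_formD[OF \<psi>]
  have "\<exists>k. k \<noteq> 0 \<and> (\<forall>t x. \<phi> 1 t x = k * \<psi> 1 t x)"
    by (rule binary_form_ratio[of B "\<phi> 1" "\<psi> 1", OF \<phi>'(1) \<psi>'(1) \<phi>'(4) \<psi>'(4)]) (simp add: eq)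
  then obtain k where k: "k \<noteq> 0" "\<And>t x. \<phi> 1 t x = k * \<psi> 1 t x" by blast
  have "\<exists>k. k \<noteq> 0 \<and> (\<forall>t x. \<phi> t 1 x = k * \<psi> t 1 x)"
    by (rule binary_form_ratio[of B "\<lambda>t. \<phi> t 1" "\<lambda>t. \<psi> t 1", OF \<phi>'(2) \<psi>'(2) \<phi>'(5) \<psi>'(5)]) (simp add: eq)
  then obtain l where l: "l \<noteq> 0" "\<And>t x. \<phi> t 1 x = l * \<psi> t 1 x" by blast
  obtain x where x: "\<psi> 1 1 x \<noteq> 0" using \<psi>'(4) by blast
  have kl: "k = l" using k(2)[of 1 x] l(2)[of 1 x] x by simp
  obtain y where y: "\<psi> 2 1 y \<noteq> 0" using \<psi>'(5) by blast
  have "\<phi> (2 * 1) (2 * (1 / 2)) = (\<lambda>x. 2 ^ D * \<phi> 1 (1 / 2) x)"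
    "\<psi> (2 * 1) (2 * (1 / 2)) = (\<lambda>x. 2 ^ D' * \<psi> 1 (1 / 2) x)"
    by (rule \<phi>'(3) \<psi>'(3), simp)+
  then have "\<phi> 2 1 y = 2 ^ D * \<phi> 1 (1 / 2) y" "\<psi> 2 1 y = 2 ^ D' * \<psi> 1 (1 / 2) y" by simp_all
  then have "l * 2 ^ D' * \<psi> 1 (1 / 2) y = 2 ^ D * k * \<psi> 1 (1 / 2) y" "\<psi> 1 (1 / 2) y \<noteq> 0"
    using l(2)[of 2 y] k(2) y by auto
  then have "(2::'k) ^ D' = 2 ^ D" using kl k by simp
  then have "(of_nat (2 ^ D') :: 'k) = of_nat (2 ^ D)" by simp
  then have "(2::nat) ^ D' = 2 ^ D" by (rule of_nat_eq_iff[THEN iffD1])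
  then show ?thesis by simp
qed

lemma p1_degree_le_1: "Polynomial.degree r \<le> 1 \<Longrightarrow> \<exists>a b. r = [:a, b:]"
  by (intro exI[of _ "Polynomial.coeff r 0"] exI[of _ "Polynomial.coeff r 1"] poly_eqI)
    (auto simp: coeff_pCons coeff_eq_0 split: nat.splits)

lemma ev1_lin: "ev1 [:a, b:] t = of_ac a + t * of_ac (b :: 'k::alg_closed_field alg_closure)"
  by (simp add: ev1_def)

text \<open>The relation forces both polynomials to have degree at most 1 and reversed coefficients,
  so the right-hand side is the sum of the two coefficients of \<open>r\<close>. It serves to derive
  additivity from homogeneity of degree 1.\<close>

lemma p1_linear:
  fixes r s :: "'k::{alg_closed_field, field_char_0} p1"
  assumes "\<And>t. t \<noteq> 0 \<Longrightarrow> ev1 r t = t * ev1 s (1 / t)"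
  shows "ev1 r 1 = ev1 r 0 + ev1 s 0"
proof -
  have deg: "Polynomial.degree r \<le> 1"
    if rs: "\<And>t. t \<noteq> 0 \<Longrightarrow> ev1 r t = t * ev1 s (1 / t)" for r s :: "'k p1"
  proof (cases "r = 0")
    case False
    let ?n = "Polynomial.degree s"
    \<comment> \<open>For \<open>n\<close> the degree of \<open>s\<close>, \<open>t^n s(1/t)\<close>
      is the reflected polynomial, of degree at most \<open>n\<close>; comparing degrees bounds the
      degree of \<open>r\<close> by 1.\<close>
    have "r * [:0, 1:] ^ ?n = [:0, 1:] * reflect_poly s"
    proof (rule ev1_eqI)
      fix t :: 'k assume t: "t \<noteq> 0"
      have "ev1 (reflect_poly s) t = t ^ ?n * ev1 s (1 / t)"
        unfolding ev1_def using t
        by (simp add: poly_reflect_poly_nz inverse_eq_divide flip: to_ac_power)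
      then show "ev1 (r * [:0, 1:] ^ ?n) t = ev1 ([:0, 1:] * reflect_poly s) t"
        using rs[OF t] by (simp del: mult_pCons_left)
    qed
    then have "Polynomial.degree (r * [:0, 1:] ^ ?n) \<le> 1 + Polynomial.degree (reflect_poly s)"
      using degree_mult_le[of "[:0, 1:]" "reflect_poly s"] by simp
    moreover have "Polynomial.degree (r * [:0, 1:] ^ ?n) = Polynomial.degree r + ?n"
      using False by (subst degree_mult_eq) (auto simp: degree_power_eq)
    ultimately show ?thesis using degree_reflect_poly_le[of s] by linarith
  qed simp
  have sr: "ev1 s t = t * ev1 r (1 / t)" if "t \<noteq> 0" for t using assms[of "1 / t"] that by simp
  obtain r0 r1 where r: "r = [:r0, r1:]" using p1_degree_le_1[OF deg[OF assms]] by blast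
  obtain s0 s1 where s: "s = [:s0, s1:]" using p1_degree_le_1[OF deg[OF sr]] by blast
  have "r = [:s1, s0:]"
  proof (rule ev1_eqI)
    fix t :: 'k assume t: "t \<noteq> 0"
    have "ev1 r t = t * (of_ac s0 + 1 / t * of_ac s1)" using assms[OF t] unfolding s ev1_lin .
    also have "\<dots> = of_ac s1 + t * of_ac s0" using t by (simp add: distrib_left)
    finally show "ev1 r t = ev1 [:s1, s0:] t" unfolding ev1_lin .
  qed
  then show ?thesis unfolding s by (simp add: ev1_lin)
qed

text \<open>Put \<open>r(t) = p(v + t v')\<close> and \<open>s(t) = p(v' + t v)\<close>. Homogeneity
  gives \<open>r(t) = t s(1/t)\<close>, so \<open>p1_linear\<close> yields
  \<open>p(v + v') = p(v) + p(v')\<close>.\<close>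

lemma ev3_linear:
  fixes p :: "'k::{alg_closed_field, field_char_0} p3"
  assumes hom: "\<And>c a b d. c \<noteq> 0 \<Longrightarrow> ev3 p (c * a) (c * b) (c * d) = c * ev3 p a b d"
  shows "ev3 p a b d = a * ev3 p 1 0 0 + b * ev3 p 0 1 0 + d * ev3 p 0 0 1"
proof -
  have add: "ev3 p (a + a') (b + b') (d + d') = ev3 p a b d + ev3 p a' b' d'" for a b d a' b' d'
  proof -
    obtain r where r: "\<And>t. ev1 r t = ev3 p (a + t * a') (b + t * b') (d + t * d')" using ev3_affine_line by metis
    obtain s where s: "\<And>t. ev1 s t = ev3 p (a' + t * a) (b' + t * b) (d' + t * d)" using ev3_affine_line by metis
    have "ev1 r t = t * ev1 s (1 / t)" if "t \<noteq> 0" for t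
    proof -
      have "t * (x + 1 / t * y) = y + t * x" for x y using that by (simp add: distrib_left)
      then show ?thesis unfolding r s hom[OF that, symmetric] by simp
    qed
    from p1_linear[OF this] show ?thesis using r[of 1] r[of 0] s[of 0] by simp
  qed
  \<comment> \<open>The scaling law excludes \<open>c = 0\<close>; the value at the origin is
    obtained from \<open>c = 2\<close>.\<close>
  have "2 * ev3 p 0 0 0 = 1 * ev3 p 0 0 0" using hom[of 2 0 0 0] by simp
  then have zero: "ev3 p 0 0 0 = 0" by (simp only: mult_cancel_right) simp
  have scale: "ev3 p (c * a) (c * b) (c * d) = c * ev3 p a b d" for c a b d
    using hom[of c a b d] zero by (cases "c = 0") auto
  have "ev3 p a b d = ev3 p a 0 0 + (ev3 p 0 b 0 + ev3 p 0 0 d)"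
    using add[of a 0 0 b 0 d] add[of 0 0 b 0 0 d] by simp
  also have "\<dots> = a * ev3 p 1 0 0 + b * ev3 p 0 1 0 + d * ev3 p 0 0 1"
    using scale[of a 1 0 0] scale[of b 0 1 0] scale[of d 0 0 1] by simp
  finally show ?thesis .
qed

section \<open>Automorphisms of projective space are linear\<close>

abbreviation lc2 :: "'k::field \<Rightarrow> ('x \<Rightarrow> 'k) \<Rightarrow> 'k \<Rightarrow> ('x \<Rightarrow> 'k) \<Rightarrow> 'x \<Rightarrow> 'k" where
  "lc2 s u t v \<equiv> \<lambda>x. s * u x + t * v x"

abbreviation lc3 :: "'k::field \<Rightarrow> ('x \<Rightarrow> 'k) \<Rightarrow> 'k \<Rightarrow> ('x \<Rightarrow> 'k) \<Rightarrow> 'k \<Rightarrow> ('x \<Rightarrow> 'k) \<Rightarrow> 'x \<Rightarrow> 'k" where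
  "lc3 r u s v t w \<equiv> \<lambda>x. r * u x + s * v x + t * w x"

definition indep2 :: "('x \<Rightarrow> 'k::field) \<Rightarrow> ('x \<Rightarrow> 'k) \<Rightarrow> bool" where
  "indep2 u v \<longleftrightarrow> (\<forall>s t. s \<noteq> 0 \<or> t \<noteq> 0 \<longrightarrow> lc2 s u t v \<noteq> (\<lambda>x. 0))"

definition indep3 :: "('x \<Rightarrow> 'k::field) \<Rightarrow> ('x \<Rightarrow> 'k) \<Rightarrow> ('x \<Rightarrow> 'k) \<Rightarrow> bool" where
  "indep3 u v w \<longleftrightarrow> (\<forall>r s t. r \<noteq> 0 \<or> s \<noteq> 0 \<or> t \<noteq> 0 \<longrightarrow> lc3 r u s v t w \<noteq> (\<lambda>x. 0))"

lemma dual_lc2: "u \<in> dual_space B \<Longrightarrow> v \<in> dual_space B \<Longrightarrow> lc2 s u t v \<in> dual_space B"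
  by (simp add: dual_space_def)

lemma lc2_eq_ev_tuple:
  assumes "u \<in> dual_space B" "v \<in> dual_space B"
  shows "\<exists>L. \<forall>a b d. ev_tuple B L a b d = lc2 b u d v"
proof -
  define L where "L = (\<lambda>x. [:[:0, 1:]:] * [:[:[:to_ac (u x):]:]:] + [:[:[:0, 1:]:]:] * [:[:[:to_ac (v x):]:]:])"
  have "ev_tuple B L a b d = lc2 b u d v" for a b d
    unfolding ev_tuple_def L_def ev3_simps ev3_gen of_ac_to_ac
    using assms by (auto simp: dual_space_def)
  then show ?thesis by blast
qed

lemma lc3_eq_ev_tuple:
  assumes "u \<in> dual_space B" "v \<in> dual_space B" "w \<in> dual_space B"
  shows "\<exists>L. \<forall>a b d. ev_tuple B L a b d = lc3 a u b v d w"
proof -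
  define L where "L = (\<lambda>x. [:0, 1:] * [:[:[:to_ac (u x):]:]:] + [:[:0, 1:]:] * [:[:[:to_ac (v x):]:]:] + [:[:[:0, 1:]:]:] * [:[:[:to_ac (w x):]:]:])"
  have "ev_tuple B L a b d = lc3 a u b v d w" for a b d
    unfolding ev_tuple_def L_def ev3_simps ev3_gen of_ac_to_ac
    using assms by (auto simp: dual_space_def)
  then show ?thesis by blast
qed

lemma ev_tuple_curve:
  assumes "x \<in> B"
  shows "\<exists>p. \<forall>t. ev1 p t = ev_tuple B F (ev1 \<alpha> t) (ev1 \<beta> t) (ev1 \<gamma> t) x"
  using assms ev3_curve[of "F x" \<alpha> \<beta> \<gamma>] by (simp add: ev_tuple_def)

text \<open>Composition with the covering \<open>(s, t) \<mapsto> (s^n, t^n)\<close> multiplies the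
  degree by \<open>n\<close>; the case \<open>n = 1\<close> is the form itself.\<close>

lemma binary_form_ev_tuple_power:
  fixes F :: "'x \<Rightarrow> 'k::alg_closed_field p3"
  assumes hom: "\<And>c s t. c \<noteq> 0 \<Longrightarrow> ev_tuple B F \<alpha> (c * s) (c * t) = (\<lambda>x. c ^ D * ev_tuple B F \<alpha> s t x)"
    and nz: "\<And>s t. s \<noteq> 0 \<or> t \<noteq> 0 \<Longrightarrow> ev_tuple B F \<alpha> (s ^ n) (t ^ n) \<noteq> (\<lambda>x. 0)"
  shows "binary_form B (n * D) (\<lambda>s t. ev_tuple B F \<alpha> (s ^ n) (t ^ n))"
  unfolding binary_form_def
proof (intro conjI ballI allI impI)
  fix x assume x: "x \<in> B"
  show "\<exists>p. \<forall>t. ev1 p t = ev_tuple B F \<alpha> (1 ^ n) (t ^ n) x"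
    using ev_tuple_curve[OF x, of F "[:to_ac \<alpha>:]" "[:1:]" "[:0, 1:] ^ n"] by (simp only: ev1_simps ev1_power of_ac_to_ac of_ac_1 power_one)
  show "\<exists>p. \<forall>t. ev1 p t = ev_tuple B F \<alpha> (t ^ n) (1 ^ n) x"
    using ev_tuple_curve[OF x, of F "[:to_ac \<alpha>:]" "[:0, 1:] ^ n" "[:1:]"] by (simp only: ev1_simps ev1_power of_ac_to_ac of_ac_1 power_one)
next
  fix c s t :: 'k assume "c \<noteq> 0"
  then show "ev_tuple B F \<alpha> ((c * s) ^ n) ((c * t) ^ n) = (\<lambda>x. c ^ (n * D) * ev_tuple B F \<alpha> (s ^ n) (t ^ n) x)"
    using hom[of "c ^ n"] by (simp add: power_mult_distrib power_mult)
next
  fix s t :: 'k assume "s \<noteq> 0 \<or> t \<noteq> 0"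
  then show "\<exists>x\<in>B. ev_tuple B F \<alpha> (s ^ n) (t ^ n) x \<noteq> 0" using nz[of s t] by (auto simp: ev_tuple_nonzero) (auto simp: ev_tuple_def)
qed

lemma binary_form_ev_tuple:
  fixes F :: "'x \<Rightarrow> 'k::alg_closed_field p3"
  assumes "\<And>c s t. c \<noteq> 0 \<Longrightarrow> ev_tuple B F \<alpha> (c * s) (c * t) = (\<lambda>x. c ^ D * ev_tuple B F \<alpha> s t x)"
    and "\<And>s t. s \<noteq> 0 \<or> t \<noteq> 0 \<Longrightarrow> ev_tuple B F \<alpha> s t \<noteq> (\<lambda>x. 0)"
  shows "binary_form B D (ev_tuple B F \<alpha>)"
  using binary_form_ev_tuple_power[of B F \<alpha> D 1] assms by simp

lemma binary_form_lc2:
  assumes "u \<in> dual_space B" "v \<in> dual_space B" "indep2 u v"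
  shows "binary_form B 1 (\<lambda>s t. lc2 s u t v)"
proof -
  obtain L where L: "\<And>a b d. ev_tuple B L a b d = lc2 b u d v" using lc2_eq_ev_tuple[OF assms(1,2)] by blast
  have "binary_form B 1 (ev_tuple B L 0)"
    by (rule binary_form_ev_tuple) (use assms(3) in \<open>auto simp: L indep2_def algebra_simps\<close>)
  moreover have "ev_tuple B L 0 = (\<lambda>s t. lc2 s u t v)" by (intro ext) (simp add: L)
  ultimately show ?thesis by simp
qed

text \<open>The line is parametrised by the second and third variable. The lift \<open>F\<close> may
  involve the idle first variable as well, so it is evaluated there at 0; the scaling law in all
  three variables is kept for \<open>ev3_linear\<close>.\<close>

lemma regular_line_lift:
  fixes f :: "('x \<Rightarrow> 'k::{alg_closed_field, field_char_0}) set \<Rightarrow> ('x \<Rightarrow> 'k) set"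
  assumes f: "regular_map B (proj_space B) (proj_space B) f"
    and uv: "u \<in> dual_space B" "v \<in> dual_space B" "indep2 u v"
  shows "\<exists>F D. binary_form B D (ev_tuple B F 0) \<and>
    (\<forall>s t. s \<noteq> 0 \<or> t \<noteq> 0 \<longrightarrow> ev_tuple B F 0 s t \<noteq> (\<lambda>x. 0) \<and> f (line (lc2 s u t v)) = line (ev_tuple B F 0 s t)) \<and>
    (\<forall>c a s t. c \<noteq> 0 \<longrightarrow> ev_tuple B F (c * a) (c * s) (c * t) = (\<lambda>x. c ^ D * ev_tuple B F a s t x))"
proof -
  obtain L where L: "\<And>a b d. ev_tuple B L a b d = lc2 b u d v" using lc2_eq_ev_tuple[OF uv(1,2)] by blast
  have ind: "lc2 s u t v \<noteq> (\<lambda>x. 0)" if "s \<noteq> 0 \<or> t \<noteq> 0" for s t using uv(3) that unfolding indep2_def by blast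
  have "ev_tuple B L 0 1 0 \<noteq> (\<lambda>x. 0)" unfolding L by (rule ind) simp
  moreover have "ev_tuple B L (c ^ 1 * a) (c * b) (c * d) = (\<lambda>x. c ^ 1 * ev_tuple B L a b d x)" for c a b d
    by (simp add: L algebra_simps)
  ultimately obtain F D where F: "\<And>a b c. ev_tuple B L a b c \<noteq> (\<lambda>x. 0) \<Longrightarrow>
      ev_tuple B F a b c \<noteq> (\<lambda>x. 0) \<and> f (line (ev_tuple B L a b c)) = line (ev_tuple B F a b c)"
    and "\<And>c a s t. c \<noteq> 0 \<Longrightarrow> ev_tuple B F (c ^ 1 * a) (c * s) (c * t) = (\<lambda>x. c ^ D * ev_tuple B F a s t x)"
    using regular_pullback_homogeneous[OF f, of L 0 1 0 1 1] by blast
  then have D: "\<And>c a s t. c \<noteq> 0 \<Longrightarrow> ev_tuple B F (c * a) (c * s) (c * t) = (\<lambda>x. c ^ D * ev_tuple B F a s t x)"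
    by (simp only: power_one_right)
  have F': "ev_tuple B F 0 s t \<noteq> (\<lambda>x. 0) \<and> f (line (lc2 s u t v)) = line (ev_tuple B F 0 s t)" if "s \<noteq> 0 \<or> t \<noteq> 0" for s t
    using F[of 0 s t] ind[OF that] by (simp add: L)
  have "binary_form B D (ev_tuple B F 0)"
    by (rule binary_form_ev_tuple) (use F' D[of _ 0] in auto)
  with F' D show ?thesis by blast
qed

text \<open>The degree on a line is multiplicative under composition: interpolate linearly between the
  curve \<open>f(\<ell>)\<close>, on which \<open>g\<close> has degree 1, and an \<open>n\<close>-fold covering of a line,
  on which it has \<open>n\<close> times its degree on that line.\<close>

lemma regular_inverse_degree_1:
  fixes f g :: "('x \<Rightarrow> 'k::{alg_closed_field, field_char_0}) set \<Rightarrow> ('x \<Rightarrow> 'k) set"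
  assumes f: "regular_map B (proj_space B) (proj_space B) f"
    and g: "regular_map B (proj_space B) (proj_space B) g" and gf: "\<And>p. p \<in> proj_space B \<Longrightarrow> g (f p) = p"
    and uv: "u \<in> dual_space B" "v \<in> dual_space B" "indep2 u v"
    and F: "binary_form B n (ev_tuple B F 0)"
      "\<And>s t. s \<noteq> 0 \<or> t \<noteq> 0 \<Longrightarrow> ev_tuple B F 0 s t \<noteq> (\<lambda>x. 0) \<and> f (line (lc2 s u t v)) = line (ev_tuple B F 0 s t)"
  shows "n = 1"
proof -
  have ind: "lc2 s u t v \<noteq> (\<lambda>x. 0)" if "s \<noteq> 0 \<or> t \<noteq> 0" for s t using uv(3) that unfolding indep2_def by blast
  \<comment> \<open>The first variable is removed from \<open>F\<close>, to be reused as the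
    interpolation parameter.\<close>
  have "\<exists>q. \<forall>a b d. ev3 q a b d = ev3 (F x) 0 b d" for x
    using ev3_subst[where p = "F x" and \<alpha> = 0 and \<beta> = "[:[:0, 1:]:]" and \<gamma> = "[:[:[:0, 1:]:]:]"] by simp
  then obtain F0 where F0: "\<And>x a b d. ev3 (F0 x) a b d = ev3 (F x) 0 b d" by metis
  \<comment> \<open>The line is covered exactly \<open>n\<close> times so that both ends are
    homogeneous of the same degree \<open>n\<close> in the last two variables; the parameter
    \<open>a\<close> gets weight 0. \<open>L\<close> may have zeros at intermediate values of
    \<open>a\<close>, but the exponent \<open>D\<close> obtained for \<open>g\<close> is the same
    for all \<open>a\<close>.\<close>
  define L where "L = (\<lambda>x. (1 - [:0, 1:]) * F0 x + [:0, 1:] * ([:[:0, 1:]:] ^ n * [:[:[:to_ac (u x):]:]:] + [:[:[:0, 1:]:]:] ^ n * [:[:[:to_ac (v x):]:]:]))"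
  have L: "ev_tuple B L a b d = (\<lambda>x. (1 - a) * ev_tuple B F 0 b d x + a * lc2 (b ^ n) u (d ^ n) v x)" for a b d
    unfolding ev_tuple_def L_def ev3_simps ev3_gen of_ac_to_ac ev3_power ev3_diff F0
    using uv by (auto simp: dual_space_def)
  have L0: "ev_tuple B L 0 b d = ev_tuple B F 0 b d" and L1: "ev_tuple B L 1 b d = lc2 (b ^ n) u (d ^ n) v" for b d
    by (simp_all add: L)
  have "ev_tuple B L 0 1 0 \<noteq> (\<lambda>x. 0)" unfolding L0 using F(2)[of 1 0] by simp
  moreover have "ev_tuple B L (c ^ 0 * a) (c * b) (c * d) = (\<lambda>x. c ^ n * ev_tuple B L a b d x)" if c: "c \<noteq> 0" for a b c d
    unfolding L binary_formD(3)[OF F(1) c] power_0 mult_1_left by (simp add: distrib_left right_diff_distrib left_diff_distrib power_mult_distrib ac_simps)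
  ultimately obtain H D where H: "\<And>a b c. ev_tuple B L a b c \<noteq> (\<lambda>x. 0) \<Longrightarrow>
      ev_tuple B H a b c \<noteq> (\<lambda>x. 0) \<and> g (line (ev_tuple B L a b c)) = line (ev_tuple B H a b c)"
    and D: "\<And>c a b d. c \<noteq> 0 \<Longrightarrow> ev_tuple B H (c ^ 0 * a) (c * b) (c * d) = (\<lambda>x. c ^ D * ev_tuple B H a b d x)"
    using regular_pullback_homogeneous[OF g, of L 0 1 0 0 n] by blast
  have H0: "ev_tuple B H 0 s t \<noteq> (\<lambda>x. 0)" "line (ev_tuple B H 0 s t) = line (lc2 s u t v)" if "s \<noteq> 0 \<or> t \<noteq> 0" for s t
    using H[of 0 s t] F(2)[OF that] gf[OF line_in_proj[OF dual_lc2[OF uv(1,2)] ind[OF that]]] by (simp_all add: L0)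
  have H1: "ev_tuple B H 1 s t \<noteq> (\<lambda>x. 0)" "line (ev_tuple B H 1 s t) = g (line (lc2 (s ^ n) u (t ^ n) v))" if "s \<noteq> 0 \<or> t \<noteq> 0" for s t
  proof -
    have "s ^ n \<noteq> 0 \<or> t ^ n \<noteq> 0" using that by auto
    then have "ev_tuple B L 1 s t \<noteq> (\<lambda>x. 0)" unfolding L1 by (rule ind)
    then show "ev_tuple B H 1 s t \<noteq> (\<lambda>x. 0)" "line (ev_tuple B H 1 s t) = g (line (lc2 (s ^ n) u (t ^ n) v))"
      using H[of 1 s t] by (simp_all add: L1)
  qed
  have bf: "binary_form B D (ev_tuple B H a)" if "\<And>s t. s \<noteq> 0 \<or> t \<noteq> 0 \<Longrightarrow> ev_tuple B H a s t \<noteq> (\<lambda>x. 0)" for a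
    by (rule binary_form_ev_tuple) (use that D in auto)
  \<comment> \<open>At \<open>a = 0\<close> the form represents \<open>g(f(p)) = p\<close> on the
    line, whose linear parametrisation has degree 1.\<close>
  have "D = 1" using binary_form_degree_unique[OF bf binary_form_lc2[OF uv], of 0] H0 by blast
  obtain G m where G: "binary_form B m (ev_tuple B G 0)"
    "\<And>s t. s \<noteq> 0 \<or> t \<noteq> 0 \<Longrightarrow> ev_tuple B G 0 s t \<noteq> (\<lambda>x. 0) \<and> g (line (lc2 s u t v)) = line (ev_tuple B G 0 s t)"
    using regular_line_lift[OF g uv] by blast
  have pow: "s ^ n \<noteq> 0 \<or> t ^ n \<noteq> 0" if "s \<noteq> 0 \<or> t \<noteq> 0" for s t :: 'k using that by auto
  have 2: "binary_form B (n * m) (\<lambda>s t. ev_tuple B G 0 (s ^ n) (t ^ n))"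
    by (rule binary_form_ev_tuple_power, erule binary_formD(3)[OF G(1)], rule G(2)[OF pow, THEN conjunct1])
  \<comment> \<open>Here \<open>m\<close> is the degree of \<open>g\<close> on the line itself.
    Together with \<open>D = 1\<close> this forces \<open>n = 1\<close>.\<close>
  have "D = n * m"
  proof (rule binary_form_degree_unique[OF bf 2])
    fix s t :: 'k assume st: "s \<noteq> 0 \<or> t \<noteq> 0"
    then show "ev_tuple B H 1 s t \<noteq> (\<lambda>x. 0)" by (rule H1)
    show "line (ev_tuple B H 1 s t) = line (ev_tuple B G 0 (s ^ n) (t ^ n))" using H1(2)[OF st] G(2)[OF pow[OF st]] by simp
  qed
  with \<open>D = 1\<close> show "n = 1" by simp
qed

text \<open>Once the degree is 1, the scaling law makes every coordinate of the lift a linear form,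
  by \<open>ev3_linear\<close>.\<close>

lemma regular_linear_on_lines:
  fixes f g :: "('x \<Rightarrow> 'k::{alg_closed_field, field_char_0}) set \<Rightarrow> ('x \<Rightarrow> 'k) set"
  assumes f: "regular_map B (proj_space B) (proj_space B) f"
    and g: "regular_map B (proj_space B) (proj_space B) g" and gf: "\<And>p. p \<in> proj_space B \<Longrightarrow> g (f p) = p"
    and uv: "u \<in> dual_space B" "v \<in> dual_space B" "indep2 u v"
  shows "\<exists>A C. A \<in> dual_space B \<and> C \<in> dual_space B \<and>
    (\<forall>s t. s \<noteq> 0 \<or> t \<noteq> 0 \<longrightarrow> lc2 s A t C \<noteq> (\<lambda>x. 0) \<and> f (line (lc2 s u t v)) = line (lc2 s A t C))"
proof -
  obtain F D where F: "binary_form B D (ev_tuple B F 0)"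
    "\<And>s t. s \<noteq> 0 \<or> t \<noteq> 0 \<Longrightarrow> ev_tuple B F 0 s t \<noteq> (\<lambda>x. 0) \<and> f (line (lc2 s u t v)) = line (ev_tuple B F 0 s t)"
    "\<And>c a s t. c \<noteq> 0 \<Longrightarrow> ev_tuple B F (c * a) (c * s) (c * t) = (\<lambda>x. c ^ D * ev_tuple B F a s t x)"
    using regular_line_lift[OF f uv] by blast
  have D: "D = 1" using regular_inverse_degree_1[OF f g gf uv F(1,2)] .
  have "ev3 (F x) (c * a) (c * s) (c * t) = c * ev3 (F x) a s t" if "c \<noteq> 0" "x \<in> B" for c a s t x
    using F(3)[OF that(1), of a s t] that(2) by (auto simp: D ev_tuple_def fun_eq_iff dest: spec[of _ x])
  from ev3_linear[OF this] have lin: "ev3 (F x) 0 s t = s * ev3 (F x) 0 1 0 + t * ev3 (F x) 0 0 1" if "x \<in> B" for s t x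
    using that by (metis add_0 mult_zero_left)
  have "ev_tuple B F 0 s t x = lc2 s (ev_tuple B F 0 1 0) t (ev_tuple B F 0 0 1) x" for s t x
    using lin[of x s t] by (simp add: ev_tuple_def)
  moreover define A C where "A = ev_tuple B F 0 1 0" and "C = ev_tuple B F 0 0 1"
  ultimately have eq: "ev_tuple B F 0 s t = lc2 s A t C" for s t by blast
  show ?thesis
  proof (intro exI conjI allI impI)
    show "A \<in> dual_space B" "C \<in> dual_space B" by (simp_all add: A_def C_def)
    fix s t :: 'k assume "s \<noteq> 0 \<or> t \<noteq> 0"
    from F(2)[OF this, unfolded eq]
    show "lc2 s A t C \<noteq> (\<lambda>x. 0)" "f (line (lc2 s u t v)) = line (lc2 s A t C)" by (rule conjunct1, rule conjunct2)
  qed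
qed

text \<open>The degree of the plane lift can be measured on the line spanned by \<open>v\<close> and
  \<open>w\<close>, where it is 1.\<close>

lemma regular_linear_on_planes:
  fixes f g :: "('x \<Rightarrow> 'k::{alg_closed_field, field_char_0}) set \<Rightarrow> ('x \<Rightarrow> 'k) set"
  assumes f: "regular_map B (proj_space B) (proj_space B) f"
    and g: "regular_map B (proj_space B) (proj_space B) g" and gf: "\<And>p. p \<in> proj_space B \<Longrightarrow> g (f p) = p"
    and uvw: "u \<in> dual_space B" "v \<in> dual_space B" "w \<in> dual_space B" "indep3 u v w"
  shows "\<exists>A C E. A \<in> dual_space B \<and> C \<in> dual_space B \<and> E \<in> dual_space B \<and>
    (\<forall>r s t. r \<noteq> 0 \<or> s \<noteq> 0 \<or> t \<noteq> 0 \<longrightarrow> lc3 r A s C t E \<noteq> (\<lambda>x. 0) \<and> f (line (lc3 r u s v t w)) = line (lc3 r A s C t E))"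
proof -
  obtain L where L: "\<And>a b d. ev_tuple B L a b d = lc3 a u b v d w" using lc3_eq_ev_tuple[OF uvw(1,2,3)] by blast
  have ind: "lc3 r u s v t w \<noteq> (\<lambda>x. 0)" if "r \<noteq> 0 \<or> s \<noteq> 0 \<or> t \<noteq> 0" for r s t using uvw(4) that unfolding indep3_def by blast
  have vw: "indep2 v w" unfolding indep2_def using ind[of 0] by simp
  have "ev_tuple B L 0 1 0 \<noteq> (\<lambda>x. 0)" unfolding L by (rule ind) simp
  moreover have "ev_tuple B L (c ^ 1 * a) (c * b) (c * d) = (\<lambda>x. c ^ 1 * ev_tuple B L a b d x)" for c a b d
    by (simp add: L algebra_simps)
  ultimately obtain F D where F: "\<And>a b c. ev_tuple B L a b c \<noteq> (\<lambda>x. 0) \<Longrightarrow>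
      ev_tuple B F a b c \<noteq> (\<lambda>x. 0) \<and> f (line (ev_tuple B L a b c)) = line (ev_tuple B F a b c)"
    and "\<And>c a s t. c \<noteq> 0 \<Longrightarrow> ev_tuple B F (c ^ 1 * a) (c * s) (c * t) = (\<lambda>x. c ^ D * ev_tuple B F a s t x)"
    using regular_pullback_homogeneous[OF f, of L 0 1 0 1 1] by blast
  then have hom: "\<And>c a s t. c \<noteq> 0 \<Longrightarrow> ev_tuple B F (c * a) (c * s) (c * t) = (\<lambda>x. c ^ D * ev_tuple B F a s t x)"
    by (simp only: power_one_right)
  have F': "ev_tuple B F r s t \<noteq> (\<lambda>x. 0) \<and> f (line (lc3 r u s v t w)) = line (ev_tuple B F r s t)"
    if "r \<noteq> 0 \<or> s \<noteq> 0 \<or> t \<noteq> 0" for r s t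
    using F[of r s t] ind[OF that] by (simp add: L)
  have bf: "binary_form B D (ev_tuple B F 0)"
    by (rule binary_form_ev_tuple) (use F' hom[of _ 0] in auto)
  have D: "D = 1"
    by (rule regular_inverse_degree_1[OF f g gf uvw(2,3) vw bf]) (use F'[of 0] in simp_all)
  have "ev3 (F x) (c * a) (c * s) (c * t) = c * ev3 (F x) a s t" if "c \<noteq> 0" "x \<in> B" for c a s t x
    using hom[OF that(1), of a s t] that(2) by (auto simp: D ev_tuple_def fun_eq_iff dest: spec[of _ x])
  from ev3_linear[OF this] have lin: "ev3 (F x) r s t = r * ev3 (F x) 1 0 0 + s * ev3 (F x) 0 1 0 + t * ev3 (F x) 0 0 1" if "x \<in> B" for r s t x
    using that by blast
  have "ev_tuple B F r s t x = lc3 r (ev_tuple B F 1 0 0) s (ev_tuple B F 0 1 0) t (ev_tuple B F 0 0 1) x" for r s t x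
    using lin[of x r s t] by (simp add: ev_tuple_def)
  moreover define A C E where "A = ev_tuple B F 1 0 0" and "C = ev_tuple B F 0 1 0" and "E = ev_tuple B F 0 0 1"
  ultimately have eq: "ev_tuple B F r s t = lc3 r A s C t E" for r s t by blast
  show ?thesis
  proof (intro exI conjI allI impI)
    show "A \<in> dual_space B" "C \<in> dual_space B" "E \<in> dual_space B"
      by (simp_all add: A_def C_def E_def)
    fix r s t :: 'k assume "r \<noteq> 0 \<or> s \<noteq> 0 \<or> t \<noteq> 0"
    from F'[OF this, unfolded eq]
    show "lc3 r A s C t E \<noteq> (\<lambda>x. 0)" "f (line (lc3 r u s v t w)) = line (lc3 r A s C t E)"
      by (rule conjunct1, rule conjunct2)
  qed
qed

section \<open>Gluing linear lifts to a matrix\<close>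

definition act :: "'x set \<Rightarrow> ('x \<Rightarrow> 'x \<Rightarrow> 'k::field) \<Rightarrow> ('x \<Rightarrow> 'k) \<Rightarrow> 'x \<Rightarrow> 'k" where
  "act B m u = (\<lambda>x. if x \<in> B then \<Sum>y\<in>B. m x y * u y else 0)"

text \<open>Relative to the fixed pair \<open>f(\<langle>w\<rangle>) = \<langle>a\<rangle>\<close>, a linear lift \<open>u \<mapsto> A\<close> of \<open>f\<close>
  is normalised on each line through \<open>\<langle>w\<rangle>\<close>.\<close>

definition normalised_lift ::
    "'x set \<Rightarrow> (('x \<Rightarrow> 'k::field) set \<Rightarrow> ('x \<Rightarrow> 'k) set) \<Rightarrow> ('x \<Rightarrow> 'k) \<Rightarrow> ('x \<Rightarrow> 'k) \<Rightarrow> ('x \<Rightarrow> 'k) \<Rightarrow> ('x \<Rightarrow> 'k) \<Rightarrow> bool" where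
  "normalised_lift B f w a u A \<longleftrightarrow> A \<in> dual_space B \<and>
    (\<forall>s t. s \<noteq> 0 \<or> t \<noteq> 0 \<longrightarrow> lc2 s A t a \<noteq> (\<lambda>x. 0) \<and> f (line (lc2 s u t w)) = line (lc2 s A t a))"

text \<open>There are scalars with \<open>A' = k A\<close> and \<open>A' + a = l (A + a)\<close>.
  Since \<open>A\<close> and \<open>a\<close> are independent, \<open>k = l = 1\<close>.\<close>

lemma normalised_lift_unique:
  assumes A: "normalised_lift B f w a u A" and A': "normalised_lift B f w a u A'"
  shows "A = A'"
proof -
  note A = A[unfolded normalised_lift_def, THEN conjunct2, rule_format]
    and A' = A'[unfolded normalised_lift_def, THEN conjunct2, rule_format]
  obtain k where k: "lc2 1 A' 0 a = (\<lambda>x. k * lc2 1 A 0 a x)"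
    using line_eqD[of "lc2 1 A 0 a" "lc2 1 A' 0 a"] A[of 1 0] A'[of 1 0] by auto
  obtain l where l: "lc2 1 A' 1 a = (\<lambda>x. l * lc2 1 A 1 a x)"
    using line_eqD[of "lc2 1 A 1 a" "lc2 1 A' 1 a"] A[of 1 1] A'[of 1 1] by auto
  have "lc2 (k - l) A (1 - l) a = (\<lambda>x. 0)"
  proof
    fix x
    show "(k - l) * A x + (1 - l) * a x = 0" using fun_cong[OF k, of x] fun_cong[OF l, of x] by (simp add: algebra_simps)
  qed
  then have "k - l = 0" "1 - l = 0" using A[of "k - l" "1 - l"] by auto
  then show ?thesis using k by simp
qed

lemma normalised_lift_scale:
  fixes c :: "'k::field"
  assumes A: "normalised_lift B f w a u A" and c: "c \<noteq> 0"
  shows "normalised_lift B f w a (\<lambda>x. c * u x) (\<lambda>x. c * A x)"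
  using A c unfolding normalised_lift_def
proof (intro conjI allI impI)
  fix s t :: 'k assume "s \<noteq> 0 \<or> t \<noteq> 0"
  then have "s * c \<noteq> 0 \<or> t \<noteq> 0" using c by simp
  with A have "lc2 (s * c) A t a \<noteq> (\<lambda>x. 0) \<and> f (line (lc2 (s * c) u t w)) = line (lc2 (s * c) A t a)"
    unfolding normalised_lift_def by blast
  then show "(\<lambda>x. s * (c * A x) + t * a x) \<noteq> (\<lambda>x. 0)" "f (line (\<lambda>x. s * (c * u x) + t * w x)) = line (\<lambda>x. s * (c * A x) + t * a x)"
    by (simp_all add: mult.assoc)
qed (auto simp: dual_space_def)

text \<open>The gluing is pure linear algebra: it starts from linearity on lines and planes and a
  base pair, and is therefore stated over any field.\<close>

locale projectively_linear =
  fixes B :: "'x set" and f :: "('x \<Rightarrow> 'k::field) set \<Rightarrow> ('x \<Rightarrow> 'k) set" and w a :: "'x \<Rightarrow> 'k"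
  assumes lines: "\<And>u v. \<lbrakk>u \<in> dual_space B; v \<in> dual_space B; indep2 u v\<rbrakk> \<Longrightarrow>
      \<exists>A C. A \<in> dual_space B \<and> C \<in> dual_space B \<and>
        (\<forall>s t. s \<noteq> 0 \<or> t \<noteq> 0 \<longrightarrow> lc2 s A t C \<noteq> (\<lambda>x. 0) \<and> f (line (lc2 s u t v)) = line (lc2 s A t C))"
    and planes: "\<And>u v w. \<lbrakk>u \<in> dual_space B; v \<in> dual_space B; w \<in> dual_space B; indep3 u v w\<rbrakk> \<Longrightarrow>
      \<exists>A C E. A \<in> dual_space B \<and> C \<in> dual_space B \<and> E \<in> dual_space B \<and>
        (\<forall>r s t. r \<noteq> 0 \<or> s \<noteq> 0 \<or> t \<noteq> 0 \<longrightarrow> lc3 r A s C t E \<noteq> (\<lambda>x. 0) \<and> f (line (lc3 r u s v t w)) = line (lc3 r A s C t E))"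
    and w: "w \<in> dual_space B" and a: "a \<in> dual_space B" "a \<noteq> (\<lambda>x. 0)" and fw: "f (line w) = line a"
begin

lemma normalised_lift_exists:
  assumes u: "u \<in> dual_space B" "indep2 u w"
  shows "\<exists>A. normalised_lift B f w a u A"
proof -
  obtain A C where A: "A \<in> dual_space B"
    and lin: "\<And>s t. s \<noteq> 0 \<or> t \<noteq> 0 \<Longrightarrow> lc2 s A t C \<noteq> (\<lambda>x. 0) \<and> f (line (lc2 s u t w)) = line (lc2 s A t C)"
    using lines[OF u(1) w u(2)] by blast
  have "line C = line a" using lin[of 0 1] fw by simp
  then obtain k where k: "k \<noteq> 0" "a = (\<lambda>x. k * C x)" using line_eqD a(2) by blast
  have sc: "lc2 s (\<lambda>x. k * A x) t a = (\<lambda>x. k * lc2 s A t C x)" for s t by (simp add: k algebra_simps)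
  have "normalised_lift B f w a u (\<lambda>x. k * A x)"
    unfolding normalised_lift_def sc line_scale[OF k(1)]
    using A lin k(1) by (auto simp: dual_space_def fun_eq_iff)
  then show ?thesis by (rule exI[of _ "\<lambda>x. k * A x"])
qed

text \<open>The linear lift on the plane, rescaled so that \<open>w\<close> goes to
  \<open>a\<close>, restricts to normalised lifts at \<open>u\<close> and at \<open>v\<close>. By
  uniqueness these are \<open>A\<close> and \<open>C\<close>, and the plane lift is
  additive.\<close>

lemma normalised_lift_add:
  assumes u: "u \<in> dual_space B" and v: "v \<in> dual_space B" and ind: "indep3 u v w"
    and A: "normalised_lift B f w a u A" and C: "normalised_lift B f w a v C"
  shows "normalised_lift B f w a (\<lambda>x. u x + v x) (\<lambda>x. A x + C x)"
proof -
  obtain A' C' E where d: "A' \<in> dual_space B" "C' \<in> dual_space B"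
    and lin: "\<And>r s t. r \<noteq> 0 \<or> s \<noteq> 0 \<or> t \<noteq> 0 \<Longrightarrow>
       lc3 r A' s C' t E \<noteq> (\<lambda>x. 0) \<and> f (line (lc3 r u s v t w)) = line (lc3 r A' s C' t E)"
    using planes[OF u v w ind] by blast
  have "line E = line a" using lin[of 0 0 1] fw by simp
  then obtain k where k: "k \<noteq> 0" "a = (\<lambda>x. k * E x)" using line_eqD a(2) by blast
  have sc: "lc3 r (\<lambda>x. k * A' x) s (\<lambda>x. k * C' x) t a = (\<lambda>x. k * lc3 r A' s C' t E x)" for r s t
    by (simp add: k algebra_simps)
  have lin': "lc3 r (\<lambda>x. k * A' x) s (\<lambda>x. k * C' x) t a \<noteq> (\<lambda>x. 0) \<and>
      f (line (lc3 r u s v t w)) = line (lc3 r (\<lambda>x. k * A' x) s (\<lambda>x. k * C' x) t a)"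
    if "r \<noteq> 0 \<or> s \<noteq> 0 \<or> t \<noteq> 0" for r s t
    unfolding sc line_scale[OF k(1)] using lin[OF that] k(1) by (auto simp: fun_eq_iff)
  have "normalised_lift B f w a u (\<lambda>x. k * A' x)"
    unfolding normalised_lift_def using d lin'[of _ 0] by (auto simp: dual_space_def)
  then have "A = (\<lambda>x. k * A' x)" using A by (metis normalised_lift_unique)
  moreover have "normalised_lift B f w a v (\<lambda>x. k * C' x)"
    unfolding normalised_lift_def using d lin'[of 0] by (auto simp: dual_space_def)
  then have "C = (\<lambda>x. k * C' x)" using C by (metis normalised_lift_unique)
  moreover have "normalised_lift B f w a (\<lambda>x. u x + v x) (\<lambda>x. k * A' x + k * C' x)"
    unfolding normalised_lift_def
  proof (intro conjI allI impI)
    show "(\<lambda>x. k * A' x + k * C' x) \<in> dual_space B" using d by (simp add: dual_space_def)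
    fix s t :: 'k assume "s \<noteq> 0 \<or> t \<noteq> 0"
    then show "(\<lambda>x. s * (k * A' x + k * C' x) + t * a x) \<noteq> (\<lambda>x. 0)"
      "f (line (\<lambda>x. s * (u x + v x) + t * w x)) = line (\<lambda>x. s * (k * A' x + k * C' x) + t * a x)"
      using lin'[of s s t] by (auto simp: distrib_left)
  qed
  ultimately show ?thesis by simp
qed

end

text \<open>The base vector is a coordinate vector \<open>e x0\<close>. The columns of the matrix
  are its image \<open>a\<close> and the normalised lifts of the other coordinate vectors; nonzero
  linear combinations of the latter are lifted by induction on the index set.\<close>

lemma regular_inverse_linear:
  fixes f g :: "('x \<Rightarrow> 'k::{alg_closed_field, field_char_0}) set \<Rightarrow> ('x \<Rightarrow> 'k) set"
  assumes f: "regular_map B (proj_space B) (proj_space B) f"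
    and g: "regular_map B (proj_space B) (proj_space B) g" and gf: "\<And>p. p \<in> proj_space B \<Longrightarrow> g (f p) = p"
    and "finite B"
  shows "\<exists>m. \<forall>u\<in>dual_space B. u \<noteq> (\<lambda>x. 0) \<longrightarrow> act B m u \<noteq> (\<lambda>x. 0) \<and> f (line u) = line (act B m u)"
proof (cases "B = {}")
  case True
  then show ?thesis by (auto simp: dual_space_def fun_eq_iff)
next
  case False
  then obtain x0 where x0: "x0 \<in> B" by auto
  define e where "e y = (\<lambda>x. if x = y then 1 else (0::'k))" for y :: 'x
  have e: "e y \<in> dual_space B" "e y \<noteq> (\<lambda>x. 0)" if "y \<in> B" for y
    using that by (auto simp: e_def dual_space_def fun_eq_iff)
  have "f (line (e x0)) \<in> proj_space B" using f line_in_proj[OF e[OF x0]] unfolding regular_map_def by blast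
  then obtain a where a: "a \<in> dual_space B" "a \<noteq> (\<lambda>x. 0)" "f (line (e x0)) = line a" by (rule proj_spaceE)
  interpret projectively_linear B f "e x0" a
    by (rule projectively_linear.intro)
      (assumption | rule regular_linear_on_lines[OF f g gf] regular_linear_on_planes[OF f g gf] e(1)[OF x0] a)+
  have "\<exists>A. normalised_lift B f (e x0) a (e y) A" if y: "y \<in> B - {x0}" for y
  proof (rule normalised_lift_exists)
    show "e y \<in> dual_space B" using e y by blast
    show "indep2 (e y) (e x0)" unfolding indep2_def
    proof (intro allI impI notI)
      fix s t assume st: "s \<noteq> 0 \<or> t \<noteq> 0" and eq: "lc2 s (e y) t (e x0) = (\<lambda>x. 0)"
      show False using st fun_cong[OF eq, of y] fun_cong[OF eq, of x0] y by (auto simp: e_def)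
    qed
  qed
  then obtain M where M: "\<And>y. y \<in> B - {x0} \<Longrightarrow> normalised_lift B f (e x0) a (e y) (M y)" by metis
  have lift: "normalised_lift B f (e x0) a (\<lambda>x. if x \<in> S then c x else 0) (\<lambda>x. \<Sum>y\<in>S. c y * M y x)"
    if "S \<subseteq> B - {x0}" "\<exists>y\<in>S. c y \<noteq> 0" for S c
  proof -
    have "finite S" using that(1) \<open>finite B\<close> by (meson finite_Diff finite_subset)
    then show ?thesis using that
    proof (induction S)
      case (insert z S)
      have z: "z \<in> B - {x0}" "z \<in> B" and S: "S \<subseteq> B - {x0}" using insert by auto
      show ?case
      \<comment> \<open>\<open>normalised_lift_add\<close> requires independent summands, so a
        vanishing new coefficient and a vanishing partial sum are treated separately.\<close>
      proof (cases "c z = 0")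
        case True
        then have "(\<lambda>x. if x \<in> insert z S then c x else 0) = (\<lambda>x. if x \<in> S then c x else 0)" by auto
        moreover have "(\<lambda>x. \<Sum>y\<in>insert z S. c y * M y x) = (\<lambda>x. \<Sum>y\<in>S. c y * M y x)" using True insert by simp
        ultimately show ?thesis using insert True by auto
      next
        case cz: False
        have lz: "normalised_lift B f (e x0) a (\<lambda>x. c z * e z x) (\<lambda>x. c z * M z x)"
          using normalised_lift_scale[OF M[OF z(1)] cz] .
        show ?thesis
        proof (cases "\<exists>y\<in>S. c y \<noteq> 0")
          case False
          then have "(\<lambda>x. if x \<in> insert z S then c x else 0) = (\<lambda>x. c z * e z x)" by (auto simp: e_def)
          moreover have "(\<lambda>x. \<Sum>y\<in>insert z S. c y * M y x) = (\<lambda>x. c z * M z x)" using False insert by auto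
          ultimately show ?thesis using lz by simp
        next
          case True
          then obtain y where y: "y \<in> S" "c y \<noteq> 0" by blast
          let ?q = "\<lambda>x. if x \<in> S then c x else 0"
          have "normalised_lift B f (e x0) a (\<lambda>x. c z * e z x + ?q x) (\<lambda>x. c z * M z x + (\<Sum>y\<in>S. c y * M y x))"
          proof (rule normalised_lift_add[OF _ _ _ lz])
            show "normalised_lift B f (e x0) a ?q (\<lambda>x. \<Sum>y\<in>S. c y * M y x)" using insert.IH[OF S True] .
            show "(\<lambda>x. c z * e z x) \<in> dual_space B" using e[OF z(2)] by (simp add: dual_space_def)
            show "?q \<in> dual_space B" using S by (auto simp: dual_space_def)
            show "indep3 (\<lambda>x. c z * e z x) ?q (e x0)" unfolding indep3_def
            proof (intro allI impI notI)
              fix r s t assume rst: "r \<noteq> 0 \<or> s \<noteq> 0 \<or> t \<noteq> 0"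
                and eq: "lc3 r (\<lambda>x. c z * e z x) s ?q t (e x0) = (\<lambda>x. 0)"
              have "r = 0" using fun_cong[OF eq, of z] z insert.hyps cz by (auto simp: e_def)
              moreover have "x0 \<notin> S" using S by blast
              then have "t = 0" using fun_cong[OF eq, of x0] z by (auto simp: e_def)
              moreover have "y \<noteq> z" "y \<noteq> x0" using y insert.hyps S by auto
              then have "s = 0" using fun_cong[OF eq, of y] y by (simp add: e_def)
              ultimately show False using rst by simp
            qed
          qed
          moreover have "(\<lambda>x. c z * e z x + ?q x) = (\<lambda>x. if x \<in> insert z S then c x else 0)"
            using insert.hyps by (auto simp: e_def)
          ultimately show ?thesis using insert.hyps by simp
        qed
      qed
    qed simp
  qed
  define m where "m x y = (if y = x0 then a x else M y x)" for x y
  have "act B m u \<noteq> (\<lambda>x. 0) \<and> f (line u) = line (act B m u)" if u: "u \<in> dual_space B" "u \<noteq> (\<lambda>x. 0)" for u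
  proof -
    let ?S = "B - {x0}"
    have MB: "M y x = 0" if "y \<in> ?S" "x \<notin> B" for x y
      using M[OF that(1)] that(2) by (auto simp: normalised_lift_def dual_space_def)
    have act: "act B m u = (\<lambda>x. (\<Sum>y\<in>?S. u y * M y x) + u x0 * a x)"
    proof
      fix x
      show "act B m u x = (\<Sum>y\<in>?S. u y * M y x) + u x0 * a x"
      proof (cases "x \<in> B")
        case True
        have "(\<Sum>y\<in>B. m x y * u y) = m x x0 * u x0 + (\<Sum>y\<in>?S. m x y * u y)"
          using x0 \<open>finite B\<close> by (simp add: sum.remove)
        moreover have "(\<Sum>y\<in>?S. m x y * u y) = (\<Sum>y\<in>?S. u y * M y x)" by (rule sum.cong) (auto simp: m_def)
        ultimately show ?thesis using True by (simp add: act_def m_def)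
      next
        case False
        then show ?thesis using MB a(1) by (simp add: act_def dual_space_def)
      qed
    qed
    have u_eq: "u = (\<lambda>x. (if x \<in> ?S then u x else 0) + u x0 * e x0 x)"
      using u(1) by (auto simp: dual_space_def e_def)
    show ?thesis
    proof (cases "\<exists>y\<in>?S. u y \<noteq> 0")
      case True
      \<comment> \<open>The parameters \<open>s = 1\<close> and \<open>t = u x0\<close> add the
        component along \<open>e x0\<close>.\<close>
      from lift[OF subset_refl this, unfolded normalised_lift_def, THEN conjunct2, rule_format, of 1 "u x0"]
      show ?thesis unfolding act using u_eq by simp
    next
      case False
      have u': "u = (\<lambda>x. u x0 * e x0 x)" using False u(1) by (auto simp: fun_eq_iff e_def dual_space_def)
      have ux: "u x0 \<noteq> 0" using u' u(2) by (metis mult_zero_left)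
      have "act B m u = (\<lambda>x. u x0 * a x)" unfolding act using False by auto
      moreover have "line u = line (e x0)" by (subst u', rule line_scale[OF ux])
      moreover have "(\<lambda>x. u x0 * a x) \<noteq> (\<lambda>x. 0)" using a(2) ux by (auto simp: fun_eq_iff)
      ultimately show ?thesis using fw line_scale[OF ux, of a] by simp
    qed
  qed
  then show ?thesis by blast
qed

section \<open>Quotients of the tensor algebra\<close>

definition conv :: "('x list \<Rightarrow> 'k::field) \<Rightarrow> ('x list \<Rightarrow> 'k) \<Rightarrow> 'x list \<Rightarrow> 'k" where
  "conv f g = (\<lambda>w. \<Sum>i\<le>length w. f (take i w) * g (drop i w))"

definition deg_part :: "('x list \<Rightarrow> 'k::field) \<Rightarrow> nat \<Rightarrow> 'x list \<Rightarrow> 'k" where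
  "deg_part f n = (\<lambda>w. if length w = n then f w else 0)"

definition unit_word :: "'x list \<Rightarrow> 'k::field" where
  "unit_word = (\<lambda>w. if w = [] then 1 else 0)"

definition tensor_grade :: "'x set \<Rightarrow> nat \<Rightarrow> ('x list \<Rightarrow> 'k::field) set" where
  "tensor_grade B n = {f \<in> tensor_carrier B. \<forall>w. f w \<noteq> 0 \<longrightarrow> length w = n}"

lemma tensor_algebra_simps [simp]:
  "carrier (tensor_algebra B) = tensor_carrier B"
  "f \<otimes>\<^bsub>tensor_algebra B\<^esub> g = conv f g"
  "\<one>\<^bsub>tensor_algebra B\<^esub> = unit_word"
  "\<zero>\<^bsub>tensor_algebra B\<^esub> = (\<lambda>w. 0)"
  "f \<oplus>\<^bsub>tensor_algebra B\<^esub> g = (\<lambda>w. f w + g w)"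
  "c \<odot>\<^bsub>tensor_algebra B\<^esub> f = (\<lambda>w. c * f w)"
  "grade (tensor_algebra B) n = tensor_grade B n"
  by (simp_all add: tensor_algebra_def conv_def unit_word_def tensor_grade_def)

lemma conv_Nil [simp]: "conv f g [] = f [] * g []"
  by (simp add: conv_def)

text \<open>Splitting off the empty prefix turns convolution into a recursion on the word, so that
  inductions on words replace the reindexing of sums.\<close>

lemma conv_Cons [simp]: "conv f g (x # w) = f [] * g (x # w) + conv (\<lambda>v. f (x # v)) g w"
  by (simp add: conv_def sum.atMost_Suc_shift del: sum.atMost_Suc)

lemma conv_add_left: "conv (\<lambda>w. f w + g w) h = (\<lambda>w. conv f h w + conv g h w)"
  by (simp add: conv_def distrib_right sum.distrib)

lemma conv_add_right: "conv h (\<lambda>w. f w + g w) = (\<lambda>w. conv h f w + conv h g w)"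
  by (simp add: conv_def distrib_left sum.distrib)

lemma conv_scale_left: "conv (\<lambda>w. c * f w) g = (\<lambda>w. c * conv f g w)"
  by (simp add: conv_def sum_distrib_left mult.assoc)

lemma conv_scale_right: "conv f (\<lambda>w. c * g w) = (\<lambda>w. c * conv f g w)"
  by (simp add: conv_def sum_distrib_left mult.left_commute)

lemma conv_zero_left [simp]: "conv (\<lambda>w. 0) g = (\<lambda>w. 0)"
  by (simp add: conv_def)

lemma conv_unit_left [simp]: "conv unit_word f = f"
proof
  fix w show "conv unit_word f w = f w"
    by (cases w) (simp_all add: unit_word_def)
qed

lemma conv_unit_right [simp]: "conv f unit_word = f"
proof
  fix w show "conv f unit_word w = f w"
    by (induction w arbitrary: f) (simp_all add: unit_word_def)
qed

lemma conv_assoc: "conv (conv f g) h = conv f (conv g h)"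
proof
  fix w show "conv (conv f g) h w = conv f (conv g h) w"
  proof (induction w arbitrary: f)
    case (Cons x w)
    have "conv (conv f g) h (x # w) = f [] * g [] * h (x # w) + conv (\<lambda>v. f [] * g (x # v) + conv (\<lambda>u. f (x # u)) g v) h w"
      by simp
    also have "\<dots> = f [] * (g [] * h (x # w) + conv (\<lambda>v. g (x # v)) h w) + conv (conv (\<lambda>u. f (x # u)) g) h w"
      by (simp only: conv_add_left conv_scale_left) (simp add: algebra_simps)
    finally show ?case by (simp add: Cons)
  qed simp
qed

lemma tensor_carrierI:
  assumes "finite B" "\<And>w. f w \<noteq> 0 \<Longrightarrow> set w \<subseteq> B \<and> length w \<le> N"
  shows "f \<in> tensor_carrier B"
proof -
  have "{w. f w \<noteq> 0} \<subseteq> {w. set w \<subseteq> B \<and> length w \<le> N}" using assms(2) by blast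
  then have "finite {w. f w \<noteq> 0}" using finite_lists_length_le[OF assms(1)] finite_subset by blast
  then show ?thesis using assms(2) by (simp add: tensor_carrier_def)
qed

lemma tensor_carrier_bounded:
  assumes "f \<in> tensor_carrier B"
  shows "\<exists>N. \<forall>w. f w \<noteq> 0 \<longrightarrow> set w \<subseteq> B \<and> length w \<le> N"
proof -
  have "finite (length ` {w. f w \<noteq> 0})" using assms by (simp add: tensor_carrier_def)
  then obtain N where "\<forall>n\<in>length ` {w. f w \<noteq> 0}. n \<le> N" by (meson finite_nat_set_iff_bounded_le)
  then show ?thesis using assms by (auto simp: tensor_carrier_def)
qed

lemma conv_nonzero:
  assumes "conv f g w \<noteq> 0"
  obtains i where "i \<le> length w" "f (take i w) \<noteq> 0" "g (drop i w) \<noteq> 0"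
proof -
  obtain i where "i \<in> {..length w}" "f (take i w) * g (drop i w) \<noteq> 0"
    using assms unfolding conv_def by (meson sum.neutral)
  then show ?thesis using that by auto
qed

lemma tensor_carrier_zero [simp]: "(\<lambda>w. 0) \<in> tensor_carrier B"
  by (simp add: tensor_carrier_def)

lemma tensor_carrier_add [simp]:
  assumes "f \<in> tensor_carrier B" "g \<in> tensor_carrier B"
  shows "(\<lambda>w. f w + g w) \<in> tensor_carrier B"
proof -
  have "{w. f w + g w \<noteq> 0} \<subseteq> {w. f w \<noteq> 0} \<union> {w. g w \<noteq> 0}" by auto
  then have "finite {w. f w + g w \<noteq> 0}" using assms unfolding tensor_carrier_def by (auto intro: finite_subset)
  moreover have "set w \<subseteq> B" if "f w + g w \<noteq> 0" for w using assms that unfolding tensor_carrier_def by (cases "f w = 0") auto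
  ultimately show ?thesis by (simp add: tensor_carrier_def)
qed

lemma tensor_carrier_scale [simp]:
  assumes "f \<in> tensor_carrier B"
  shows "(\<lambda>w. c * f w) \<in> tensor_carrier B"
  using assms unfolding tensor_carrier_def by (auto elim: rev_finite_subset)

lemma tensor_carrier_diff [simp]:
  assumes "f \<in> tensor_carrier B" "g \<in> tensor_carrier B"
  shows "(\<lambda>w. f w - g w) \<in> tensor_carrier B"
  using tensor_carrier_add[OF assms(1) tensor_carrier_scale[OF assms(2), of "-1"]] by simp

lemma tensor_carrier_uminus [simp]: "f \<in> tensor_carrier B \<Longrightarrow> (\<lambda>w. - f w) \<in> tensor_carrier B"
  using tensor_carrier_scale[of f B "-1"] by simp

lemma tensor_carrier_sum:
  assumes "\<And>i. i \<in> N \<Longrightarrow> g i \<in> tensor_carrier B"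
  shows "(\<lambda>w. \<Sum>i\<in>N. g i w) \<in> tensor_carrier B"
  using assms by (induction N rule: infinite_finite_induct) simp_all

lemma tensor_carrier_unit [simp]: "unit_word \<in> tensor_carrier B"
  by (simp add: tensor_carrier_def unit_word_def)

lemma tensor_carrier_deg_part [simp]: "f \<in> tensor_carrier B \<Longrightarrow> deg_part f n \<in> tensor_carrier B"
  unfolding tensor_carrier_def deg_part_def by (auto elim: rev_finite_subset)

lemma tensor_carrier_conv [simp]:
  assumes "f \<in> tensor_carrier B" "g \<in> tensor_carrier B"
  shows "conv f g \<in> tensor_carrier B"
proof -
  have "{w. conv f g w \<noteq> 0} \<subseteq> (\<lambda>(u, v). u @ v) ` ({w. f w \<noteq> 0} \<times> {w. g w \<noteq> 0})"
  proof
    fix w assume "w \<in> {w. conv f g w \<noteq> 0}"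
    then have "conv f g w \<noteq> 0" by simp
    then obtain i where "f (take i w) \<noteq> 0" "g (drop i w) \<noteq> 0" by (rule conv_nonzero)
    then show "w \<in> (\<lambda>(u, v). u @ v) ` ({w. f w \<noteq> 0} \<times> {w. g w \<noteq> 0})"
      by (intro image_eqI[of _ _ "(take i w, drop i w)"]) auto
  qed
  moreover have "finite ((\<lambda>(u, v). u @ v) ` ({w. f w \<noteq> 0} \<times> {w. g w \<noteq> 0}))"
    using assms by (simp add: tensor_carrier_def)
  ultimately have "finite {w. conv f g w \<noteq> 0}" by (rule finite_subset)
  moreover have "set w \<subseteq> B" if nz: "conv f g w \<noteq> 0" for w
  proof -
    obtain i where "f (take i w) \<noteq> 0" "g (drop i w) \<noteq> 0" using nz by (rule conv_nonzero)
    then have "set (take i w) \<subseteq> B" "set (drop i w) \<subseteq> B" using assms by (auto simp: tensor_carrier_def)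
    then show ?thesis by (metis append_take_drop_id set_append Un_subset_iff)
  qed
  ultimately show ?thesis by (simp add: tensor_carrier_def)
qed

lemma deg_part_grade [simp]: "f \<in> tensor_carrier B \<Longrightarrow> deg_part f n \<in> tensor_grade B n"
  by (simp add: tensor_grade_def) (simp add: deg_part_def)

lemma grade_carrier: "f \<in> tensor_grade B n \<Longrightarrow> f \<in> tensor_carrier B"
  by (simp add: tensor_grade_def)

lemma deg_part_of_grade: "f \<in> tensor_grade B n \<Longrightarrow> deg_part f m = (if m = n then f else (\<lambda>w. 0))"
  by (auto simp: tensor_grade_def deg_part_def fun_eq_iff)

lemma deg_part_add: "deg_part (\<lambda>w. f w + g w) n = (\<lambda>w. deg_part f n w + deg_part g n w)"
  by (auto simp: deg_part_def)

lemma sum_deg_part: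
  assumes "finite N" "\<And>w. f w \<noteq> 0 \<Longrightarrow> length w \<in> N"
  shows "(\<lambda>w. \<Sum>n\<in>N. deg_part f n w) = f"
proof
  fix w
  have "(\<Sum>n\<in>N. deg_part f n w) = (\<Sum>n\<in>N. if n = length w then f w else 0)"
    by (rule sum.cong) (auto simp: deg_part_def)
  also have "\<dots> = f w" using assms by (auto simp: sum.delta)
  finally show "(\<Sum>n\<in>N. deg_part f n w) = f w" .
qed

lemma finite_degrees: "f \<in> tensor_carrier B \<Longrightarrow> finite (length ` {w. f w \<noteq> 0})"
  by (simp add: tensor_carrier_def)

lemma conv_grade [simp]:
  assumes "f \<in> tensor_grade B m" "g \<in> tensor_grade B n"
  shows "conv f g \<in> tensor_grade B (m + n)"
proof -
  have "length w = m + n" if nz: "conv f g w \<noteq> 0" for w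
  proof -
    obtain i where "i \<le> length w" "f (take i w) \<noteq> 0" "g (drop i w) \<noteq> 0" using nz by (rule conv_nonzero)
    then have "length (take i w) = m" "length (drop i w) = n" using assms by (auto simp: tensor_grade_def)
    then show ?thesis using \<open>i \<le> length w\<close> by simp
  qed
  then show ?thesis using assms by (simp add: tensor_grade_def)
qed

text \<open>The structure \<open>S\<close> inherits the algebra laws from the tensor algebra; the last condition, that
  the kernel of \<open>h\<close> is homogeneous, yields the uniqueness of decompositions.\<close>

definition presents ::
    "'x set \<Rightarrow> (('x list \<Rightarrow> 'k::field) \<Rightarrow> 'b) \<Rightarrow> ('k, 'b) graded_alg \<Rightarrow> bool" where
  "presents B h S \<longleftrightarrow>
     carrier S = h ` tensor_carrier B \<and>
     (\<forall>f\<in>tensor_carrier B. \<forall>g\<in>tensor_carrier B. h (\<lambda>w. f w + g w) = h f \<oplus>\<^bsub>S\<^esub> h g) \<and>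
     (\<forall>f\<in>tensor_carrier B. \<forall>g\<in>tensor_carrier B. h (conv f g) = h f \<otimes>\<^bsub>S\<^esub> h g) \<and>
     h unit_word = \<one>\<^bsub>S\<^esub> \<and> h (\<lambda>w. 0) = \<zero>\<^bsub>S\<^esub> \<and>
     (\<forall>c. \<forall>f\<in>tensor_carrier B. h (\<lambda>w. c * f w) = c \<odot>\<^bsub>S\<^esub> h f) \<and>
     (\<forall>n. grade S n = h ` tensor_grade B n) \<and>
     (\<forall>f\<in>tensor_carrier B. h f = \<zero>\<^bsub>S\<^esub> \<longrightarrow> (\<forall>n. h (deg_part f n) = \<zero>\<^bsub>S\<^esub>))"

locale presentation =
  fixes B :: "'x set" and h :: "('x list \<Rightarrow> 'k::field) \<Rightarrow> 'b" and S :: "('k, 'b) graded_alg"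
  assumes presents: "presents B h S"
begin

lemma carrier: "carrier S = h ` tensor_carrier B"
  and add: "\<lbrakk>f \<in> tensor_carrier B; g \<in> tensor_carrier B\<rbrakk> \<Longrightarrow> h f \<oplus>\<^bsub>S\<^esub> h g = h (\<lambda>w. f w + g w)"
  and mult: "\<lbrakk>f \<in> tensor_carrier B; g \<in> tensor_carrier B\<rbrakk> \<Longrightarrow> h f \<otimes>\<^bsub>S\<^esub> h g = h (conv f g)"
  and one: "\<one>\<^bsub>S\<^esub> = h unit_word" and zero: "\<zero>\<^bsub>S\<^esub> = h (\<lambda>w. 0)"
  and smult: "f \<in> tensor_carrier B \<Longrightarrow> c \<odot>\<^bsub>S\<^esub> h f = h (\<lambda>w. c * f w)"
  and grade: "grade S n = h ` tensor_grade B n"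
  and kernel_deg_part: "\<lbrakk>f \<in> tensor_carrier B; h f = \<zero>\<^bsub>S\<^esub>\<rbrakk> \<Longrightarrow> h (deg_part f n) = \<zero>\<^bsub>S\<^esub>"
  using presents unfolding presents_def by auto

lemma abelian_group_S: "abelian_group S"
proof (rule abelian_groupI)
  fix x assume "x \<in> carrier S"
  then obtain f where f: "f \<in> tensor_carrier B" "x = h f" by (auto simp: carrier)
  then show "\<exists>y\<in>carrier S. y \<oplus>\<^bsub>S\<^esub> x = \<zero>\<^bsub>S\<^esub>"
    by (intro bexI[of _ "h (\<lambda>w. - f w)"]) (auto simp: add zero carrier)
qed (auto simp: carrier add zero ac_simps)

lemma monoid_S: "Group.monoid S"
  by (rule Group.monoidI) (auto simp: carrier mult one conv_assoc)

lemma ring_S: "ring S"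
  by (rule ringI[OF abelian_group_S monoid_S]) (auto simp: carrier add mult conv_add_left conv_add_right)

lemma module_S: "module (ring_of_type_algebra :: 'k ring) S"
  by (rule moduleI[OF cring_from_type_algebra abelian_group_S])
    (auto simp: ring_of_type_algebra_def carrier add smult algebra_simps)

lemma eq_iff:
  assumes "f \<in> tensor_carrier B" "g \<in> tensor_carrier B"
  shows "h f = h g \<longleftrightarrow> h (\<lambda>w. f w - g w) = \<zero>\<^bsub>S\<^esub>"
proof
  assume "h f = h g"
  then have "h f \<oplus>\<^bsub>S\<^esub> h (\<lambda>w. - g w) = h g \<oplus>\<^bsub>S\<^esub> h (\<lambda>w. - g w)" by simp
  then show "h (\<lambda>w. f w - g w) = \<zero>\<^bsub>S\<^esub>" using assms by (simp add: add zero)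
next
  assume "h (\<lambda>w. f w - g w) = \<zero>\<^bsub>S\<^esub>"
  then have "h (\<lambda>w. f w - g w) \<oplus>\<^bsub>S\<^esub> h g = h (\<lambda>w. 0) \<oplus>\<^bsub>S\<^esub> h g" by (simp add: zero)
  then show "h f = h g" using assms by (simp add: add)
qed

lemma finsum:
  assumes "\<And>i. i \<in> N \<Longrightarrow> g i \<in> tensor_carrier B" "finite N"
  shows "(\<Oplus>\<^bsub>S\<^esub>i\<in>N. h (g i)) = h (\<lambda>w. \<Sum>i\<in>N. g i w)"
proof -
  interpret abelian_group S by (rule abelian_group_S)
  show ?thesis using assms(2,1)
  proof (induction N)
    case (insert i N)
    then have "(\<Oplus>\<^bsub>S\<^esub>j\<in>insert i N. h (g j)) = h (g i) \<oplus>\<^bsub>S\<^esub> (\<Oplus>\<^bsub>S\<^esub>j\<in>N. h (g j))"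
      by (intro finsum_insert) (auto simp: carrier)
    also have "\<dots> = h (\<lambda>w. g i w + (\<Sum>j\<in>N. g j w))"
      using insert tensor_carrier_sum[of N g B] by (simp add: add)
    finally show ?case using insert by simp
  qed (simp add: zero)
qed

text \<open>A decomposition is summed over the degrees with nonzero component in the quotient, a set
  not known explicitly; the degrees that occur in a representative form a larger finite set with the
  same sum.\<close>

lemma finsum_nonzero:
  assumes "\<And>i. i \<in> N \<Longrightarrow> c i \<in> carrier S" "finite N" "\<And>i. i \<notin> N \<Longrightarrow> c i = \<zero>\<^bsub>S\<^esub>"
  shows "(\<Oplus>\<^bsub>S\<^esub>i\<in>{i. c i \<noteq> \<zero>\<^bsub>S\<^esub>}. c i) = (\<Oplus>\<^bsub>S\<^esub>i\<in>N. c i)"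
proof -
  interpret abelian_group S by (rule abelian_group_S)
  show ?thesis by (rule add.finprod_mono_neutral_cong_left) (use assms in auto)
qed

lemma decomposition_deg_part:
  assumes f: "f \<in> tensor_carrier B"
  shows "is_decomposition S (h f) (\<lambda>n. h (deg_part f n))"
proof -
  let ?N = "length ` {w. f w \<noteq> 0}"
  have out: "h (deg_part f n) = \<zero>\<^bsub>S\<^esub>" if "n \<notin> ?N" for n
  proof -
    have "deg_part f n = (\<lambda>w. 0)" using that by (auto simp: deg_part_def fun_eq_iff)
    then show ?thesis by (simp add: zero)
  qed
  have "{n. h (deg_part f n) \<noteq> \<zero>\<^bsub>S\<^esub>} \<subseteq> ?N" using out by blast
  then have fin: "finite {n. h (deg_part f n) \<noteq> \<zero>\<^bsub>S\<^esub>}" using finite_degrees[OF f] by (rule finite_subset)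
  have "(\<Oplus>\<^bsub>S\<^esub>n\<in>{n. h (deg_part f n) \<noteq> \<zero>\<^bsub>S\<^esub>}. h (deg_part f n)) = (\<Oplus>\<^bsub>S\<^esub>n\<in>?N. h (deg_part f n))"
    by (rule finsum_nonzero) (use f out finite_degrees[OF f] in \<open>auto simp: carrier\<close>)
  also have "\<dots> = h (\<lambda>w. \<Sum>n\<in>?N. deg_part f n w)"
    by (rule finsum) (use f finite_degrees[OF f] in auto)
  also have "\<dots> = h f" by (subst sum_deg_part) (use finite_degrees[OF f] in auto)
  finally show ?thesis using fin f by (auto simp: is_decomposition_def grade)
qed

text \<open>A decomposition lifts to homogeneous elements \<open>g n\<close> of the tensor algebra
  whose sum differs from \<open>f\<close> by a kernel element. As the kernel is homogeneous, the
  degree \<open>n\<close> parts of both have the same image.\<close>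

lemma decomposition_unique:
  assumes f: "f \<in> tensor_carrier B" and c: "is_decomposition S (h f) c"
  shows "c = (\<lambda>n. h (deg_part f n))"
proof
  fix n
  let ?N = "{n. c n \<noteq> \<zero>\<^bsub>S\<^esub>}"
  have "\<forall>n. \<exists>g. g \<in> tensor_grade B n \<and> c n = h g" using c by (auto simp: is_decomposition_def grade)
  then obtain g where g: "\<And>n. g n \<in> tensor_grade B n" "\<And>n. c n = h (g n)" by metis
  have fin: "finite ?N" using c by (simp add: is_decomposition_def)
  define s where "s = (\<lambda>w. \<Sum>n\<in>?N. g n w)"
  have s: "s \<in> tensor_carrier B" unfolding s_def by (rule tensor_carrier_sum) (rule grade_carrier[OF g(1)])
  have "h f = (\<Oplus>\<^bsub>S\<^esub>n\<in>?N. h (g n))" using c g by (simp add: is_decomposition_def)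
  also have "\<dots> = h s" unfolding s_def by (rule finsum) (use fin grade_carrier[OF g(1)] in auto)
  finally have "h (\<lambda>w. f w - s w) = \<zero>\<^bsub>S\<^esub>" using eq_iff[OF f s] by simp
  then have "h (deg_part (\<lambda>w. f w - s w) n) = \<zero>\<^bsub>S\<^esub>" using f s by (intro kernel_deg_part) simp_all
  moreover have "deg_part (\<lambda>w. f w - s w) n = (\<lambda>w. deg_part f n w - deg_part s n w)" by (auto simp: deg_part_def)
  ultimately have 1: "h (deg_part f n) = h (deg_part s n)" using f s by (simp add: eq_iff)
  have "deg_part s n = (\<lambda>w. \<Sum>m\<in>?N. deg_part (g m) n w)" by (auto simp: deg_part_def s_def)
  also have "\<dots> = (\<lambda>w. \<Sum>m\<in>?N. if m = n then g n w else 0)"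
    by (intro ext sum.cong) (auto simp: deg_part_of_grade[OF g(1)])
  also have "\<dots> = (if n \<in> ?N then g n else (\<lambda>w. 0))" using fin by (auto simp: sum.delta')
  finally show "c n = h (deg_part f n)" using 1 g(2) by (auto simp: zero)
qed

lemma hcomp: "f \<in> tensor_carrier B \<Longrightarrow> hcomp S (h f) = (\<lambda>n. h (deg_part f n))"
  unfolding hcomp_def by (rule the_equality) (use decomposition_deg_part decomposition_unique in auto)

lemma graded_algebra_S: "graded_algebra S"
proof -
  note S_zero = zero and S_one = one
  interpret ring S by (rule ring_S)
  interpret module "ring_of_type_algebra :: 'k ring" S by (rule module_S)
  show ?thesis
  proof unfold_locales
    fix n
    show "grade S n \<subseteq> carrier (add_monoid S)" by (auto simp: grade carrier grade_carrier)
    show "\<one>\<^bsub>add_monoid S\<^esub> \<in> grade S n" by (auto simp: grade S_zero tensor_grade_def)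
    fix x assume "x \<in> grade S n"
    then obtain f where f: "f \<in> tensor_grade B n" "x = h f" by (auto simp: grade)
    have f': "(\<lambda>w. - f w) \<in> tensor_grade B n" "f \<in> tensor_carrier B" "(\<lambda>w. - f w) \<in> tensor_carrier B"
      using f by (auto simp: tensor_grade_def)
    then have "h (\<lambda>w. - f w) \<oplus>\<^bsub>S\<^esub> x = \<zero>\<^bsub>S\<^esub>" by (simp only: f(2) add S_zero) simp
    then have "\<ominus>\<^bsub>S\<^esub> x = h (\<lambda>w. - f w)"
      using f f' by (intro abelian_group.minus_equality[OF abelian_group_S]) (auto simp: carrier)
    then have "\<ominus>\<^bsub>S\<^esub> x \<in> grade S n" using f' by (simp only: grade) blast
    then show "inv\<^bsub>add_monoid S\<^esub> x \<in> grade S n" by (simp add: a_inv_def)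
    fix y assume "y \<in> grade S n"
    then obtain g where g: "g \<in> tensor_grade B n" "y = h g" by (auto simp: grade)
    have "(\<lambda>w. f w + g w) \<in> tensor_grade B n" using f g by (auto simp: tensor_grade_def) (metis add_0)
    then show "x \<otimes>\<^bsub>add_monoid S\<^esub> y \<in> grade S n" using f g by (auto simp: add grade grade_carrier)
  next
    fix a :: 'b and c n assume "a \<in> grade S n"
    then show "c \<odot>\<^bsub>S\<^esub> a \<in> grade S n" by (auto simp: grade smult tensor_grade_def)
  next
    have "unit_word \<in> tensor_grade B 0" by (simp add: tensor_grade_def) (simp add: unit_word_def)
    then show "\<one>\<^bsub>S\<^esub> \<in> grade S 0" unfolding grade S_one by (rule imageI)
  next
    fix a b m n assume "a \<in> grade S m" "b \<in> grade S n"
    then show "a \<otimes>\<^bsub>S\<^esub> b \<in> grade S (m + n)" by (auto simp: grade mult grade_carrier)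
  next
    fix a assume "a \<in> carrier S"
    then obtain f where "f \<in> tensor_carrier B" "a = h f" by (auto simp: carrier)
    then show "\<exists>!c. is_decomposition S a c"
      using decomposition_deg_part decomposition_unique by blast
  qed (auto simp: carrier mult smult conv_scale_left conv_scale_right)
qed

end

text \<open>Both structures are the quotient of the tensor algebra by the same kernel; the
  isomorphism sends \<open>h f\<close> to \<open>h' f\<close>.\<close>

lemma presents_iso:
  assumes "presents B h S" "presents B h' S'"
    and ker: "\<And>f. f \<in> tensor_carrier B \<Longrightarrow> h f = \<zero>\<^bsub>S\<^esub> \<longleftrightarrow> h' f = \<zero>\<^bsub>S'\<^esub>"
  shows "graded_iso S S' \<noteq> {}"
proof -
  interpret P: presentation B h S by (rule presentation.intro[OF assms(1)])
  interpret P': presentation B h' S' by (rule presentation.intro[OF assms(2)])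
  have eq: "h f = h g \<longleftrightarrow> h' f = h' g" if "f \<in> tensor_carrier B" "g \<in> tensor_carrier B" for f g
    using that by (simp add: P.eq_iff P'.eq_iff ker)
  define \<phi> where "\<phi> y = h' (inv_into (tensor_carrier B) h y)" for y
  have \<phi>: "\<phi> (h f) = h' f" if "f \<in> tensor_carrier B" for f
  proof -
    have "h f \<in> h ` tensor_carrier B" using that by blast
    then show ?thesis unfolding \<phi>_def
      using that eq f_inv_into_f[of "h f" h "tensor_carrier B"] inv_into_into[of "h f" h "tensor_carrier B"] by simp
  qed
  have "\<phi> \<in> graded_iso S S'" unfolding graded_iso_def ring_iso_def ring_hom_def
  proof (intro CollectI conjI allI ballI)
    show "bij_betw \<phi> (carrier S) (carrier S')"
      unfolding bij_betw_def by (auto simp: inj_on_def P.carrier P'.carrier \<phi> eq image_image)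
    show "\<phi> ` grade S n = grade S' n" for n
    proof -
      have "\<phi> ` grade S n = (\<lambda>f. \<phi> (h f)) ` tensor_grade B n" by (simp add: P.grade image_image)
      also have "\<dots> = h' ` tensor_grade B n" using \<phi> grade_carrier by (intro image_cong) auto
      finally show ?thesis by (simp add: P'.grade)
    qed
  qed (auto simp: P.carrier P'.carrier \<phi> P.add P'.add P.mult P'.mult P.one P'.one P.smult P'.smult)
  then show ?thesis by blast
qed

lemma presents_tensor_algebra: "presents B (\<lambda>f. f) (tensor_algebra B)"
  unfolding presents_def by (simp add: fun_eq_iff deg_part_def)

lemma ring_tensor_algebra: "ring (tensor_algebra B)"
  by (rule presentation.ring_S[OF presentation.intro[OF presents_tensor_algebra]])

section \<open>Letterwise action of matrices\<close>

lemma uminus_tensor_algebra: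
  assumes "f \<in> tensor_carrier B"
  shows "\<ominus>\<^bsub>tensor_algebra B\<^esub> f = (\<lambda>w. - f w)"
proof -
  interpret ring "tensor_algebra B" by (rule ring_tensor_algebra)
  show ?thesis by (rule minus_equality) (use assms in simp_all)
qed

lemma ideal_tensor_algebraI:
  assumes "I \<subseteq> tensor_carrier B" "(\<lambda>w. 0) \<in> I"
    and add: "\<And>f g. f \<in> I \<Longrightarrow> g \<in> I \<Longrightarrow> (\<lambda>w. f w + g w) \<in> I"
    and l: "\<And>a f. a \<in> tensor_carrier B \<Longrightarrow> f \<in> I \<Longrightarrow> conv a f \<in> I"
    and r: "\<And>a f. a \<in> tensor_carrier B \<Longrightarrow> f \<in> I \<Longrightarrow> conv f a \<in> I"
  shows "ideal I (tensor_algebra B)"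
proof (rule idealI[OF ring_tensor_algebra])
  have neg: "(\<lambda>w. - f w) \<in> I" if "f \<in> I" for f
  proof -
    have "conv (\<lambda>w. - 1 * unit_word w) f \<in> I"
      by (rule l[OF tensor_carrier_scale[OF tensor_carrier_unit] that])
    then show ?thesis by (subst (asm) conv_scale_left) simp
  qed
  show "subgroup I (add_monoid (tensor_algebra B))"
  proof
    fix f assume f: "f \<in> I"
    then have "\<ominus>\<^bsub>tensor_algebra B\<^esub> f \<in> I" using neg assms(1) by (subst uminus_tensor_algebra) auto
    then show "inv\<^bsub>add_monoid (tensor_algebra B)\<^esub> f \<in> I" unfolding a_inv_def .
  qed (use assms in auto)
qed (use l r in auto)

lemma ideal_tensor_algebraD:
  assumes "ideal I (tensor_algebra B)"
  shows "f \<in> I \<Longrightarrow> f \<in> tensor_carrier B" "(\<lambda>w. 0) \<in> I"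
    "f \<in> I \<Longrightarrow> g \<in> I \<Longrightarrow> (\<lambda>w. f w + g w) \<in> I"
    "f \<in> I \<Longrightarrow> a \<in> tensor_carrier B \<Longrightarrow> conv a f \<in> I"
    "f \<in> I \<Longrightarrow> a \<in> tensor_carrier B \<Longrightarrow> conv f a \<in> I"
    "f \<in> I \<Longrightarrow> (\<lambda>w. c * f w) \<in> I"
proof -
  interpret ideal I "tensor_algebra B" by fact
  show "f \<in> I \<Longrightarrow> f \<in> tensor_carrier B" using Icarr by simp
  show "(\<lambda>w. 0) \<in> I" using additive_subgroup.zero_closed[OF is_additive_subgroup] by simp
  show "f \<in> I \<Longrightarrow> g \<in> I \<Longrightarrow> (\<lambda>w. f w + g w) \<in> I" using additive_subgroup.a_closed[OF is_additive_subgroup] by simp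
  show l: "conv a f \<in> I" if "f \<in> I" "a \<in> tensor_carrier B" for a using I_l_closed[of f a] that by simp
  show "f \<in> I \<Longrightarrow> a \<in> tensor_carrier B \<Longrightarrow> conv f a \<in> I" using I_r_closed[of f a] by simp
  show "(\<lambda>w. c * f w) \<in> I" if "f \<in> I"
    using l[OF that tensor_carrier_scale[OF tensor_carrier_unit], of c] by (simp add: conv_scale_left)
qed

lemma ideal_tensor_algebra_sum:
  assumes "ideal I (tensor_algebra B)" "\<And>i. i \<in> N \<Longrightarrow> g i \<in> I"
  shows "(\<lambda>w. \<Sum>i\<in>N. g i w) \<in> I"
  using assms(2) by (induction N rule: infinite_finite_induct)
    (simp_all add: ideal_tensor_algebraD(2)[OF assms(1)] ideal_tensor_algebraD(3)[OF assms(1)])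

lemma coset_eq_zero_iff:
  assumes "ideal I (tensor_algebra B)" "f \<in> tensor_carrier B"
  shows "I +>\<^bsub>tensor_algebra B\<^esub> f = I \<longleftrightarrow> f \<in> I"
proof -
  interpret ideal I "tensor_algebra B" by fact
  show ?thesis using a_rcos_zero[OF assms(1)] a_rcos_self[of f] assms(2) by auto
qed

text \<open>A scalar multiple of a coset is a union over its representatives. All members of this
  union coincide, because the ideal is closed under scalars.\<close>

lemma presents_quotient:
  assumes I: "ideal I (tensor_algebra B)" and hom: "\<And>f n. f \<in> I \<Longrightarrow> deg_part f n \<in> I"
  shows "presents B (\<lambda>f. I +>\<^bsub>tensor_algebra B\<^esub> f) (quotient_algebra (tensor_algebra B) I)"
proof -
  interpret ideal I "tensor_algebra B" by fact
  note D = ideal_tensor_algebraD[OF I]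
  have coset: "I +>\<^bsub>tensor_algebra B\<^esub> f = (\<lambda>i w. i w + f w) ` I" for f
    by (auto simp: a_r_coset_def')
  have smult: "(\<Union>g\<in>I +>\<^bsub>tensor_algebra B\<^esub> f. I +>\<^bsub>tensor_algebra B\<^esub> (\<lambda>w. c * g w)) = I +>\<^bsub>tensor_algebra B\<^esub> (\<lambda>w. c * f w)"
    if f: "f \<in> tensor_carrier B" for c f
  proof -
    have "I +>\<^bsub>tensor_algebra B\<^esub> (\<lambda>w. c * g w) = I +>\<^bsub>tensor_algebra B\<^esub> (\<lambda>w. c * f w)"
      if "g \<in> I +>\<^bsub>tensor_algebra B\<^esub> f" for g
    proof -
      have "g \<in> (\<lambda>i w. i w + f w) ` I" using that unfolding coset .
      then obtain i where i: "i \<in> I" "g = (\<lambda>w. i w + f w)" by blast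
      have "(\<lambda>w. c * i w) \<in> I" by (rule D(6)[OF i(1)])
      moreover have "(\<lambda>w. c * g w) = (\<lambda>w. c * i w + c * f w)" by (simp add: i distrib_left)
      ultimately have "(\<lambda>w. c * g w) \<in> I +>\<^bsub>tensor_algebra B\<^esub> (\<lambda>w. c * f w)" by (auto simp: coset)
      then show ?thesis using a_repr_independence[OF _ _ is_additive_subgroup[THEN additive_subgroup.a_subgroup]] f
        by (metis tensor_carrier_scale tensor_algebra_simps(1))
    qed
    moreover have "f \<in> I +>\<^bsub>tensor_algebra B\<^esub> f" using a_rcos_self f by simp
    ultimately show ?thesis by blast
  qed
  have zero: "I +>\<^bsub>tensor_algebra B\<^esub> (\<lambda>w. 0) = I" using coset_eq_zero_iff[OF I] D(2) by simp
  show ?thesis unfolding presents_def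
  proof (intro conjI ballI allI impI)
    show "carrier (quotient_algebra (tensor_algebra B) I) = (\<lambda>f. I +>\<^bsub>tensor_algebra B\<^esub> f) ` tensor_carrier B"
      by (auto simp: quotient_algebra_def FactRing_def A_RCOSETS_def')
  next
    fix f g :: "'a list \<Rightarrow> 'b" assume fg: "f \<in> tensor_carrier B" "g \<in> tensor_carrier B"
    show "I +>\<^bsub>tensor_algebra B\<^esub> (\<lambda>w. f w + g w) =
          (I +>\<^bsub>tensor_algebra B\<^esub> f) \<oplus>\<^bsub>quotient_algebra (tensor_algebra B) I\<^esub> (I +>\<^bsub>tensor_algebra B\<^esub> g)"
      using a_rcos_sum[of f g] fg by (simp add: quotient_algebra_def FactRing_def)
    show "I +>\<^bsub>tensor_algebra B\<^esub> (conv f g) =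
          (I +>\<^bsub>tensor_algebra B\<^esub> f) \<otimes>\<^bsub>quotient_algebra (tensor_algebra B) I\<^esub> (I +>\<^bsub>tensor_algebra B\<^esub> g)"
      using rcoset_mult_add[of f g] fg by (simp add: quotient_algebra_def FactRing_def)
  next
    fix f n assume f: "f \<in> tensor_carrier B"
      and z: "I +>\<^bsub>tensor_algebra B\<^esub> f = \<zero>\<^bsub>quotient_algebra (tensor_algebra B) I\<^esub>"
    then have "f \<in> I" using coset_eq_zero_iff[OF I f] by (simp add: quotient_algebra_def FactRing_def)
    then have "I +>\<^bsub>tensor_algebra B\<^esub> (deg_part f n) = I" using hom coset_eq_zero_iff[OF I tensor_carrier_deg_part[OF f]] by blast
    then show "I +>\<^bsub>tensor_algebra B\<^esub> (deg_part f n) = \<zero>\<^bsub>quotient_algebra (tensor_algebra B) I\<^esub>"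
      by (simp add: quotient_algebra_def FactRing_def)
  qed (simp_all add: quotient_algebra_def FactRing_def zero smult)
qed

text \<open>The matrix \<open>M i\<close> acts on the letter in position \<open>i\<close> by \<open>x \<mapsto> \<Sum>\<^sub>y M i x y y\<close>; \<open>act\<close> is the
  dual action on linear forms.\<close>

fun letterwise :: "'x set \<Rightarrow> (nat \<Rightarrow> 'x \<Rightarrow> 'x \<Rightarrow> 'k::field) \<Rightarrow> ('x list \<Rightarrow> 'k) \<Rightarrow> 'x list \<Rightarrow> 'k" where
  "letterwise B M f [] = f []"
| "letterwise B M f (y # w) = (if y \<in> B then \<Sum>x\<in>B. M 0 x y * letterwise B (\<lambda>i. M (Suc i)) (\<lambda>v. f (x # v)) w else 0)"

lemma letterwise_add: "letterwise B M (\<lambda>w. f w + g w) = (\<lambda>w. letterwise B M f w + letterwise B M g w)"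
proof
  fix w show "letterwise B M (\<lambda>w. f w + g w) w = letterwise B M f w + letterwise B M g w"
    by (induction w arbitrary: f g M) (simp_all add: distrib_left sum.distrib)
qed

lemma letterwise_scale: "letterwise B M (\<lambda>w. c * f w) = (\<lambda>w. c * letterwise B M f w)"
proof
  fix w show "letterwise B M (\<lambda>w. c * f w) w = c * letterwise B M f w"
    by (induction w arbitrary: f M) (simp_all add: sum_distrib_left mult.left_commute)
qed

lemma letterwise_zero [simp]: "letterwise B M (\<lambda>w. 0) = (\<lambda>w. 0)"
  using letterwise_scale[of B M 0] by simp

lemma letterwise_sum: "letterwise B M (\<lambda>w. \<Sum>i\<in>N. g i w) = (\<lambda>w. \<Sum>i\<in>N. letterwise B M (g i) w)"
  by (induction N rule: infinite_finite_induct) (simp_all add: letterwise_add)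

lemma letterwise_unit [simp]: "letterwise B M unit_word = unit_word"
proof
  fix w show "letterwise B M unit_word w = unit_word w"
  proof (cases w)
    case (Cons y v)
    have "(\<lambda>v. unit_word (x # v)) = (\<lambda>v. 0 :: 'b)" for x :: 'a by (simp add: unit_word_def)
    then show ?thesis by (simp add: Cons) (simp add: unit_word_def)
  qed simp
qed

lemma letterwise_nonzero:
  assumes "letterwise B M f w \<noteq> 0"
  shows "set w \<subseteq> B \<and> (\<exists>v. length v = length w \<and> f v \<noteq> 0)"
  using assms
proof (induction w arbitrary: f M)
  case (Cons y w)
  then have y: "y \<in> B" and "(\<Sum>x\<in>B. M 0 x y * letterwise B (\<lambda>i. M (Suc i)) (\<lambda>v. f (x # v)) w) \<noteq> 0"
    by (auto split: if_splits)
  then obtain x where "M 0 x y * letterwise B (\<lambda>i. M (Suc i)) (\<lambda>v. f (x # v)) w \<noteq> 0" by (meson sum.neutral)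
  then have "letterwise B (\<lambda>i. M (Suc i)) (\<lambda>v. f (x # v)) w \<noteq> 0" by simp
  from Cons.IH[OF this] obtain v where "set w \<subseteq> B" "length v = length w" "f (x # v) \<noteq> 0" by blast
  then show ?case using y by (intro conjI exI[of _ "x # v"]) auto
qed auto

lemma letterwise_carrier [simp]:
  assumes "finite B" "f \<in> tensor_carrier B"
  shows "letterwise B M f \<in> tensor_carrier B"
proof -
  obtain N where N: "\<forall>w. f w \<noteq> 0 \<longrightarrow> set w \<subseteq> B \<and> length w \<le> N" using tensor_carrier_bounded[OF assms(2)] by blast
  show ?thesis
  proof (rule tensor_carrierI[OF assms(1), of _ N])
    fix w assume "letterwise B M f w \<noteq> 0"
    from letterwise_nonzero[OF this] N show "set w \<subseteq> B \<and> length w \<le> N" by metis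
  qed
qed

lemma letterwise_grade:
  assumes "finite B" "f \<in> tensor_grade B n"
  shows "letterwise B M f \<in> tensor_grade B n"
  using letterwise_carrier[OF assms(1), of f M] letterwise_nonzero[of B M f] assms(2) unfolding tensor_grade_def by fastforce

lemma letterwise_deg_part: "letterwise B M (deg_part f n) = deg_part (letterwise B M f) n"
proof
  fix w show "letterwise B M (deg_part f n) w = deg_part (letterwise B M f) n w"
  proof (induction w arbitrary: f n M)
    case (Cons y w)
    show ?case
    proof (cases n)
      case 0
      then have "(\<lambda>v. deg_part f n (x # v)) = (\<lambda>v. 0)" for x by (simp add: deg_part_def)
      then show ?thesis using 0 by simp (simp add: deg_part_def)
    next
      case (Suc m)
      then have "(\<lambda>v. deg_part f n (x # v)) = deg_part (\<lambda>v. f (x # v)) m" for x by (auto simp: deg_part_def)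
      then show ?thesis using Suc Cons by simp (simp add: deg_part_def)
    qed
  qed (simp add: deg_part_def)
qed

text \<open>When a word is cut after \<open>i\<close> letters, the second factor is acted on by the
  family shifted by \<open>i\<close>. This shift is the source of the twist in the
  multiplication.\<close>

lemma letterwise_conv:
  "letterwise B M (conv f g) w = (\<Sum>i\<le>length w. letterwise B M f (take i w) * letterwise B (\<lambda>j. M (i + j)) g (drop i w))"
proof (induction w arbitrary: f M)
  case (Cons y w)
  show ?case
  proof (cases "y \<in> B")
    case True
    let ?M = "\<lambda>i. M (Suc i)"
    have "letterwise B M (conv f g) (y # w) = (\<Sum>x\<in>B. M 0 x y * (f [] * letterwise B ?M (\<lambda>v. g (x # v)) w + letterwise B ?M (conv (\<lambda>v. f (x # v)) g) w))"
      using True by (simp add: letterwise_add letterwise_scale)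
    also have "\<dots> = f [] * letterwise B M g (y # w) + (\<Sum>x\<in>B. M 0 x y * letterwise B ?M (conv (\<lambda>v. f (x # v)) g) w)"
      using True by (simp add: distrib_left sum.distrib sum_distrib_left mult.left_commute)
    also have "(\<Sum>x\<in>B. M 0 x y * letterwise B ?M (conv (\<lambda>v. f (x # v)) g) w) =
      (\<Sum>i\<le>length w. letterwise B M f (take (Suc i) (y # w)) * letterwise B (\<lambda>j. M (Suc i + j)) g (drop (Suc i) (y # w)))"
      using True by (simp add: Cons sum_distrib_left sum_distrib_right mult.assoc sum.swap[of _ B])
    finally show ?thesis by (simp add: sum.atMost_Suc_shift del: sum.atMost_Suc)
  next
    case False
    have "letterwise B M f (take i (y # w)) * letterwise B (\<lambda>j. M (i + j)) g (drop i (y # w)) = 0" for i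
      using False by (cases i) simp_all
    then have "(\<Sum>i\<le>length (y # w). letterwise B M f (take i (y # w)) * letterwise B (\<lambda>j. M (i + j)) g (drop i (y # w))) = 0"
      by (intro sum.neutral) blast
    then show ?thesis using False by (simp only: letterwise.simps if_False)
  qed
qed simp

text \<open>For \<open>f\<close> of degree \<open>m\<close> the only cut that contributes is the one
  after \<open>m\<close> letters, so the shift becomes constant.\<close>

lemma letterwise_conv_grade:
  assumes "f \<in> tensor_grade B m" "finite B"
  shows "letterwise B M (conv f g) = conv (letterwise B M f) (letterwise B (\<lambda>j. M (m + j)) g)"
proof
  fix w
  have "letterwise B M f (take i w) * letterwise B (\<lambda>j. M (i + j)) g (drop i w) = letterwise B M f (take i w) * letterwise B (\<lambda>j. M (m + j)) g (drop i w)"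
    if "i \<in> {..length w}" for i
  proof (cases "letterwise B M f (take i w) = 0")
    case False
    then have "length (take i w) = m" using letterwise_grade[OF assms(2,1)] unfolding tensor_grade_def by blast
    then show ?thesis using that by simp
  qed simp
  then have "(\<Sum>i\<le>length w. letterwise B M f (take i w) * letterwise B (\<lambda>j. M (i + j)) g (drop i w)) =
    (\<Sum>i\<le>length w. letterwise B M f (take i w) * letterwise B (\<lambda>j. M (m + j)) g (drop i w))"
    by (rule sum.cong[OF refl])
  then show "letterwise B M (conv f g) w = conv (letterwise B M f) (letterwise B (\<lambda>j. M (m + j)) g) w"
    by (simp add: letterwise_conv conv_def[of "letterwise B M f"])
qed

definition mat_mult :: "'x set \<Rightarrow> ('x \<Rightarrow> 'x \<Rightarrow> 'k::field) \<Rightarrow> ('x \<Rightarrow> 'x \<Rightarrow> 'k) \<Rightarrow> 'x \<Rightarrow> 'x \<Rightarrow> 'k" where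
  "mat_mult B N M = (\<lambda>x z. \<Sum>y\<in>B. N x y * M y z)"

definition mat_one :: "'x set \<Rightarrow> 'x \<Rightarrow> 'x \<Rightarrow> 'k::field" where
  "mat_one B x y = (if x = y \<and> x \<in> B then 1 else 0)"

text \<open>Matrices are functions on the whole type; requiring them to vanish outside
  \<open>B\<close> makes \<open>mat_one B\<close> a neutral element, so that the invertible ones are
  the units of a monoid.\<close>

definition Mat :: "'x set \<Rightarrow> ('x \<Rightarrow> 'x \<Rightarrow> 'k::field) monoid" where
  "Mat B = \<lparr>carrier = {m. \<forall>x y. m x y \<noteq> 0 \<longrightarrow> x \<in> B \<and> y \<in> B}, monoid.mult = mat_mult B, one = mat_one B\<rparr>"

definition GL :: "'x set \<Rightarrow> ('x \<Rightarrow> 'x \<Rightarrow> 'k::field) monoid" where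
  "GL B = units_of (Mat B)"

lemma mat_mult_assoc: "mat_mult B (mat_mult B L M) N = mat_mult B L (mat_mult B M N)"
  by (auto simp: mat_mult_def fun_eq_iff sum_distrib_left sum_distrib_right mult.assoc intro: sum.swap)

lemma monoid_Mat: "finite B \<Longrightarrow> Group.monoid (Mat B :: ('x \<Rightarrow> 'x \<Rightarrow> 'k::field) monoid)"
proof (rule Group.monoidI)
  fix m n :: "'x \<Rightarrow> 'x \<Rightarrow> 'k" assume B: "finite B" and m: "m \<in> carrier (Mat B)"
  have 0: "m x y = 0" if "x \<notin> B \<or> y \<notin> B" for x y using that m by (auto simp: Mat_def)
  show "\<one>\<^bsub>Mat B\<^esub> \<otimes>\<^bsub>Mat B\<^esub> m = m"
  proof (intro ext)
    fix x z
    have "mat_mult B (mat_one B) m x z = (\<Sum>y\<in>B. if y = x then m x z else 0)"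
      unfolding mat_mult_def by (rule sum.cong) (auto simp: mat_one_def)
    then show "(\<one>\<^bsub>Mat B\<^esub> \<otimes>\<^bsub>Mat B\<^esub> m) x z = m x z" using B 0 by (auto simp: Mat_def)
  qed
  show "m \<otimes>\<^bsub>Mat B\<^esub> \<one>\<^bsub>Mat B\<^esub> = m"
  proof (intro ext)
    fix x z
    have "mat_mult B m (mat_one B) x z = (\<Sum>y\<in>B. if y = z then m x z else 0)"
      unfolding mat_mult_def by (rule sum.cong) (auto simp: mat_one_def)
    then show "(m \<otimes>\<^bsub>Mat B\<^esub> \<one>\<^bsub>Mat B\<^esub>) x z = m x z" using B 0 by (auto simp: Mat_def)
  qed
  assume n: "n \<in> carrier (Mat B)"
  show "m \<otimes>\<^bsub>Mat B\<^esub> n \<in> carrier (Mat B)"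
  proof -
    have "x \<in> B \<and> z \<in> B" if nz: "mat_mult B m n x z \<noteq> 0" for x z
    proof -
      obtain y where "m x y * n y z \<noteq> 0" using nz unfolding mat_mult_def by (meson sum.neutral)
      then show ?thesis using m n by (auto simp: Mat_def)
    qed
    then show ?thesis by (simp add: Mat_def)
  qed
next
  show "\<one>\<^bsub>Mat B\<^esub> \<in> carrier (Mat B)" by (simp add: Mat_def mat_one_def)
qed (simp add: Mat_def mat_mult_assoc)

lemma group_GL: "finite B \<Longrightarrow> group (GL B)"
  unfolding GL_def by (rule monoid.units_group[OF monoid_Mat])

lemma GL_simps: "x \<otimes>\<^bsub>GL B\<^esub> y = mat_mult B x y" "\<one>\<^bsub>GL B\<^esub> = mat_one B"
  by (simp_all add: GL_def units_of_def Mat_def)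

lemma GL_support: "m \<in> carrier (GL B) \<Longrightarrow> m x y \<noteq> 0 \<Longrightarrow> x \<in> B \<and> y \<in> B"
  by (auto simp: GL_def units_of_def Units_def Mat_def)

text \<open>The one-sided inverses may be arbitrary functions. Cut off outside \<open>B\<close> they
  lie in the monoid, where a left and a right inverse coincide.\<close>

lemma GLI:
  assumes B: "finite B" and m: "\<And>x y. m x y \<noteq> 0 \<Longrightarrow> x \<in> B \<and> y \<in> B"
    and l: "\<exists>l. \<forall>x\<in>B. \<forall>z\<in>B. (\<Sum>y\<in>B. l x y * m y z) = mat_one B x z"
    and r: "\<exists>r. \<forall>x\<in>B. \<forall>z\<in>B. (\<Sum>y\<in>B. m x y * r y z) = mat_one B x z"
  shows "m \<in> carrier (GL B)"
proof -
  interpret Group.monoid "Mat B :: ('a \<Rightarrow> 'a \<Rightarrow> 'b) monoid" by (rule monoid_Mat[OF B])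
  define cut where "cut l = (\<lambda>x y. if x \<in> B \<and> y \<in> B then l x y else 0)" for l :: "'a \<Rightarrow> 'a \<Rightarrow> 'b"
  have cut: "cut l \<in> carrier (Mat B)" for l by (simp add: cut_def Mat_def)
  have mc: "m \<in> carrier (Mat B)" using m by (auto simp: Mat_def)
  obtain l r where l: "\<forall>x\<in>B. \<forall>z\<in>B. (\<Sum>y\<in>B. l x y * m y z) = mat_one B x z"
    and r: "\<forall>x\<in>B. \<forall>z\<in>B. (\<Sum>y\<in>B. m x y * r y z) = mat_one B x z" using l r by blast
  have "mat_mult B (cut l) m x z = mat_one B x z" for x z
  proof (cases "x \<in> B \<and> z \<in> B")
    case True
    then have "mat_mult B (cut l) m x z = (\<Sum>y\<in>B. l x y * m y z)" unfolding mat_mult_def by (intro sum.cong) (auto simp: cut_def)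
    then show ?thesis using l True by simp
  next
    case False
    then have "\<And>y. cut l x y * m y z = 0" using m by (auto simp: cut_def)
    then have "mat_mult B (cut l) (m) x z = 0" unfolding mat_mult_def by (intro sum.neutral) blast
    then show ?thesis using False by (auto simp: mat_one_def)
  qed
  then have 1: "cut l \<otimes>\<^bsub>Mat B\<^esub> m = \<one>\<^bsub>Mat B\<^esub>" by (auto simp: Mat_def)
  have "mat_mult B m (cut r) x z = mat_one B x z" for x z
  proof (cases "x \<in> B \<and> z \<in> B")
    case True
    then have "mat_mult B m (cut r) x z = (\<Sum>y\<in>B. m x y * r y z)" unfolding mat_mult_def by (intro sum.cong) (auto simp: cut_def)
    then show ?thesis using r True by simp
  next
    case False
    then have "\<And>y. m x y * cut r y z = 0" using m by (auto simp: cut_def)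
    then have "mat_mult B (m) (cut r) x z = 0" unfolding mat_mult_def by (intro sum.neutral) blast
    then show ?thesis using False by (auto simp: mat_one_def)
  qed
  then have 2: "m \<otimes>\<^bsub>Mat B\<^esub> cut r = \<one>\<^bsub>Mat B\<^esub>" by (auto simp: Mat_def)
  have "cut l = cut r" using inv_unique[OF 1 2 mc cut cut] .
  then have "m \<in> Units (Mat B)" using 1 2 cut mc by (auto simp: Units_def)
  then show ?thesis by (simp add: GL_def units_of_def)
qed

text \<open>Acting by \<open>N\<close> and then by \<open>M\<close> gives the product
  \<open>N M\<close>: the letterwise action reverses products, whereas the dual action
  \<open>act\<close> preserves them.\<close>

lemma letterwise_letterwise: "letterwise B M (letterwise B N f) = letterwise B (\<lambda>i. mat_mult B (N i) (M i)) f"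
proof
  fix w show "letterwise B M (letterwise B N f) w = letterwise B (\<lambda>i. mat_mult B (N i) (M i)) f w"
  proof (induction w arbitrary: M N f)
    case (Cons z w)
    show ?case
    proof (cases "z \<in> B")
      case True
      let ?M = "\<lambda>i. M (Suc i)" and ?N = "\<lambda>i. N (Suc i)"
      have "letterwise B M (letterwise B N f) (z # w) = (\<Sum>y\<in>B. M 0 y z * letterwise B ?M (\<lambda>v. \<Sum>x\<in>B. N 0 x y * letterwise B ?N (\<lambda>u. f (x # u)) v) w)"
        using True by simp
      also have "\<dots> = (\<Sum>y\<in>B. \<Sum>x\<in>B. M 0 y z * (N 0 x y * letterwise B ?M (letterwise B ?N (\<lambda>u. f (x # u))) w))"
        by (simp add: letterwise_sum letterwise_scale sum_distrib_left)
      also have "\<dots> = (\<Sum>x\<in>B. mat_mult B (N 0) (M 0) x z * letterwise B ?M (letterwise B ?N (\<lambda>u. f (x # u))) w)"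
        by (subst sum.swap) (simp add: mat_mult_def sum_distrib_right ac_simps)
      finally show ?thesis using True by (simp add: Cons)
    qed simp
  qed simp
qed

lemma letterwise_id:
  fixes f :: "'x list \<Rightarrow> 'k::field"
  assumes "finite B" "f \<in> tensor_carrier B"
  shows "letterwise B (\<lambda>i. mat_one B) f = f"
proof
  fix w
  have "letterwise B (\<lambda>i. mat_one B) f w = (if set w \<subseteq> B then f w else 0)" for f :: "'x list \<Rightarrow> 'k"
  proof (induction w arbitrary: f)
    case (Cons y w)
    have "(\<Sum>x\<in>B. mat_one B x y * letterwise B (\<lambda>i. mat_one B) (\<lambda>v. f (x # v)) w) = (\<Sum>x\<in>B. if x = y then letterwise B (\<lambda>i. mat_one B) (\<lambda>v. f (y # v)) w else 0)"
      by (rule sum.cong) (auto simp: mat_one_def)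
    then have "letterwise B (\<lambda>i. mat_one B) f (y # w) = (if y \<in> B then letterwise B (\<lambda>i. mat_one B) (\<lambda>v. f (y # v)) w else 0)"
      using assms(1) by (simp add: sum.delta)
    then show ?case unfolding Cons by auto
  qed simp
  then show "letterwise B (\<lambda>i. mat_one B) f w = f w" using assms(2) by (auto simp: tensor_carrier_def)
qed

lemma deg_part_conv:
  "deg_part (conv f g) n = (\<lambda>w. \<Sum>j\<le>n. conv (deg_part f j) (deg_part g (n - j)) w)"
proof
  fix w
  have *: "conv (deg_part f j) (deg_part g (n - j)) w = (if length w = n then f (take j w) * g (drop j w) else 0)" if "j \<le> n" for j
  proof -
    have "conv (deg_part f j) (deg_part g (n - j)) w = (\<Sum>i\<le>length w. if i = j then (if length w = n then f (take j w) * g (drop j w) else 0) else 0)"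
      unfolding conv_def by (rule sum.cong) (use that in \<open>auto simp: deg_part_def\<close>)
    then show ?thesis using that by (auto simp: sum.delta)
  qed
  show "deg_part (conv f g) n w = (\<Sum>j\<le>n. conv (deg_part f j) (deg_part g (n - j)) w)"
  proof (cases "length w = n")
    case True
    then have "deg_part (conv f g) n w = (\<Sum>j\<le>n. f (take j w) * g (drop j w))" by (simp add: deg_part_def conv_def)
    also have "\<dots> = (\<Sum>j\<le>n. conv (deg_part f j) (deg_part g (n - j)) w)" by (rule sum.cong) (simp_all add: * True)
    finally show ?thesis .
  next
    case False
    then show ?thesis by (simp add: * deg_part_def[of "conv f g"])
  qed
qed

text \<open>\<open>letterwise\<close> is not multiplicative, so the preimage of an ideal is replaced by the largest subset
  that is stable under shifts of the family and under homogeneous components.\<close>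

lemma letterwise_ideal:
  fixes f :: "'x list \<Rightarrow> 'k::field"
  assumes B: "finite B" and R1: "R1 \<subseteq> tensor_carrier B" and R2: "ideal I (tensor_algebra B)"
    and gen: "\<And>i n g. g \<in> R1 \<Longrightarrow> letterwise B (\<lambda>j. M (i + j)) (deg_part g n) \<in> I"
    and f: "f \<in> Idl\<^bsub>tensor_algebra B\<^esub> R1"
  shows "letterwise B M (deg_part f n) \<in> I"
proof -
  interpret ring "tensor_algebra B" by (rule ring_tensor_algebra)
  note D = ideal_tensor_algebraD[OF R2]
  define J where "J = {f \<in> tensor_carrier B. \<forall>i n. letterwise B (\<lambda>j. M (i + j)) (deg_part f n) \<in> I}"
  have "ideal J (tensor_algebra B)"
  proof (rule ideal_tensor_algebraI)
    show "J \<subseteq> tensor_carrier B" by (auto simp: J_def)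
    show "(\<lambda>w. 0) \<in> J" using D(2) by (simp add: J_def letterwise_deg_part) (simp add: deg_part_def)
    show "(\<lambda>w. f w + g w) \<in> J" if "f \<in> J" "g \<in> J" for f g
      using that D(3) by (simp add: J_def deg_part_add letterwise_add)
  next
    fix a f :: "'x list \<Rightarrow> 'k" assume a: "a \<in> tensor_carrier B" and f: "f \<in> J"
    then have f': "f \<in> tensor_carrier B" by (simp add: J_def)
    have "letterwise B (\<lambda>j. M (i + j)) (deg_part (conv a f) n) \<in> I" for i n
    proof -
      \<comment> \<open>A left factor of degree \<open>m\<close> moves \<open>f\<close> by
        \<open>m\<close> positions; membership of \<open>f\<close> in \<open>J\<close> covers all
        shifts \<open>i + m\<close>.\<close>
      have "conv (letterwise B (\<lambda>j. M (i + j)) (deg_part a m)) (letterwise B (\<lambda>j. M (i + (m + j))) (deg_part f (n - m))) \<in> I" for m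
        using f a by (intro D(4)) (auto simp: J_def B add.assoc[symmetric])
      then show ?thesis unfolding deg_part_conv letterwise_sum
        by (intro ideal_tensor_algebra_sum[OF R2]) (simp add: letterwise_conv_grade[OF deg_part_grade[OF a] B])
    qed
    then show "conv a f \<in> J" using a f' by (simp add: J_def)
    have "letterwise B (\<lambda>j. M (i + j)) (deg_part (conv f a) n) \<in> I" for i n
    proof -
      have "conv (letterwise B (\<lambda>j. M (i + j)) (deg_part f m)) (letterwise B (\<lambda>j. M (i + (m + j))) (deg_part a (n - m))) \<in> I" for m
        using f a by (intro D(5)) (auto simp: J_def B)
      then show ?thesis unfolding deg_part_conv letterwise_sum
        by (intro ideal_tensor_algebra_sum[OF R2]) (simp add: letterwise_conv_grade[OF deg_part_grade[OF f'] B])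
    qed
    then show "conv f a \<in> J" using a f' by (simp add: J_def)
  qed
  moreover have "R1 \<subseteq> J" using R1 gen by (auto simp: J_def)
  ultimately have "Idl\<^bsub>tensor_algebra B\<^esub> R1 \<subseteq> J" by (rule genideal_minimal)
  then have "letterwise B (\<lambda>j. M (0 + j)) (deg_part f n) \<in> I" using f unfolding J_def by blast
  then show ?thesis by simp
qed

lemma ideal_Idl: "R \<subseteq> tensor_carrier B \<Longrightarrow> ideal (Idl\<^bsub>tensor_algebra B\<^esub> R) (tensor_algebra B)"
  using ring.genideal_ideal[OF ring_tensor_algebra, of R B] by simp

lemma Idl_self: "R \<subseteq> tensor_carrier B \<Longrightarrow> g \<in> R \<Longrightarrow> g \<in> Idl\<^bsub>tensor_algebra B\<^esub> R"
  using ring.genideal_self[OF ring_tensor_algebra, of R B] by auto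

lemma deg_part_mem_ideal:
  assumes "g \<in> tensor_grade B d" "ideal I (tensor_algebra B)" "g \<in> I"
  shows "deg_part g n \<in> I"
  using assms ideal_tensor_algebraD(2)[OF assms(2)] by (simp add: deg_part_of_grade)

text \<open>The constant family of identity matrices in \<open>letterwise_ideal\<close> gives
  homogeneity.\<close>

lemma Idl_homogeneous:
  assumes B: "finite B" and R: "R \<subseteq> tensor_grade B d" and f: "f \<in> Idl\<^bsub>tensor_algebra B\<^esub> R"
  shows "deg_part f n \<in> Idl\<^bsub>tensor_algebra B\<^esub> R"
proof -
  have R': "R \<subseteq> tensor_carrier B" using R grade_carrier by blast
  have "letterwise B (\<lambda>j. mat_one B) (deg_part f n) \<in> Idl\<^bsub>tensor_algebra B\<^esub> R"
  proof (rule letterwise_ideal[OF B R' ideal_Idl[OF R'] _ f])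
    fix g n assume g: "g \<in> R"
    then have "deg_part g n \<in> Idl\<^bsub>tensor_algebra B\<^esub> R" using R Idl_self[OF R' g] by (intro deg_part_mem_ideal[OF _ ideal_Idl[OF R']]) auto
    moreover have "g \<in> tensor_carrier B" using g R' by auto
    ultimately show "letterwise B (\<lambda>j. mat_one B) (deg_part g n) \<in> Idl\<^bsub>tensor_algebra B\<^esub> R" by (simp add: letterwise_id B)
  qed
  moreover have "f \<in> tensor_carrier B" using ideal_tensor_algebraD(1)[OF ideal_Idl[OF R'] f] .
  ultimately show ?thesis by (simp add: letterwise_id B)
qed

text \<open>Generators of a single degree are their own homogeneous component, so it suffices that
  every shift of the family maps generators to generators. The element \<open>f\<close> is then
  treated one component at a time.\<close>

lemma letterwise_Idl:
  assumes B: "finite B" and R1: "R1 \<subseteq> tensor_grade B d" and R2: "R2 \<subseteq> tensor_grade B d"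
    and gen: "\<And>i g. g \<in> R1 \<Longrightarrow> letterwise B (\<lambda>j. M (i + j)) g \<in> R2"
    and f: "f \<in> Idl\<^bsub>tensor_algebra B\<^esub> R1"
  shows "letterwise B M f \<in> Idl\<^bsub>tensor_algebra B\<^esub> R2"
proof -
  have R1': "R1 \<subseteq> tensor_carrier B" and R2': "R2 \<subseteq> tensor_carrier B" using R1 R2 grade_carrier by blast+
  have fc: "f \<in> tensor_carrier B" using ideal_tensor_algebraD(1)[OF ideal_Idl[OF R1'] f] .
  have *: "letterwise B M (deg_part f n) \<in> Idl\<^bsub>tensor_algebra B\<^esub> R2" for n
  proof (rule letterwise_ideal[OF B R1' ideal_Idl[OF R2'] _ f])
    fix i n g assume g: "g \<in> R1"
    have "letterwise B (\<lambda>j. M (i + j)) g \<in> R2" using gen[OF g] .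
    then show "letterwise B (\<lambda>j. M (i + j)) (deg_part g n) \<in> Idl\<^bsub>tensor_algebra B\<^esub> R2"
      unfolding letterwise_deg_part using R2 Idl_self[OF R2'] by (intro deg_part_mem_ideal[OF _ ideal_Idl[OF R2']]) auto
  qed
  have "letterwise B M (\<lambda>w. \<Sum>n\<in>length ` {w. f w \<noteq> 0}. deg_part f n w) \<in> Idl\<^bsub>tensor_algebra B\<^esub> R2"
    unfolding letterwise_sum by (rule ideal_tensor_algebra_sum[OF ideal_Idl[OF R2'] *])
  then show ?thesis by (subst (asm) sum_deg_part) (use finite_degrees[OF fc] in auto)
qed

definition subspace :: "('a \<Rightarrow> 'k::field) set \<Rightarrow> bool" where
  "subspace R \<longleftrightarrow> (\<lambda>w. 0) \<in> R \<and> (\<forall>f\<in>R. \<forall>g\<in>R. (\<lambda>w. f w + g w) \<in> R) \<and> (\<forall>c. \<forall>f\<in>R. (\<lambda>w. c * f w) \<in> R)"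

text \<open>The elements without part in degree below 2 and with degree 2 part in \<open>R\<close>
  form an ideal: multiplication by \<open>a\<close> on either side multiplies the degree 2 part by
  the scalar \<open>a []\<close>. Thus the quotient has no relations in degree 1, and its degree 2
  part remembers \<open>R\<close>.\<close>

lemma Idl_low_degree:
  fixes f :: "'x list \<Rightarrow> 'k::field"
  assumes R: "R \<subseteq> tensor_grade B 2" "subspace R" and f: "f \<in> Idl\<^bsub>tensor_algebra B\<^esub> R"
  shows "length w < 2 \<Longrightarrow> f w = 0" "deg_part f 2 \<in> R"
proof -
  interpret ring "tensor_algebra B" by (rule ring_tensor_algebra)
  define J where "J = {f \<in> tensor_carrier B. (\<forall>w. length w < 2 \<longrightarrow> f w = 0) \<and> deg_part f 2 \<in> R}"
  have "ideal J (tensor_algebra B)"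
  proof (rule ideal_tensor_algebraI)
    show "J \<subseteq> tensor_carrier B" by (auto simp: J_def)
    show "(\<lambda>w. 0) \<in> J" using R by (simp add: J_def deg_part_def subspace_def)
    show "(\<lambda>w. f w + g w) \<in> J" if "f \<in> J" "g \<in> J" for f g
      using that R(2) by (simp add: J_def deg_part_add subspace_def)
  next
    fix a f :: "'x list \<Rightarrow> 'k" assume a: "a \<in> tensor_carrier B" and f: "f \<in> J"
    then have f0: "\<And>w. length w < 2 \<Longrightarrow> f w = 0" and f2: "deg_part f 2 \<in> R" and fc: "f \<in> tensor_carrier B" by (auto simp: J_def)
    have af: "conv a f w = (if length w = 2 then a [] * f w else 0)" if "length w \<le> 2" for w
    proof -
      have "conv a f w = (\<Sum>i\<le>length w. if i = 0 then (if length w = 2 then a [] * f w else 0) else 0)"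
        unfolding conv_def using that f0 by (intro sum.cong) auto
      then show ?thesis by (simp add: sum.delta)
    qed
    have fa: "conv f a w = (if length w = 2 then a [] * f w else 0)" if "length w \<le> 2" for w
    proof -
      have "conv f a w = (\<Sum>i\<le>length w. if i = length w then (if length w = 2 then a [] * f w else 0) else 0)"
        unfolding conv_def using that f0 by (intro sum.cong) auto
      then show ?thesis by (simp add: sum.delta)
    qed
    have "deg_part (conv a f) 2 = (\<lambda>w. a [] * deg_part f 2 w)" "deg_part (conv f a) 2 = (\<lambda>w. a [] * deg_part f 2 w)"
      using af fa by (auto simp: deg_part_def)
    moreover have "(\<lambda>w. a [] * deg_part f 2 w) \<in> R" using R(2) f2 by (simp add: subspace_def)
    ultimately show "conv a f \<in> J" "conv f a \<in> J" using a fc af fa by (auto simp: J_def)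
  qed
  moreover have "R \<subseteq> J"
  proof
    fix g assume "g \<in> R"
    then have g: "g \<in> tensor_grade B 2" using R(1) by blast
    have "g w = 0" if "length w < 2" for w using g that unfolding tensor_grade_def by force
    then show "g \<in> J" using g \<open>g \<in> R\<close> by (simp add: J_def grade_carrier deg_part_of_grade)
  qed
  ultimately have "Idl\<^bsub>tensor_algebra B\<^esub> R \<subseteq> J" by (rule genideal_minimal)
  then show "length w < 2 \<Longrightarrow> f w = 0" "deg_part f 2 \<in> R" using f unfolding J_def by blast+
qed

lemma presents_quadratic:
  assumes "finite B" "R \<subseteq> tensor_grade B 2"
  shows "presents B (\<lambda>f. Idl\<^bsub>tensor_algebra B\<^esub> R +>\<^bsub>tensor_algebra B\<^esub> f) (quadratic_algebra B R)"
  unfolding quadratic_algebra_def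
proof (rule presents_quotient)
  have "R \<subseteq> tensor_carrier B" using assms(2) grade_carrier by blast
  then show "ideal (Idl\<^bsub>tensor_algebra B\<^esub> R) (tensor_algebra B)" by (rule ideal_Idl)
qed (rule Idl_homogeneous[OF assms])

section \<open>Twists of quadratic algebras\<close>

lemma tensor_grade_zero [simp]: "(\<lambda>w. 0) \<in> tensor_grade B n"
  by (simp add: tensor_grade_def)

definition single :: "'x \<Rightarrow> 'x list \<Rightarrow> 'k::field" where
  "single x = (\<lambda>w. if w = [x] then 1 else 0)"

definition row :: "('x \<Rightarrow> 'x \<Rightarrow> 'k::field) \<Rightarrow> 'x \<Rightarrow> 'x list \<Rightarrow> 'k" where
  "row m x = (\<lambda>w. if length w = 1 then m x (hd w) else 0)"

lemma single_grade: "x \<in> B \<Longrightarrow> single x \<in> tensor_grade B 1"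
  by (auto simp: single_def tensor_grade_def tensor_carrier_def)

lemma row_grade:
  assumes "finite B" "\<And>x y. m x y \<noteq> 0 \<Longrightarrow> y \<in> B"
  shows "row m x \<in> tensor_grade B 1"
proof -
  have "row m x \<in> tensor_carrier B"
    by (rule tensor_carrierI[OF assms(1), of _ 1]) (use assms(2) in \<open>auto simp: row_def length_Suc_conv split: if_splits\<close>)
  then show ?thesis by (auto simp: tensor_grade_def row_def)
qed

lemma row_eqD: "row m x = row m' x' \<Longrightarrow> m x y = m' x' y"
  by (drule fun_cong[of _ _ "[y]"]) (simp add: row_def)

lemma row_mat_one: "x \<in> B \<Longrightarrow> row (mat_one B) x = single x"
  by (auto simp: row_def mat_one_def single_def length_Suc_conv fun_eq_iff)

lemma grade_1_row: "v \<in> tensor_grade B 1 \<Longrightarrow> row (\<lambda>x y. v [y]) x = v"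
  by (auto simp: row_def tensor_grade_def fun_eq_iff length_Suc_conv)

lemma letterwise_single:
  fixes M :: "nat \<Rightarrow> 'x \<Rightarrow> 'x \<Rightarrow> 'k::field"
  assumes "finite B" "x \<in> B" "\<And>x y. M 0 x y \<noteq> 0 \<Longrightarrow> y \<in> B"
  shows "letterwise B M (single x) = row (M 0) x"
proof
  fix w
  show "letterwise B M (single x) w = row (M 0) x w"
  proof (cases w)
    case Nil
    then show ?thesis by (simp add: single_def row_def)
  next
    case (Cons y v)
    have "(\<lambda>v. single x (z # v)) = (\<lambda>v. (if z = x then 1 else 0 :: 'k) * unit_word v)" for z
      by (auto simp: single_def unit_word_def)
    then have "letterwise B M (single x) w = (if y \<in> B then (\<Sum>z\<in>B. M 0 z y * ((if z = x then 1 else 0) * unit_word v)) else 0)"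
      by (simp add: Cons letterwise_scale del: mult_cancel_left)
    also have "\<dots> = (if y \<in> B then M 0 x y * unit_word v else 0)"
    proof -
      have "(\<Sum>z\<in>B. M 0 z y * ((if z = x then 1 else 0) * unit_word v)) = (\<Sum>z\<in>B. if z = x then M 0 x y * unit_word v else 0)"
        by (rule sum.cong) auto
      then show ?thesis using assms by simp
    qed
    finally show ?thesis using assms(3)[of x y] by (auto simp: Cons row_def unit_word_def)
  qed
qed

lemma grade_1_sum:
  assumes "finite B" "v \<in> tensor_grade B 1"
  shows "v = (\<lambda>w. \<Sum>x\<in>B. v [x] * single x w)"
proof
  fix w
  show "v w = (\<Sum>x\<in>B. v [x] * single x w)"
  proof (cases "\<exists>y\<in>B. w = [y]")
    case True
    then obtain y where y: "y \<in> B" "w = [y]" by blast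
    have "(\<Sum>x\<in>B. v [x] * single x w) = (\<Sum>x\<in>B. if x = y then v [y] else 0)"
      by (rule sum.cong) (auto simp: single_def y)
    then show ?thesis using y assms(1) by simp
  next
    case False
    then have "(\<Sum>x\<in>B. v [x] * single x w) = 0" by (intro sum.neutral) (auto simp: single_def)
    moreover have "v w = 0"
    proof (rule ccontr)
      assume "v w \<noteq> 0"
      then have "length w = 1" "set w \<subseteq> B" using assms(2) by (auto simp: tensor_grade_def tensor_carrier_def)
      then show False using False by (auto simp: length_Suc_conv)
    qed
    ultimately show ?thesis by simp
  qed
qed

text \<open>Splitting off the first letter prepares the induction on the degree in
  \<open>twist_letterwise_grade\<close>.\<close>

lemma grade_Suc_sum:
  fixes f :: "'x list \<Rightarrow> 'k::field"
  assumes "finite B" "f \<in> tensor_grade B (Suc l)"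
  shows "f = (\<lambda>w. \<Sum>x\<in>B. conv (single x) (\<lambda>v. f (x # v)) w)"
proof
  fix w
  show "f w = (\<Sum>x\<in>B. conv (single x) (\<lambda>v. f (x # v)) w)"
  proof (cases w)
    case Nil
    have "f [] = 0" using assms(2) by (force simp: tensor_grade_def)
    then show ?thesis by (simp add: Nil single_def)
  next
    case (Cons y v)
    have cs: "conv (single x) g (y # v) = (if x = y then g v else 0)" for x and g :: "'x list \<Rightarrow> 'k"
    proof -
      have "(\<lambda>u. single x (y # u)) = (\<lambda>u. (if x = y then 1 else 0 :: 'k) * unit_word u)"
        by (auto simp: single_def unit_word_def)
      then have "conv (single x) g (y # v) = single x [] * g (y # v) + conv (\<lambda>u. (if x = y then 1 else 0 :: 'k) * unit_word u) g v"
        by (simp only: conv_Cons)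
      then show ?thesis unfolding conv_scale_left by (simp add: single_def)
    qed
    have "(\<Sum>x\<in>B. conv (single x) (\<lambda>v. f (x # v)) w) = (\<Sum>x\<in>B. if x = y then f (y # v) else 0)"
      unfolding Cons cs by (intro sum.cong) auto
    moreover have "f w = 0" if "y \<notin> B" using that assms(2) by (auto simp: Cons tensor_grade_def tensor_carrier_def)
    ultimately show ?thesis using assms(1) by (auto simp: Cons)
  qed
qed

lemma grade_Cons:
  assumes "f \<in> tensor_grade B (Suc l)"
  shows "(\<lambda>v. f (x # v)) \<in> tensor_grade B l"
proof -
  have "{v. f (x # v) \<noteq> 0} = Cons x -` {w. f w \<noteq> 0}" by auto
  moreover have "finite (Cons x -` {w. f w \<noteq> 0})"
    by (rule finite_vimageI) (use assms in \<open>auto simp: tensor_grade_def tensor_carrier_def inj_on_def\<close>)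
  ultimately have "finite {v. f (x # v) \<noteq> 0}" by simp
  moreover have "set v \<subseteq> B \<and> length v = l" if nz: "f (x # v) \<noteq> 0" for v
  proof -
    have "set (x # v) \<subseteq> B" "length (x # v) = Suc l"
      using nz assms unfolding tensor_grade_def tensor_carrier_def by blast+
    then show ?thesis by simp
  qed
  ultimately show ?thesis by (auto simp: tensor_grade_def tensor_carrier_def)
qed

lemma graded_linear_autD:
  assumes "\<phi> \<in> graded_linear_aut A"
  shows "\<And>a. a \<in> carrier A \<Longrightarrow> \<phi> a \<in> carrier A" "inj_on \<phi> (carrier A)" "\<phi> ` carrier A = carrier A"
    "\<And>a b. a \<in> carrier A \<Longrightarrow> b \<in> carrier A \<Longrightarrow> \<phi> (a \<oplus>\<^bsub>A\<^esub> b) = \<phi> a \<oplus>\<^bsub>A\<^esub> \<phi> b"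
    "\<And>c a. a \<in> carrier A \<Longrightarrow> \<phi> (c \<odot>\<^bsub>A\<^esub> a) = c \<odot>\<^bsub>A\<^esub> \<phi> a" "\<And>n. \<phi> ` grade A n = grade A n"
    "\<phi> \<in> extensional (carrier A)"
  using assms unfolding graded_linear_aut_def Bij_def bij_betw_def by auto

lemma graded_linear_aut_inverse:
  assumes \<phi>: "\<phi> \<in> graded_linear_aut A" and sub: "\<And>n. grade A n \<subseteq> carrier A"
    and cl: "\<And>a b. a \<in> carrier A \<Longrightarrow> b \<in> carrier A \<Longrightarrow> a \<oplus>\<^bsub>A\<^esub> b \<in> carrier A" "\<And>c a. a \<in> carrier A \<Longrightarrow> c \<odot>\<^bsub>A\<^esub> a \<in> carrier A"
  shows "restrict (inv_into (carrier A) \<phi>) (carrier A) \<in> graded_linear_aut A"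
proof -
  note D = graded_linear_autD[OF \<phi>]
  let ?\<eta> = "inv_into (carrier A) \<phi>"
  have bij: "bij_betw \<phi> (carrier A) (carrier A)" using D by (simp add: bij_betw_def)
  have \<eta>: "\<And>a. a \<in> carrier A \<Longrightarrow> ?\<eta> a \<in> carrier A \<and> \<phi> (?\<eta> a) = a"
    using D(3) by (metis f_inv_into_f inv_into_into)
  have eq: "?\<eta> a = b" if "a \<in> carrier A" "b \<in> carrier A" "\<phi> b = a" for a b
    using that D(2) by (metis inv_into_f_f)
  show ?thesis unfolding graded_linear_aut_def
  proof (intro CollectI conjI ballI allI)
    show "restrict ?\<eta> (carrier A) \<in> Bij (carrier A)"
      unfolding Bij_def using bij_betw_inv_into[OF bij] by simp
    show "restrict ?\<eta> (carrier A) (a \<oplus>\<^bsub>A\<^esub> b) = restrict ?\<eta> (carrier A) a \<oplus>\<^bsub>A\<^esub> restrict ?\<eta> (carrier A) b"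
      if "a \<in> carrier A" "b \<in> carrier A" for a b
      using that \<eta> cl by (auto intro!: eq simp: D(4))
    show "restrict ?\<eta> (carrier A) (c \<odot>\<^bsub>A\<^esub> a) = c \<odot>\<^bsub>A\<^esub> restrict ?\<eta> (carrier A) a" if "a \<in> carrier A" for c a
      using that \<eta> cl by (auto intro!: eq simp: D(5))
    show "restrict ?\<eta> (carrier A) ` grade A n = grade A n" for n
    proof -
      have "restrict ?\<eta> (carrier A) ` grade A n = ?\<eta> ` \<phi> ` grade A n"
        using sub[of n] by (auto simp: D(6) restrict_def)
      also have "\<dots> = grade A n" using sub[of n] D(2) by (simp add: inv_into_image_cancel)
      finally show ?thesis .
    qed
  qed
qed

definition shifted_family :: "(int \<Rightarrow> 'm) \<Rightarrow> int \<Rightarrow> nat \<Rightarrow> 'm" where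
  "shifted_family m n = (\<lambda>j. m (n + int j))"

lemma shifted_family_shift: "(\<lambda>j. shifted_family m n (i + j)) = shifted_family m (n + int i)"
  by (simp add: shifted_family_def add.assoc)

lemma GL_inv:
  assumes "finite B" "m \<in> carrier (GL B)"
  shows "mat_mult B m (inv\<^bsub>GL B\<^esub> m) = mat_one B" "mat_mult B (inv\<^bsub>GL B\<^esub> m) m = mat_one B" "inv\<^bsub>GL B\<^esub> m \<in> carrier (GL B)"
  using group.r_inv[OF group_GL[OF assms(1)] assms(2)] group.l_inv[OF group_GL[OF assms(1)] assms(2)]
    group.inv_closed[OF group_GL[OF assms(1)] assms(2)] by (simp_all add: GL_simps)

lemma letterwise_inverse:
  assumes "finite B" "\<And>j. M j \<in> carrier (GL B)" "f \<in> tensor_carrier B"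
  shows "letterwise B M (letterwise B (\<lambda>j. inv\<^bsub>GL B\<^esub> (M j)) f) = f" "letterwise B (\<lambda>j. inv\<^bsub>GL B\<^esub> (M j)) (letterwise B M f) = f"
  by (simp_all add: letterwise_letterwise GL_inv[OF assms(1,2)] letterwise_id assms)

text \<open>\<open>R\<close> is a subspace, so it is recovered as the degree 2 part of the ideal it
  generates.\<close>

locale quadratic =
  fixes B :: "'x set" and R :: "('x list \<Rightarrow> 'k::field) set"
  assumes fin: "finite B" and R: "R \<subseteq> tensor_grade B 2" "subspace R"
begin

definition I where "I = Idl\<^bsub>tensor_algebra B\<^esub> R"
definition \<pi> where "\<pi> f = I +>\<^bsub>tensor_algebra B\<^esub> f"
abbreviation "A \<equiv> quadratic_algebra B R"

sublocale presentation B \<pi> A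
  using presents_quadratic[OF fin R(1)] by unfold_locales (simp add: I_def \<pi>_def[abs_def])

lemma R_carrier: "R \<subseteq> tensor_carrier B"
  using R(1) grade_carrier by blast

lemma ideal_I: "ideal I (tensor_algebra B)"
  unfolding I_def by (rule ideal_Idl[OF R_carrier])

lemma \<pi>_zero_iff: "f \<in> tensor_carrier B \<Longrightarrow> \<pi> f = \<zero>\<^bsub>A\<^esub> \<longleftrightarrow> f \<in> I"
  using coset_eq_zero_iff[OF ideal_I] by (simp add: \<pi>_def quadratic_algebra_def quotient_algebra_def FactRing_def I_def)

lemma \<pi>_carrier [simp]: "f \<in> tensor_carrier B \<Longrightarrow> \<pi> f \<in> carrier A"
  by (simp add: carrier)

text \<open>All relations lie in degree at least 2. Linear maps on degree 1 of the quotient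
  therefore have well-defined matrices.\<close>

lemma \<pi>_inj_grade_1:
  assumes "f \<in> tensor_grade B 1" "g \<in> tensor_grade B 1" "\<pi> f = \<pi> g"
  shows "f = g"
proof
  fix w
  have c: "f \<in> tensor_carrier B" "g \<in> tensor_carrier B" using assms grade_carrier by blast+
  then have "(\<lambda>w. f w - g w) \<in> I" using assms(3) eq_iff[of f g] \<pi>_zero_iff by simp
  then have "length w < 2 \<Longrightarrow> f w - g w = 0" using Idl_low_degree(1)[OF R] unfolding I_def by blast
  moreover have "length w \<noteq> 1 \<Longrightarrow> f w = 0 \<and> g w = 0" using assms by (auto simp: tensor_grade_def)
  ultimately show "f w = g w" by (cases "length w = 1") auto
qed

lemma I_grade_2: "f \<in> tensor_grade B 2 \<Longrightarrow> f \<in> I \<longleftrightarrow> f \<in> R"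
  using Idl_low_degree(2)[OF R, of f] Idl_self[OF R_carrier, of f] by (auto simp: I_def deg_part_of_grade)

lemma carrier_induct [consumes 1, case_names grade add]:
  assumes "a \<in> carrier A"
    and gr: "\<And>n b. b \<in> grade A n \<Longrightarrow> P b"
    and ad: "\<And>b c. b \<in> carrier A \<Longrightarrow> c \<in> carrier A \<Longrightarrow> P b \<Longrightarrow> P c \<Longrightarrow> P (b \<oplus>\<^bsub>A\<^esub> c)"
  shows "P a"
proof -
  obtain f where f: "f \<in> tensor_carrier B" "a = \<pi> f" using assms(1) by (auto simp: carrier)
  have "P (\<pi> (\<lambda>w. \<Sum>n\<in>N. deg_part f n w))" if "finite N" for N
    using that
  proof (induction N)
    case empty
    have "\<pi> (\<lambda>w. 0) \<in> grade A 0" unfolding grade by (intro imageI tensor_grade_zero)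
    then show ?case using gr by simp
  next
    case (insert n N)
    have 1: "(\<lambda>w. \<Sum>n\<in>N. deg_part f n w) \<in> tensor_carrier B" using f by (intro tensor_carrier_sum) simp
    have "\<pi> (deg_part f n) \<in> grade A n" unfolding grade using f by (intro imageI) simp
    then have "P (\<pi> (deg_part f n))" by (rule gr)
    then have "P (\<pi> (deg_part f n) \<oplus>\<^bsub>A\<^esub> \<pi> (\<lambda>w. \<Sum>n\<in>N. deg_part f n w))"
      by (rule ad[rotated 2]) (use insert f 1 in simp_all)
    then show ?case using insert f 1 by (simp add: add)
  qed
  from this[OF finite_degrees[OF f(1)]] show ?thesis
    by (subst (asm) sum_deg_part) (use f finite_degrees[OF f(1)] in auto)
qed

lemma additive_sum:
  assumes \<phi>: "\<phi> \<in> graded_linear_aut A" and "finite N"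
    and "\<And>x. x \<in> N \<Longrightarrow> F x \<in> tensor_carrier B" "\<And>x. x \<in> N \<Longrightarrow> G x \<in> tensor_carrier B"
    and "\<And>x. x \<in> N \<Longrightarrow> \<phi> (\<pi> (F x)) = \<pi> (G x)"
  shows "\<phi> (\<pi> (\<lambda>w. \<Sum>x\<in>N. F x w)) = \<pi> (\<lambda>w. \<Sum>x\<in>N. G x w)"
  using assms(2-)
proof (induction N)
  case empty
  have "\<phi> (0 \<odot>\<^bsub>A\<^esub> \<pi> (\<lambda>w. 0)) = 0 \<odot>\<^bsub>A\<^esub> \<phi> (\<pi> (\<lambda>w. 0))" by (rule graded_linear_autD(5)[OF \<phi>]) simp
  moreover obtain g where "g \<in> tensor_carrier B" "\<phi> (\<pi> (\<lambda>w. 0)) = \<pi> g"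
    using graded_linear_autD(1)[OF \<phi>, of "\<pi> (\<lambda>w. 0)"] by (auto simp: carrier)
  ultimately show ?case by (simp add: smult)
next
  case (insert y N)
  have "(\<lambda>w. \<Sum>x\<in>N. F x w) \<in> tensor_carrier B" "(\<lambda>w. \<Sum>x\<in>N. G x w) \<in> tensor_carrier B"
    using insert by (auto intro!: tensor_carrier_sum)
  then show ?case using insert graded_linear_autD(4)[OF \<phi>, of "\<pi> (F y)" "\<pi> (\<lambda>w. \<Sum>x\<in>N. F x w)"]
    by (simp add: add)
qed

lemma aut_zero: "\<phi> \<in> graded_linear_aut A \<Longrightarrow> \<phi> \<zero>\<^bsub>A\<^esub> = \<zero>\<^bsub>A\<^esub>"
  using additive_sum[of \<phi> "{}"] by (simp add: zero)

lemma TS_D: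
  assumes "\<theta> \<in> TS A"
  shows "\<theta> n \<in> graded_linear_aut A"
    "\<lbrakk>a \<in> grade A m; b \<in> grade A l\<rbrakk> \<Longrightarrow> \<theta> n (a \<otimes>\<^bsub>A\<^esub> \<theta> (int m) b) = \<theta> n a \<otimes>\<^bsub>A\<^esub> \<theta> (n + int m) b"
  using assms unfolding TS_def by blast+

lemma grade_sub: "grade A n \<subseteq> carrier A"
  using grade_carrier by (auto simp: grade carrier)

text \<open>The twisting identity is given for homogeneous \<open>b\<close>; both sides are additive
  in \<open>b\<close>.\<close>

lemma TS_mult:
  assumes \<theta>: "\<theta> \<in> TS A" and a: "a \<in> grade A m" and b: "b \<in> carrier A"
  shows "\<theta> n (a \<otimes>\<^bsub>A\<^esub> \<theta> (int m) b) = \<theta> n a \<otimes>\<^bsub>A\<^esub> \<theta> (n + int m) b"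
  using b
proof (induction b rule: carrier_induct)
  case (grade l b)
  then show ?case by (rule TS_D(2)[OF \<theta> a])
next
  case (add b c)
  interpret ring A by (rule ring_S)
  note L = graded_linear_autD[OF TS_D(1)[OF \<theta>]]
  have ac: "a \<in> carrier A" using a grade_sub by blast
  show ?case using add ac by (simp add: L(4) L(1) r_distr)
qed

text \<open>Choose \<open>b\<close> of degree 0 that \<open>\<theta> n\<close> maps to 1. The
  twisting identity for 1 and \<open>b\<close> then has value 1 on the left and
  \<open>\<theta> n\<close> of 1 on the right.\<close>

lemma TS_one:
  assumes \<theta>: "\<theta> \<in> TS A" "\<And>a. a \<in> carrier A \<Longrightarrow> \<theta> 0 a = a"
  shows "\<theta> n \<one>\<^bsub>A\<^esub> = \<one>\<^bsub>A\<^esub>"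
proof -
  interpret graded_algebra A by (rule graded_algebra_S)
  note L = graded_linear_autD[OF TS_D(1)[OF \<theta>(1)]]
  obtain b where b: "b \<in> grade A 0" "\<theta> n b = \<one>\<^bsub>A\<^esub>"
    using grade_one L(6)[of n 0] by (metis imageE)
  have bc: "b \<in> carrier A" using b grade_sub by blast
  have "\<theta> n (\<one>\<^bsub>A\<^esub> \<otimes>\<^bsub>A\<^esub> \<theta> (int 0) b) = \<theta> n \<one>\<^bsub>A\<^esub> \<otimes>\<^bsub>A\<^esub> \<theta> (n + int 0) b"
    by (rule TS_D(2)[OF \<theta>(1) grade_one b(1)])
  then show ?thesis using b bc \<theta>(2) L(1) by simp
qed

end

text \<open>Here \<open>m n\<close> is the matrix of \<open>\<theta> n\<close> in degree 1. As
  degree 1 generates the algebra, the matrices determine the whole system, which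
  \<open>twist_letterwise\<close> makes explicit.\<close>

locale quadratic_twist = quadratic B R for B :: "'x set" and R :: "('x list \<Rightarrow> 'k::field) set" +
  fixes \<theta> :: "int \<Rightarrow> ('x list \<Rightarrow> 'k) set \<Rightarrow> ('x list \<Rightarrow> 'k) set" and m :: "int \<Rightarrow> 'x \<Rightarrow> 'x \<Rightarrow> 'k"
  assumes \<theta>: "\<theta> \<in> TS0 A" and m: "\<And>n. m n \<in> carrier (GL B)"
    and \<theta>_m: "\<And>n x. x \<in> B \<Longrightarrow> \<theta> n (\<pi> (single x)) = \<pi> (row (m n) x)"
begin

lemma \<theta>_TS: "\<theta> \<in> TS A" and \<theta>_0: "a \<in> carrier A \<Longrightarrow> \<theta> 0 a = a"
  using \<theta> unfolding TS0_def by auto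

lemma m_row: "row (m n) x \<in> tensor_grade B 1"
  by (rule row_grade[OF fin]) (use GL_support[OF m] in blast)

lemma m_0: "m 0 = mat_one B"
proof (intro ext)
  fix x y
  show "m 0 x y = mat_one B x y"
  proof (cases "x \<in> B")
    case True
    then have "\<pi> (single x) = \<pi> (row (m 0) x)"
      using \<theta>_m[OF True, of 0] \<theta>_0[OF \<pi>_carrier[OF grade_carrier[OF single_grade[OF True]]]] by simp
    then have "single x = row (m 0) x" by (rule \<pi>_inj_grade_1[OF single_grade[OF True] m_row])
    then have "row (m 0) x = row (mat_one B) x" by (simp add: row_mat_one[OF True])
    then show ?thesis by (rule row_eqD)
  qed (use GL_support[OF m[of 0], of x y] in \<open>auto simp: mat_one_def\<close>)
qed

lemma shifted_family_GL: "shifted_family m n j \<in> carrier (GL B)"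
  by (simp add: shifted_family_def m)

text \<open>Write \<open>P n\<close> for the letterwise action of \<open>shifted_family m n\<close>.
  For a first letter \<open>x\<close>, \<open>P 0 (x g) = x (P 1 g)\<close> because
  \<open>m 0\<close> is the identity, and \<open>P 1 g\<close> represents
  \<open>\<theta>\<^sub>1 (P 0 g)\<close> by induction. The twisting identity then gives
  \<open>\<theta>\<^sub>n(x) \<theta>\<^sub>n\<^sub>+\<^sub>1(P 0 g)\<close>, which is represented
  by \<open>P n (x g)\<close>.\<close>

lemma twist_letterwise_grade:
  "f \<in> tensor_grade B l \<Longrightarrow> \<theta> n (\<pi> (letterwise B (shifted_family m 0) f)) = \<pi> (letterwise B (shifted_family m n) f)"
proof (induction l arbitrary: f n)
  case 0
  have "f = (\<lambda>w. f [] * unit_word w)" using 0 by (auto simp: tensor_grade_def unit_word_def fun_eq_iff)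
  then obtain c where f: "f = (\<lambda>w. c * unit_word w)" by blast
  have "\<theta> n (c \<odot>\<^bsub>A\<^esub> \<pi> unit_word) = c \<odot>\<^bsub>A\<^esub> \<pi> unit_word"
    using graded_linear_autD(5)[OF TS_D(1)[OF \<theta>_TS], of "\<pi> unit_word"] TS_one[OF \<theta>_TS \<theta>_0, of n] one by simp
  then show ?case by (simp add: f letterwise_scale smult)
next
  case (Suc l)
  let ?g = "\<lambda>x v. f (x # v)"
  have g: "?g x \<in> tensor_grade B l" for x by (rule grade_Cons[OF Suc.prems])
  have letterwise_f: "letterwise B (shifted_family m n) f = (\<lambda>w. \<Sum>x\<in>B. conv (row (m n) x) (letterwise B (shifted_family m (n + 1)) (?g x)) w)" for n
  proof -
    have "letterwise B (shifted_family m n) f = (\<lambda>w. \<Sum>x\<in>B. letterwise B (shifted_family m n) (conv (single x) (?g x)) w)"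
      by (subst grade_Suc_sum[OF fin Suc.prems]) (rule letterwise_sum)
    also have "\<dots> = (\<lambda>w. \<Sum>x\<in>B. conv (row (m n) x) (letterwise B (shifted_family m (n + 1)) (?g x)) w)"
    proof (intro ext sum.cong refl)
      fix w x assume x: "x \<in> B"
      have "letterwise B (shifted_family m n) (single x) = row (shifted_family m n 0) x"
        by (rule letterwise_single[OF fin x]) (use GL_support[OF shifted_family_GL] in blast)
      then show "letterwise B (shifted_family m n) (conv (single x) (?g x)) w = conv (row (m n) x) (letterwise B (shifted_family m (n + 1)) (?g x)) w"
        unfolding letterwise_conv_grade[OF single_grade[OF x] fin] shifted_family_shift by (simp add: shifted_family_def)
    qed
    finally show ?thesis .
  qed
  have Pg: "letterwise B (shifted_family m n) (?g x) \<in> tensor_grade B l" for n x by (rule letterwise_grade[OF fin g])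
  show ?case unfolding letterwise_f
  proof (rule additive_sum[OF TS_D(1)[OF \<theta>_TS] fin])
    fix x assume x: "x \<in> B"
    have c: "conv (row (m k) x) (letterwise B (shifted_family m (k + 1)) (?g x)) \<in> tensor_carrier B" for k
      using m_row Pg by (intro tensor_carrier_conv) (blast intro: grade_carrier)+
    show "conv (row (m 0) x) (letterwise B (shifted_family m (0 + 1)) (?g x)) \<in> tensor_carrier B"
      "conv (row (m n) x) (letterwise B (shifted_family m (n + 1)) (?g x)) \<in> tensor_carrier B" by (rule c)+
    have s: "single x \<in> tensor_carrier B" "\<pi> (single x) \<in> grade A 1"
      using single_grade[OF x] grade_carrier by (auto simp: grade)
    have "\<theta> n (\<pi> (conv (row (m 0) x) (letterwise B (shifted_family m (0 + 1)) (?g x)))) = \<theta> n (\<pi> (single x) \<otimes>\<^bsub>A\<^esub> \<theta> (int 1) (\<pi> (letterwise B (shifted_family m 0) (?g x))))"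
      by (simp add: m_0 row_mat_one[OF x] Suc.IH[OF g] mult[OF s(1) grade_carrier[OF Pg]])
    also have "\<dots> = \<theta> n (\<pi> (single x)) \<otimes>\<^bsub>A\<^esub> \<theta> (n + int 1) (\<pi> (letterwise B (shifted_family m 0) (?g x)))"
      by (rule TS_D(2)[OF \<theta>_TS s(2), of _ l]) (use Pg in \<open>auto simp: grade\<close>)
    also have "\<dots> = \<pi> (conv (row (m n) x) (letterwise B (shifted_family m (n + 1)) (?g x)))"
      by (simp add: \<theta>_m[OF x] Suc.IH[OF g] mult[OF grade_carrier[OF m_row] grade_carrier[OF Pg]])
    finally show "\<theta> n (\<pi> (conv (row (m 0) x) (letterwise B (shifted_family m (0 + 1)) (?g x)))) = \<pi> (conv (row (m n) x) (letterwise B (shifted_family m (n + 1)) (?g x)))" .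
  qed
qed

lemma twist_letterwise:
  assumes f: "f \<in> tensor_carrier B"
  shows "\<theta> n (\<pi> (letterwise B (shifted_family m 0) f)) = \<pi> (letterwise B (shifted_family m n) f)"
proof -
  let ?N = "length ` {w. f w \<noteq> 0}"
  have f': "f = (\<lambda>w. \<Sum>n\<in>?N. deg_part f n w)" by (subst sum_deg_part) (use finite_degrees[OF f] in auto)
  have eq: "letterwise B M f = (\<lambda>w. \<Sum>n\<in>?N. letterwise B M (deg_part f n) w)" for M
    by (subst f') (rule letterwise_sum)
  show ?thesis unfolding eq
  proof (rule additive_sum[OF TS_D(1)[OF \<theta>_TS] finite_degrees[OF f]])
    show "\<theta> n (\<pi> (letterwise B (shifted_family m 0) (deg_part f k))) = \<pi> (letterwise B (shifted_family m n) (deg_part f k))" for k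
      by (rule twist_letterwise_grade) (rule deg_part_grade[OF f])
  qed (use f fin in auto)
qed

text \<open>With \<open>P k\<close> the letterwise action of the family shifted by \<open>k\<close>,
  the degree \<open>k\<close> part of \<open>P 0 f\<close> is multiplied by
  \<open>\<theta>\<^sub>k (P 0 g) = P k g\<close>. Summed over \<open>k\<close>, this is the cut
  formula \<open>letterwise_conv\<close> for \<open>P 0 (f g)\<close>, so \<open>P 0\<close> is
  multiplicative into the twisted algebra.\<close>

lemma twisted_mult_letterwise:
  assumes f: "f \<in> tensor_carrier B" and g: "g \<in> tensor_carrier B"
  shows "twisted_mult A \<theta> (\<pi> (letterwise B (shifted_family m 0) f)) (\<pi> (letterwise B (shifted_family m 0) g)) = \<pi> (letterwise B (shifted_family m 0) (conv f g))"
proof -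
  interpret ring A by (rule ring_S)
  let ?F = "letterwise B (shifted_family m 0) f"
  let ?N = "length ` {w. ?F w \<noteq> 0}"
  let ?H = "\<lambda>k. conv (deg_part ?F k) (letterwise B (shifted_family m (int k)) g)"
  have F: "?F \<in> tensor_carrier B" using f fin by simp
  have H: "?H k \<in> tensor_carrier B" for k using f g fin by simp
  have c: "\<pi> (deg_part ?F k) \<otimes>\<^bsub>A\<^esub> \<theta> (int k) (\<pi> (letterwise B (shifted_family m 0) g)) = \<pi> (?H k)" for k
    using f g fin by (simp add: twist_letterwise mult)
  have out: "\<pi> (deg_part ?F k) = \<zero>\<^bsub>A\<^esub>" if "k \<notin> ?N" for k
  proof -
    have "deg_part ?F k = (\<lambda>w. 0)" using that by (auto simp: deg_part_def fun_eq_iff)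
    then show ?thesis by (simp add: \<pi>_zero_iff ideal_tensor_algebraD(2)[OF ideal_I])
  qed
  have "twisted_mult A \<theta> (\<pi> ?F) (\<pi> (letterwise B (shifted_family m 0) g)) =
      (\<Oplus>\<^bsub>A\<^esub>k\<in>{k. \<pi> (deg_part ?F k) \<noteq> \<zero>\<^bsub>A\<^esub>}. \<pi> (?H k))"
    unfolding twisted_mult_def hcomp[OF F] c ..
  also have "\<dots> = (\<Oplus>\<^bsub>A\<^esub>k\<in>?N. \<pi> (?H k))"
  \<comment> \<open>The twisted product omits the degrees in which the component vanishes in the
    quotient, although it may be nonzero in the tensor algebra; the terms added here are
    zero.\<close>
  proof (rule add.finprod_mono_neutral_cong_left)
    show "\<pi> (?H k) = \<zero>\<^bsub>A\<^esub>" if "k \<in> ?N - {k. \<pi> (deg_part ?F k) \<noteq> \<zero>\<^bsub>A\<^esub>}" for k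
    proof -
      have "\<pi> (deg_part ?F k) = \<zero>\<^bsub>A\<^esub>" using that by blast
      moreover have "\<theta> (int k) (\<pi> (letterwise B (shifted_family m 0) g)) \<in> carrier A" using g fin by (simp add: twist_letterwise)
      ultimately show ?thesis unfolding c[symmetric] by simp
    qed
  qed (use H out finite_degrees[OF F] in auto)
  also have "\<dots> = \<pi> (\<lambda>w. \<Sum>k\<in>?N. ?H k w)"
    by (rule finsum) (use H finite_degrees[OF F] in auto)
  also have "(\<lambda>w. \<Sum>k\<in>?N. ?H k w) = letterwise B (shifted_family m 0) (conv f g)"
  proof
    fix w
    have "(\<Sum>k\<in>?N. ?H k w) = (\<Sum>i\<le>length w. \<Sum>k\<in>?N. if k = i then ?F (take i w) * letterwise B (shifted_family m (int i)) g (drop i w) else 0)"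
      unfolding conv_def
      by (subst sum.swap) (intro sum.cong refl, auto simp: deg_part_def)
    also have "\<dots> = (\<Sum>i\<le>length w. ?F (take i w) * letterwise B (shifted_family m (int i)) g (drop i w))"
    proof (rule sum.cong[OF refl])
      fix i assume i: "i \<in> {..length w}"
      have "?F (take i w) = 0" if "i \<notin> ?N"
      proof (rule ccontr)
        assume "?F (take i w) \<noteq> 0"
        then have "length (take i w) \<in> ?N" by blast
        with i that show False by simp
      qed
      then show "(\<Sum>k\<in>?N. if k = i then ?F (take i w) * letterwise B (shifted_family m (int i)) g (drop i w) else 0) = ?F (take i w) * letterwise B (shifted_family m (int i)) g (drop i w)"
        using finite_degrees[OF F] by (auto simp: sum.delta)
    qed
    finally show "(\<Sum>k\<in>?N. ?H k w) = letterwise B (shifted_family m 0) (conv f g) w"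
      by (simp add: letterwise_conv shifted_family_shift)
  qed
  finally show ?thesis .
qed

lemma letterwise_onto:
  assumes "f \<in> tensor_grade B d"
  shows "\<exists>g\<in>tensor_grade B d. f = letterwise B (shifted_family m n) g"
proof
  show "f = letterwise B (shifted_family m n) (letterwise B (\<lambda>j. inv\<^bsub>GL B\<^esub> (shifted_family m n j)) f)"
    by (rule letterwise_inverse(1)[symmetric]) (use fin shifted_family_GL grade_carrier[OF assms] in auto)
qed (rule letterwise_grade[OF fin assms])

lemma presents_twisted: "presents B (\<lambda>f. \<pi> (letterwise B (shifted_family m 0) f)) (twisted_algebra A \<theta>)"
proof -
  have inv_one: "inv_into (carrier A) (\<theta> 0) \<one>\<^bsub>A\<^esub> = \<one>\<^bsub>A\<^esub>"
  proof (rule inv_into_f_eq)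
    show "inj_on (\<theta> 0) (carrier A)" by (rule graded_linear_autD(2)[OF TS_D(1)[OF \<theta>_TS]])
  qed (use \<theta>_0 one in auto)
  have simps: "carrier (twisted_algebra A \<theta>) = carrier A" "add (twisted_algebra A \<theta>) = add A"
    "monoid.mult (twisted_algebra A \<theta>) = twisted_mult A \<theta>" "\<one>\<^bsub>twisted_algebra A \<theta>\<^esub> = \<one>\<^bsub>A\<^esub>"
    "\<zero>\<^bsub>twisted_algebra A \<theta>\<^esub> = \<zero>\<^bsub>A\<^esub>" "grade (twisted_algebra A \<theta>) = grade A"
    "module.smult (twisted_algebra A \<theta>) = module.smult A"
    by (simp_all add: twisted_algebra_def inv_one)
  have onto: "\<exists>g\<in>tensor_carrier B. f = letterwise B (shifted_family m 0) g" if "f \<in> tensor_carrier B" for f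
  proof
    show "f = letterwise B (shifted_family m 0) (letterwise B (\<lambda>j. inv\<^bsub>GL B\<^esub> (shifted_family m 0 j)) f)"
      by (rule letterwise_inverse(1)[symmetric]) (use fin shifted_family_GL that in auto)
  qed (use that fin in simp)
  show ?thesis unfolding presents_def simps
  proof (intro conjI ballI allI impI)
    show "carrier A = (\<lambda>f. \<pi> (letterwise B (shifted_family m 0) f)) ` tensor_carrier B"
      unfolding carrier using onto fin by (auto simp: image_iff; metis)
    show "grade A n = (\<lambda>f. \<pi> (letterwise B (shifted_family m 0) f)) ` tensor_grade B n" for n
      unfolding grade using letterwise_onto[of _ n 0] letterwise_grade[OF fin, of _ n "shifted_family m 0"] by (auto simp: image_iff; metis)
    fix f :: "'x list \<Rightarrow> 'k" assume f: "f \<in> tensor_carrier B"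
    assume "\<pi> (letterwise B (shifted_family m 0) f) = \<zero>\<^bsub>A\<^esub>"
    then show "\<pi> (letterwise B (shifted_family m 0) (deg_part f n)) = \<zero>\<^bsub>A\<^esub>" for n
      unfolding letterwise_deg_part using f fin by (intro kernel_deg_part) simp_all
  qed (use fin in \<open>simp_all add: twisted_mult_letterwise letterwise_add letterwise_scale add smult one zero\<close>)
qed

text \<open>\<open>\<theta> n\<close> is injective and sends the class of the unshifted transform of
  \<open>g\<close> to that of the transform shifted by \<open>n\<close>, so both classes vanish
  together.\<close>

lemma relations_invariant:
  assumes g: "g \<in> tensor_grade B 2"
  shows "letterwise B (shifted_family m n) g \<in> R \<longleftrightarrow> letterwise B (shifted_family m 0) g \<in> R"
proof -
  note L = graded_linear_autD[OF TS_D(1)[OF \<theta>_TS, of n]]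
  have P: "letterwise B (shifted_family m k) g \<in> tensor_grade B 2" for k by (rule letterwise_grade[OF fin g])
  have "letterwise B (shifted_family m n) g \<in> R \<longleftrightarrow> \<theta> n (\<pi> (letterwise B (shifted_family m 0) g)) = \<theta> n \<zero>\<^bsub>A\<^esub>"
    by (simp add: twist_letterwise grade_carrier[OF g] \<pi>_zero_iff grade_carrier[OF P] I_grade_2[OF P] aut_zero[OF TS_D(1)[OF \<theta>_TS]])
  also have "\<dots> \<longleftrightarrow> \<pi> (letterwise B (shifted_family m 0) g) = \<zero>\<^bsub>A\<^esub>"
    by (rule inj_on_eq_iff[OF L(2)]) (use grade_carrier[OF P] in \<open>auto simp: zero\<close>)
  also have "\<dots> \<longleftrightarrow> letterwise B (shifted_family m 0) g \<in> R"
    by (simp add: \<pi>_zero_iff grade_carrier[OF P] I_grade_2[OF P])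
  finally show ?thesis .
qed

end

context quadratic_twist
begin

definition "twisted_relations = {g \<in> tensor_grade B 2. letterwise B (shifted_family m 0) g \<in> R}"

lemma twisted_relations_grade: "twisted_relations \<subseteq> tensor_grade B 2"
  by (auto simp: twisted_relations_def)

text \<open>One inclusion transports generators by the matrices, the other by their inverses.
  \<open>relations_invariant\<close> supplies the condition for every shift that
  \<open>letterwise_Idl\<close> asks for.\<close>

lemma twisted_kernel:
  assumes f: "f \<in> tensor_carrier B"
  shows "letterwise B (shifted_family m 0) f \<in> I \<longleftrightarrow> f \<in> Idl\<^bsub>tensor_algebra B\<^esub> twisted_relations"
proof
  assume "f \<in> Idl\<^bsub>tensor_algebra B\<^esub> twisted_relations"
  then show "letterwise B (shifted_family m 0) f \<in> I" unfolding I_def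
    by (rule letterwise_Idl[OF fin twisted_relations_grade R(1), rotated])
      (simp add: shifted_family_shift relations_invariant twisted_relations_def)
next
  let ?P = "\<lambda>i. letterwise B (\<lambda>j. inv\<^bsub>GL B\<^esub> (shifted_family m i j))"
  assume "letterwise B (shifted_family m 0) f \<in> I"
  then have "?P 0 (letterwise B (shifted_family m 0) f) \<in> Idl\<^bsub>tensor_algebra B\<^esub> twisted_relations"
    unfolding I_def
  proof (rule letterwise_Idl[OF fin R(1) twisted_relations_grade, rotated])
    fix i g assume g: "g \<in> R"
    then have g2: "g \<in> tensor_grade B 2" using R(1) by blast
    have P: "?P (int i) g \<in> tensor_grade B 2" by (rule letterwise_grade[OF fin g2])
    have "letterwise B (shifted_family m (int i)) (?P (int i) g) = g"
      by (rule letterwise_inverse(1)[OF fin shifted_family_GL grade_carrier[OF g2]])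
    then have "letterwise B (shifted_family m 0) (?P (int i) g) \<in> R" using relations_invariant[OF P, of "int i"] g by simp
    then have "?P (int i) g \<in> twisted_relations" using P by (simp add: twisted_relations_def)
    moreover have "(\<lambda>j. inv\<^bsub>GL B\<^esub> (shifted_family m 0 (i + j))) = (\<lambda>j. inv\<^bsub>GL B\<^esub> (shifted_family m (int i) j))"
      by (simp add: shifted_family_def)
    ultimately show "letterwise B (\<lambda>j. inv\<^bsub>GL B\<^esub> (shifted_family m 0 (i + j))) g \<in> twisted_relations" by simp
  qed
  then show "f \<in> Idl\<^bsub>tensor_algebra B\<^esub> twisted_relations"
    using letterwise_inverse(2)[OF fin shifted_family_GL f] by simp
qed

end

context quadratic
begin

text \<open>The matrix is read off in degree 1; surjectivity of \<open>\<theta> n\<close> yields its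
  left inverse, injectivity the right one. From algebraicity only \<open>m 2 = (m 1)^2\<close> is
  kept, which already makes \<open>\<sigma>\<close> commute with \<open>m 1\<close> on
  \<open>E\<close>.\<close>

lemma TS0_matrices:
  assumes \<theta>: "\<theta> \<in> TS0 A"
  shows "\<exists>m. quadratic_twist B R \<theta> m \<and> (\<theta> \<in> TS_alg A \<longrightarrow> m 2 = mat_mult B (m 1) (m 1))"
proof -
  have TS: "\<theta> \<in> TS A" using \<theta> by (simp add: TS0_def)
  note aut = TS_D(1)[OF TS]
  note L = graded_linear_autD[OF aut]
  have s: "(single x :: 'x list \<Rightarrow> 'k) \<in> tensor_carrier B" if "x \<in> B" for x using single_grade[OF that] by (rule grade_carrier)
  have "\<exists>v. v \<in> tensor_grade B 1 \<and> \<theta> n (\<pi> (single x)) = \<pi> v" if x: "x \<in> B" for n x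
  proof -
    have "\<pi> (single x) \<in> grade A 1" unfolding grade using single_grade[OF x] by (rule imageI)
    then have "\<theta> n (\<pi> (single x)) \<in> grade A 1" using L(6)[of n 1] by blast
    then show ?thesis unfolding grade by blast
  qed
  then have "\<forall>n x. \<exists>v. x \<in> B \<longrightarrow> v \<in> tensor_grade B 1 \<and> \<theta> n (\<pi> (single x)) = \<pi> v" by blast
  then obtain v where "\<forall>n x. x \<in> B \<longrightarrow> v n x \<in> tensor_grade B 1 \<and> \<theta> n (\<pi> (single x)) = \<pi> (v n x)"
    by metis
  then have v: "\<And>n x. x \<in> B \<Longrightarrow> v n x \<in> tensor_grade B 1" "\<And>n x. x \<in> B \<Longrightarrow> \<theta> n (\<pi> (single x)) = \<pi> (v n x)"
    by blast+
  define m where "m n x y = (if x \<in> B then v n x [y] else 0)" for n x y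
  have row: "row (m n) x = v n x" if "x \<in> B" for n x
  proof -
    have "row (m n) x = row (\<lambda>a b. v n x [b]) x" using that by (auto simp: row_def m_def fun_eq_iff)
    then show ?thesis by (simp add: grade_1_row[OF v(1)[OF that]])
  qed
  have supp: "x \<in> B \<and> y \<in> B" if "m n x y \<noteq> 0" for n x y
    using that v(1)[of x n] by (auto simp: m_def tensor_grade_def tensor_carrier_def split: if_splits)
  have rg: "row (m n) x \<in> tensor_grade B 1" if "x \<in> B" for n x using v(1)[OF that] by (simp add: row[OF that])
  have sc: "\<theta> n (\<pi> (\<lambda>w. c * f w)) = \<pi> (\<lambda>w. c * g w)"
    if "\<theta> n (\<pi> f) = \<pi> g" "f \<in> tensor_carrier B" "g \<in> tensor_carrier B" for n c f g
    using L(5)[of "\<pi> f" n c] that by (simp add: smult)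
  have lin: "\<theta> n (\<pi> f) = \<pi> (\<lambda>w. \<Sum>x\<in>B. f [x] * row (m n) x w)" if f: "f \<in> tensor_grade B 1" for n f
  proof (subst grade_1_sum[OF fin f], rule additive_sum[OF aut fin])
    fix x assume x: "x \<in> B"
    show "\<theta> n (\<pi> (\<lambda>w. f [x] * single x w)) = \<pi> (\<lambda>w. f [x] * row (m n) x w)"
      by (rule sc) (use x s v(2) grade_carrier[OF rg] row in auto)
  qed (use s grade_carrier[OF rg] in simp_all)
  have GL: "m n \<in> carrier (GL B)" for n
  proof (rule GLI[OF fin])
    show "\<And>x y. m n x y \<noteq> 0 \<Longrightarrow> x \<in> B \<and> y \<in> B" by (rule supp)
    have "\<exists>l. l \<in> tensor_grade B 1 \<and> \<theta> n (\<pi> l) = \<pi> (single x)" if x: "x \<in> B" for x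
    proof -
      have "\<pi> (single x) \<in> grade A 1" unfolding grade using single_grade[OF x] by (rule imageI)
      then have "\<pi> (single x) \<in> \<theta> n ` grade A 1" using L(6)[of n 1] by blast
      then show ?thesis unfolding grade by auto
    qed
    then obtain l where l: "\<And>x. x \<in> B \<Longrightarrow> l x \<in> tensor_grade B 1" "\<And>x. x \<in> B \<Longrightarrow> \<theta> n (\<pi> (l x)) = \<pi> (single x)" by metis
    have sg: "(\<lambda>w. \<Sum>y\<in>B. c y * h y w) \<in> tensor_grade B 1"
      if h: "\<And>y. y \<in> B \<Longrightarrow> h y \<in> tensor_grade B 1" for c and h :: "'x \<Rightarrow> 'x list \<Rightarrow> 'k"
    proof -
      have "(\<lambda>w. \<Sum>y\<in>B. c y * h y w) \<in> tensor_carrier B"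
        using h grade_carrier by (intro tensor_carrier_sum tensor_carrier_scale) blast
      moreover have "length w = 1" if nz: "(\<Sum>y\<in>B. c y * h y w) \<noteq> 0" for w
      proof -
        obtain y where "y \<in> B" "c y * h y w \<noteq> 0" using nz by (meson sum.neutral)
        then show ?thesis using h[of y] by (simp add: tensor_grade_def)
      qed
      ultimately show ?thesis by (simp add: tensor_grade_def)
    qed
    have "(\<Sum>y\<in>B. l x [y] * m n y z) = mat_one B x z" if x: "x \<in> B" for x z
    proof -
      have "\<pi> (single x) = \<pi> (\<lambda>w. \<Sum>y\<in>B. l x [y] * row (m n) y w)" using lin[OF l(1)[OF x]] l(2)[OF x] by simp
      moreover have "(\<lambda>w. \<Sum>y\<in>B. l x [y] * row (m n) y w) \<in> tensor_grade B 1" by (rule sg) (rule rg)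
      ultimately have "single x = (\<lambda>w. \<Sum>y\<in>B. l x [y] * row (m n) y w)"
        using single_grade[OF x] by (intro \<pi>_inj_grade_1)
      from fun_cong[OF this, of "[z]"] show ?thesis using x by (auto simp: single_def row_def mat_one_def)
    qed
    then show "\<exists>l. \<forall>x\<in>B. \<forall>z\<in>B. (\<Sum>y\<in>B. l x y * m n y z) = mat_one B x z"
      by (intro exI[of _ "\<lambda>x y. l x [y]"]) simp
    \<comment> \<open>The combination of the \<open>l y\<close> with coefficients from row
      \<open>x\<close> and the letter \<open>x\<close> have the same image under
      \<open>\<theta> n\<close>, so they are equal.\<close>
    have "(\<Sum>y\<in>B. m n x y * l y [z]) = mat_one B x z" if x: "x \<in> B" for x z
    proof -
      let ?q = "\<lambda>w. \<Sum>y\<in>B. m n x y * l y w"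
      have q: "?q \<in> tensor_grade B 1" by (rule sg[OF l(1)])
      have "\<theta> n (\<pi> ?q) = \<pi> (\<lambda>w. \<Sum>y\<in>B. m n x y * single y w)"
      proof (rule additive_sum[OF aut fin])
        fix y assume y: "y \<in> B"
        show "\<theta> n (\<pi> (\<lambda>w. m n x y * l y w)) = \<pi> (\<lambda>w. m n x y * single y w)"
          by (rule sc) (use y s l(2) grade_carrier[OF l(1)] in auto)
      qed (use s grade_carrier[OF l(1)] in simp_all)
      also have "(\<lambda>w. \<Sum>y\<in>B. m n x y * single y w) = row (m n) x"
        by (subst grade_1_sum[OF fin rg[OF x]]) (simp add: row_def)
      also have "\<pi> (row (m n) x) = \<theta> n (\<pi> (single x))" using v(2)[OF x] by (simp add: row[OF x])
      finally have "\<pi> ?q = \<pi> (single x)"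
        by (rule inj_onD[OF L(2)]) (use grade_carrier[OF q] s[OF x] in simp_all)
      then have "?q = single x" by (rule \<pi>_inj_grade_1[OF q single_grade[OF x]])
      from fun_cong[OF this, of "[z]"] show ?thesis using x by (auto simp: single_def mat_one_def)
    qed
    then show "\<exists>r. \<forall>x\<in>B. \<forall>z\<in>B. (\<Sum>y\<in>B. m n x y * r y z) = mat_one B x z"
      by (intro exI[of _ "\<lambda>y z. l y [z]"]) simp
  qed
  have tw: "quadratic_twist B R \<theta> m"
  proof (intro quadratic_twist.intro quadratic_twist_axioms.intro)
    show "quadratic B R" by (rule quadratic_axioms)
    show "\<theta> \<in> TS0 A" by (rule \<theta>)
    show "m n \<in> carrier (GL B)" for n by (rule GL)
    show "\<theta> n (quadratic.\<pi> B R (single x)) = quadratic.\<pi> B R (row (m n) x)" if "x \<in> B" for n x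
      using v(2)[OF that] by (simp add: row[OF that])
  qed
  have mat_mult_row: "row (mat_mult B (m 1) (m 1)) x \<in> tensor_grade B 1" for x
  proof (rule row_grade[OF fin], rule ccontr)
    fix x y assume nz: "mat_mult B (m 1) (m 1) x y \<noteq> 0" and "y \<notin> B"
    then have "m 1 z y = 0" for z using supp by blast
    then show False using nz by (simp add: mat_mult_def)
  qed
  have "m 2 x z = mat_mult B (m 1) (m 1) x z" if alg: "\<theta> \<in> TS_alg A" for x z
  proof (cases "x \<in> B")
    case True
    have "\<theta> 2 = compose (carrier A) (\<theta> 1) (\<theta> 1)"
    proof -
      have "\<forall>a b. \<theta> (a + b) = compose (carrier A) (\<theta> a) (\<theta> b)" using alg unfolding TS_alg_def by blast
      from this[rule_format, of 1 1] show ?thesis by (simp only: one_add_one)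
    qed
    then have "\<theta> 2 (\<pi> (single x)) = \<theta> 1 (\<theta> 1 (\<pi> (single x)))"
      using \<pi>_carrier[OF s[OF True]] by (simp only: compose_eq)
    moreover have "\<theta> n (\<pi> (single x)) = \<pi> (row (m n) x)" for n unfolding row[OF True] by (rule v(2)[OF True])
    ultimately have "\<pi> (row (m 2) x) = \<theta> 1 (\<pi> (row (m 1) x))" by (simp only:)
    also have "\<dots> = \<pi> (\<lambda>w. \<Sum>y\<in>B. row (m 1) x [y] * row (m 1) y w)" by (rule lin[OF rg[OF True]])
    also have "(\<lambda>w. \<Sum>y\<in>B. row (m 1) x [y] * row (m 1) y w) = row (mat_mult B (m 1) (m 1)) x"
      by (auto simp: row_def mat_mult_def fun_eq_iff)
    finally have "row (m 2) x = row (mat_mult B (m 1) (m 1)) x"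
      by (rule \<pi>_inj_grade_1[OF rg[OF True] mat_mult_row])
    then show ?thesis by (rule row_eqD)
  next
    case False
    then have "m 2 x z = 0" "m 1 x y = 0" for y using supp by blast+
    then show ?thesis by (simp add: mat_mult_def)
  qed
  then have "\<theta> \<in> TS_alg A \<longrightarrow> m 2 = mat_mult B (m 1) (m 1)" by blast
  with tw show ?thesis by blast
qed

lemma aut_hcomp:
  assumes \<phi>: "\<phi> \<in> graded_linear_aut A" and a: "a \<in> carrier A"
  shows "hcomp A (\<phi> a) = (\<lambda>n. \<phi> (hcomp A a n))"
proof -
  obtain f where f: "f \<in> tensor_carrier B" "a = \<pi> f" using a by (auto simp: carrier)
  note L = graded_linear_autD[OF \<phi>]
  have "\<exists>g. g \<in> tensor_grade B n \<and> \<phi> (\<pi> (deg_part f n)) = \<pi> g" for n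
  proof -
    have "\<pi> (deg_part f n) \<in> grade A n" unfolding grade using deg_part_grade[OF f(1)] by (rule imageI)
    then have "\<phi> (\<pi> (deg_part f n)) \<in> grade A n" using L(6)[of n] by blast
    then show ?thesis unfolding grade by blast
  qed
  then obtain g where g: "\<And>n. g n \<in> tensor_grade B n" "\<And>n. \<phi> (\<pi> (deg_part f n)) = \<pi> (g n)" by metis
  let ?N = "length ` {w. f w \<noteq> 0}"
  let ?s = "\<lambda>w. \<Sum>n\<in>?N. g n w"
  have s: "?s \<in> tensor_carrier B" by (rule tensor_carrier_sum) (rule grade_carrier[OF g(1)])
  have "\<phi> (\<pi> (\<lambda>w. \<Sum>n\<in>?N. deg_part f n w)) = \<pi> ?s"
    by (rule additive_sum[OF \<phi> finite_degrees[OF f(1)]]) (use f g grade_carrier[OF g(1)] in auto)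
  then have \<phi>a: "\<phi> a = \<pi> ?s" unfolding f(2) by (subst (asm) sum_deg_part) (use finite_degrees[OF f(1)] in auto)
  have "\<pi> (deg_part ?s n) = \<phi> (\<pi> (deg_part f n))" for n
  proof -
    have "deg_part ?s n = (\<lambda>w. \<Sum>k\<in>?N. deg_part (g k) n w)" by (auto simp: deg_part_def)
    also have "\<dots> = (\<lambda>w. \<Sum>k\<in>?N. if k = n then g n w else 0)"
      by (intro ext sum.cong) (auto simp: deg_part_of_grade[OF g(1)])
    also have "\<dots> = (if n \<in> ?N then g n else (\<lambda>w. 0))" using finite_degrees[OF f(1)] by (auto simp: sum.delta')
    finally have ds: "deg_part ?s n = (if n \<in> ?N then g n else (\<lambda>w. 0))" .
    show ?thesis
    proof (cases "n \<in> ?N")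
      case False
      then have "deg_part f n = (\<lambda>w. 0)" by (auto simp: deg_part_def fun_eq_iff)
      then show ?thesis using ds False aut_zero[OF \<phi>] by (simp add: zero)
    qed (use ds g(2) in simp)
  qed
  then show ?thesis unfolding \<phi>a hcomp[OF s] by (simp add: f(2) hcomp[OF f(1)])
qed

lemma aut_finsum:
  assumes \<phi>: "\<phi> \<in> graded_linear_aut A" and "finite N" "\<And>i. i \<in> N \<Longrightarrow> c i \<in> carrier A"
  shows "\<phi> (\<Oplus>\<^bsub>A\<^esub>i\<in>N. c i) = (\<Oplus>\<^bsub>A\<^esub>i\<in>N. \<phi> (c i))"
proof -
  interpret ring A by (rule ring_S)
  note L = graded_linear_autD[OF \<phi>]
  show ?thesis using assms(2,3)
  proof (induction N)
    case (insert i N)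
    have "\<phi> (\<Oplus>\<^bsub>A\<^esub>j\<in>insert i N. c j) = \<phi> (c i \<oplus>\<^bsub>A\<^esub> (\<Oplus>\<^bsub>A\<^esub>j\<in>N. c j))"
      using insert by (subst finsum_insert) auto
    also have "\<dots> = \<phi> (c i) \<oplus>\<^bsub>A\<^esub> \<phi> (\<Oplus>\<^bsub>A\<^esub>j\<in>N. c j)" using insert by (intro L(4) finsum_closed) auto
    also have "\<dots> = \<phi> (c i) \<oplus>\<^bsub>A\<^esub> (\<Oplus>\<^bsub>A\<^esub>j\<in>N. \<phi> (c j))" using insert by simp
    also have "\<dots> = (\<Oplus>\<^bsub>A\<^esub>j\<in>insert i N. \<phi> (c j))" using insert L(1) by (subst finsum_insert) auto
    finally show ?case .
  qed (simp add: aut_zero[OF \<phi>])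
qed

text \<open>A twisting system is normalised by \<open>\<theta>'\<^sub>n = \<theta>\<^sub>n \<theta>\<^sub>0\<^sup>-\<^sup>1\<close>, and \<open>\<theta>\<^sub>0\<close> is an
  isomorphism between the twisted algebras.\<close>

lemma TS_normalise:
  assumes \<theta>: "\<theta> \<in> TS A"
  shows "\<exists>\<theta>'\<in>TS0 A. \<exists>\<eta>. \<forall>h. presents B h (twisted_algebra A \<theta>') \<longrightarrow>
    presents B (\<lambda>f. \<eta> (h f)) (twisted_algebra A \<theta>) \<and>
    (\<forall>f\<in>tensor_carrier B. \<eta> (h f) = \<zero>\<^bsub>twisted_algebra A \<theta>\<^esub> \<longleftrightarrow> h f = \<zero>\<^bsub>twisted_algebra A \<theta>'\<^esub>)"
proof -
  interpret Ar: ring A by (rule ring_S)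
  interpret Am: module "ring_of_type_algebra :: 'k ring" A by (rule module_S)
  note L = graded_linear_autD[OF TS_D(1)[OF \<theta>]]
  define \<eta> where "\<eta> = restrict (inv_into (carrier A) (\<theta> 0)) (carrier A)"
  have smc: "c \<odot>\<^bsub>A\<^esub> a \<in> carrier A" if "a \<in> carrier A" for c a
    using Am.smult_closed[of c a] that by (simp add: ring_of_type_algebra_def)
  have \<eta>: "\<eta> \<in> graded_linear_aut A" unfolding \<eta>_def
    by (rule graded_linear_aut_inverse[OF TS_D(1)[OF \<theta>] grade_sub Ar.add.m_closed smc])
  note H = graded_linear_autD[OF \<eta>]
  have \<eta>\<theta>: "\<theta> 0 (\<eta> a) = a" "\<eta> (\<theta> 0 a) = a" if "a \<in> carrier A" for a
    using that L(2,3)[of 0] L(1)[OF that, of 0] by (simp_all add: \<eta>_def f_inv_into_f)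
  define \<theta>' where "\<theta>' n = compose (carrier A) (\<theta> n) \<eta>" for n
  have \<theta>': "\<theta>' n a = \<theta> n (\<eta> a)" if "a \<in> carrier A" for n a using that by (simp add: \<theta>'_def compose_eq)
  have aut': "\<theta>' n \<in> graded_linear_aut A" for n
    unfolding graded_linear_aut_def
  proof (intro CollectI conjI ballI allI)
    have "\<theta> n \<in> Bij (carrier A)" "\<eta> \<in> Bij (carrier A)" using TS_D(1)[OF \<theta>] \<eta> by (auto simp: graded_linear_aut_def)
    then show "\<theta>' n \<in> Bij (carrier A)" unfolding \<theta>'_def by (rule compose_Bij)
    show "\<theta>' n (a \<oplus>\<^bsub>A\<^esub> b) = \<theta>' n a \<oplus>\<^bsub>A\<^esub> \<theta>' n b" if "a \<in> carrier A" "b \<in> carrier A" for a b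
      using that by (simp add: \<theta>' H(4) H(1) L(4))
    show "\<theta>' n (c \<odot>\<^bsub>A\<^esub> a) = c \<odot>\<^bsub>A\<^esub> \<theta>' n a" if "a \<in> carrier A" for c a
      using that by (simp add: \<theta>' H(5) H(1) L(5) smc)
    show "\<theta>' n ` grade A k = grade A k" for k
    proof -
      have "\<theta>' n ` grade A k = \<theta> n ` \<eta> ` grade A k"
        unfolding image_image using grade_sub[of k] \<theta>' by (intro image_cong) auto
      then show ?thesis by (simp add: H(6) L(6))
    qed
  qed
  \<comment> \<open>The twisting identity at \<open>n = 0\<close>, applied to
    \<open>\<eta> x\<close> and \<open>\<eta> b\<close>, shows that \<open>\<theta>\<^sub>0\<close>
    acts on a twisted product through its left factor alone; \<open>\<eta>\<close> undoes
    this.\<close>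
  have \<theta>0: "\<eta> (x \<otimes>\<^bsub>A\<^esub> \<theta>' (int k) b) = \<eta> x \<otimes>\<^bsub>A\<^esub> \<theta>' (int k) b" if x: "x \<in> grade A k" and b: "b \<in> carrier A" for x b k
  proof -
    have x': "\<eta> x \<in> grade A k" using x H(6)[of k] by blast
    have xc: "x \<in> carrier A" "\<eta> x \<in> carrier A" using x x' grade_sub by blast+
    have "\<theta> 0 (\<eta> x \<otimes>\<^bsub>A\<^esub> \<theta> (int k) (\<eta> b)) = \<theta> 0 (\<eta> x) \<otimes>\<^bsub>A\<^esub> \<theta> (0 + int k) (\<eta> b)"
      by (rule TS_mult[OF \<theta> x' H(1)[OF b]])
    then have "\<theta> 0 (\<eta> x \<otimes>\<^bsub>A\<^esub> \<theta>' (int k) b) = x \<otimes>\<^bsub>A\<^esub> \<theta>' (int k) b" using xc b by (simp add: \<theta>' \<eta>\<theta>)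
    moreover have "\<eta> x \<otimes>\<^bsub>A\<^esub> \<theta>' (int k) b \<in> carrier A" using xc b H(1) L(1) by (simp add: \<theta>')
    ultimately show ?thesis using \<eta>\<theta>(2) by metis
  qed
  have "\<theta>' n (a \<otimes>\<^bsub>A\<^esub> \<theta>' (int k) b) = \<theta>' n a \<otimes>\<^bsub>A\<^esub> \<theta>' (n + int k) b"
    if a: "a \<in> grade A k" and b: "b \<in> grade A l" for n k l a b
  proof -
    have c: "a \<in> carrier A" "b \<in> carrier A" using a b grade_sub by blast+
    have a': "\<eta> a \<in> grade A k" using a H(6)[of k] by blast
    have "\<theta>' n (a \<otimes>\<^bsub>A\<^esub> \<theta>' (int k) b) = \<theta> n (\<eta> a \<otimes>\<^bsub>A\<^esub> \<theta> (int k) (\<eta> b))"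
      using c H(1) L(1) \<theta>0[OF a c(2)] by (simp add: \<theta>')
    also have "\<dots> = \<theta> n (\<eta> a) \<otimes>\<^bsub>A\<^esub> \<theta> (n + int k) (\<eta> b)" by (rule TS_mult[OF \<theta> a' H(1)[OF c(2)]])
    finally show ?thesis using c by (simp add: \<theta>')
  qed
  then have "\<theta>' \<in> TS A" using aut' by (auto simp: TS_def)
  moreover have "\<theta>' 0 = (\<lambda>a\<in>carrier A. a)" using \<eta>\<theta> by (auto simp: \<theta>'_def compose_def restrict_def fun_eq_iff)
  ultimately have "\<theta>' \<in> TS0 A" by (simp add: TS0_def)
  \<comment> \<open>The isomorphism appears as a transport of presentations with unchanged kernel,
    so that it can be composed with \<open>presents_twisted\<close> for the normalised
    system.\<close>
  moreover have "presents B (\<lambda>f. \<eta> (h f)) (twisted_algebra A \<theta>) \<and>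
    (\<forall>f\<in>tensor_carrier B. \<eta> (h f) = \<zero>\<^bsub>twisted_algebra A \<theta>\<^esub> \<longleftrightarrow> h f = \<zero>\<^bsub>twisted_algebra A \<theta>'\<^esub>)"
    if h: "presents B h (twisted_algebra A \<theta>')" for h
  proof -
    interpret P: presentation B h "twisted_algebra A \<theta>'" using h by unfold_locales
    have simps: "carrier (twisted_algebra A t) = carrier A" "add (twisted_algebra A t) = add A"
      "monoid.mult (twisted_algebra A t) = twisted_mult A t" "\<one>\<^bsub>twisted_algebra A t\<^esub> = inv_into (carrier A) (t 0) \<one>\<^bsub>A\<^esub>"
      "\<zero>\<^bsub>twisted_algebra A t\<^esub> = \<zero>\<^bsub>A\<^esub>" "grade (twisted_algebra A t) = grade A"
      "module.smult (twisted_algebra A t) = module.smult A" for t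
      by (simp_all add: twisted_algebra_def)
    have hc: "h f \<in> carrier A" if "f \<in> tensor_carrier B" for f using that P.carrier by (simp add: simps)
    have tm: "twisted_mult A \<theta> (\<eta> a) (\<eta> b) = \<eta> (twisted_mult A \<theta>' a b)" if a: "a \<in> carrier A" and b: "b \<in> carrier A" for a b
    proof -
      have hcg: "hcomp A a k \<in> grade A k" for k
        using a deg_part_grade by (auto simp: carrier hcomp grade)
      have hcc: "hcomp A a k \<in> carrier A" for k using hcg grade_sub by blast
      have z: "\<eta> (hcomp A a k) = \<zero>\<^bsub>A\<^esub> \<longleftrightarrow> hcomp A a k = \<zero>\<^bsub>A\<^esub>" for k
        using inj_on_eq_iff[OF H(2), of "hcomp A a k" "\<zero>\<^bsub>A\<^esub>"] hcc aut_zero[OF \<eta>] by simp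
      have fin: "finite {k. hcomp A a k \<noteq> \<zero>\<^bsub>A\<^esub>}"
      proof -
        obtain f where f: "f \<in> tensor_carrier B" "a = \<pi> f" using a by (auto simp: carrier)
        have "finite {k. \<pi> (deg_part f k) \<noteq> \<zero>\<^bsub>A\<^esub>}"
          using decomposition_deg_part[OF f(1)] unfolding is_decomposition_def by blast
        then show ?thesis unfolding f(2) hcomp[OF f(1)] .
      qed
      have "twisted_mult A \<theta> (\<eta> a) (\<eta> b) =
        (\<Oplus>\<^bsub>A\<^esub>k\<in>{k. hcomp A a k \<noteq> \<zero>\<^bsub>A\<^esub>}. \<eta> (hcomp A a k \<otimes>\<^bsub>A\<^esub> \<theta>' (int k) b))"
        unfolding twisted_mult_def aut_hcomp[OF \<eta> a] z \<theta>0[OF hcg b] unfolding \<theta>'[OF b] ..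
      also have "\<dots> = \<eta> (twisted_mult A \<theta>' a b)"
        unfolding twisted_mult_def by (rule aut_finsum[OF \<eta> fin, symmetric]) (use b hcc H(1) L(1) in \<open>simp add: \<theta>'\<close>)
      finally show ?thesis .
    qed
    have one': "inv_into (carrier A) (\<theta>' 0) \<one>\<^bsub>A\<^esub> = \<one>\<^bsub>A\<^esub>"
      by (rule inv_into_f_eq) (use graded_linear_autD(2)[OF aut'] \<eta>\<theta> in \<open>auto simp: \<theta>'\<close>)
    have kernel: "\<eta> (h f) = \<zero>\<^bsub>A\<^esub> \<longleftrightarrow> h f = \<zero>\<^bsub>A\<^esub>" if "f \<in> tensor_carrier B" for f
      using inj_on_eq_iff[OF H(2), of "h f" "\<zero>\<^bsub>A\<^esub>"] hc[OF that] aut_zero[OF \<eta>] by simp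
    have "presents B (\<lambda>f. \<eta> (h f)) (twisted_algebra A \<theta>)"
      unfolding presents_def simps
    proof (intro conjI ballI allI impI)
      show "carrier A = (\<lambda>f. \<eta> (h f)) ` tensor_carrier B"
        using P.carrier H(3) by (simp add: simps image_image[symmetric])
      show "grade A n = (\<lambda>f. \<eta> (h f)) ` tensor_grade B n" for n
        using P.grade[of n] H(6)[of n] by (simp add: simps image_image[symmetric])
      show "\<eta> (h unit_word) = inv_into (carrier A) (\<theta> 0) \<one>\<^bsub>A\<^esub>"
        using P.one hc[OF tensor_carrier_unit] by (simp add: simps one' \<eta>_def)
      show "\<eta> (h (\<lambda>w. 0)) = \<zero>\<^bsub>A\<^esub>" using P.zero aut_zero[OF \<eta>] by (simp add: simps)
      fix f :: "'x list \<Rightarrow> 'k" assume f: "f \<in> tensor_carrier B"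
      show "\<eta> (h (\<lambda>w. c * f w)) = c \<odot>\<^bsub>A\<^esub> \<eta> (h f)" for c
      proof -
        have "h (\<lambda>w. c * f w) = c \<odot>\<^bsub>A\<^esub> h f" using P.smult[OF f, of c] by (simp add: simps)
        then show ?thesis by (simp only: H(5)[OF hc[OF f]])
      qed
      show "\<eta> (h (deg_part f n)) = \<zero>\<^bsub>A\<^esub>" if "\<eta> (h f) = \<zero>\<^bsub>A\<^esub>" for n
        using that P.kernel_deg_part[OF f] kernel f aut_zero[OF \<eta>] by (simp add: simps)
      fix g :: "'x list \<Rightarrow> 'k" assume g: "g \<in> tensor_carrier B"
      show "\<eta> (h (\<lambda>w. f w + g w)) = \<eta> (h f) \<oplus>\<^bsub>A\<^esub> \<eta> (h g)"
        using P.add[OF f g] H(4)[OF hc[OF f] hc[OF g]] by (simp add: simps)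
      show "\<eta> (h (conv f g)) = twisted_mult A \<theta> (\<eta> (h f)) (\<eta> (h g))"
        using P.mult[OF f g] tm[OF hc[OF f] hc[OF g]] by (simp add: simps)
    qed
    then show ?thesis using kernel by (simp add: simps)
  qed
  ultimately show ?thesis by blast
qed

end

lemma graded_iso_rel_quadratic:
  fixes S :: "('k::field, ('x list \<Rightarrow> 'k) set) graded_alg"
  assumes "finite B" "R' \<subseteq> tensor_grade B 2" "presents B h S"
    and ker: "\<And>f. f \<in> tensor_carrier B \<Longrightarrow> h f = \<zero>\<^bsub>S\<^esub> \<longleftrightarrow> f \<in> Idl\<^bsub>tensor_algebra B\<^esub> R'"
  shows "(S, quadratic_algebra B R') \<in> graded_iso_rel"
proof -
  note Q = presents_quadratic[OF assms(1,2)]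
  have R': "R' \<subseteq> tensor_carrier B" using assms(2) grade_carrier by blast
  have "graded_iso S (quadratic_algebra B R') \<noteq> {}"
    by (rule presents_iso[OF assms(3) Q])
      (use ker coset_eq_zero_iff[OF ideal_Idl[OF R']] in \<open>simp add: quadratic_algebra_def quotient_algebra_def FactRing_def\<close>)
  then show ?thesis
    using presentation.graded_algebra_S[OF presentation.intro[OF assms(3)]]
      presentation.graded_algebra_S[OF presentation.intro[OF Q]] by (simp add: graded_iso_rel_def)
qed

context quadratic
begin

text \<open>The degree 1 data of normalised twisting systems, as \<open>twist_TS0\<close> and
  \<open>twist_exists\<close> show. The last clause compares every shift with the shift 0
  only.\<close>

definition twist_family :: "(int \<Rightarrow> 'x \<Rightarrow> 'x \<Rightarrow> 'k) \<Rightarrow> bool" where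
  "twist_family m \<longleftrightarrow> (\<forall>n. m n \<in> carrier (GL B)) \<and> m 0 = mat_one B \<and>
    (\<forall>n. \<forall>g\<in>tensor_grade B 2. letterwise B (shifted_family m n) g \<in> R \<longleftrightarrow> letterwise B (shifted_family m 0) g \<in> R)"

lemma twist_TS0:
  assumes "\<theta> \<in> TS0 A"
  shows "\<exists>m. quadratic_twist B R \<theta> m \<and> twist_family m \<and> (\<theta> \<in> TS_alg A \<longrightarrow> m 2 = mat_mult B (m 1) (m 1)) \<and>
    (twisted_algebra A \<theta>, quadratic_algebra B {g \<in> tensor_grade B 2. letterwise B (shifted_family m 0) g \<in> R}) \<in> graded_iso_rel"
proof -
  obtain m where tw: "quadratic_twist B R \<theta> m" and alg: "\<theta> \<in> TS_alg A \<longrightarrow> m 2 = mat_mult B (m 1) (m 1)"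
    using TS0_matrices[OF assms] by blast
  interpret quadratic_twist B R \<theta> m by (rule tw)
  have "twist_family m" unfolding twist_family_def using m m_0 relations_invariant by blast
  moreover have "(twisted_algebra A \<theta>, quadratic_algebra B {g \<in> tensor_grade B 2. letterwise B (shifted_family m 0) g \<in> R}) \<in> graded_iso_rel"
    unfolding twisted_relations_def[symmetric]
    by (rule graded_iso_rel_quadratic[OF fin twisted_relations_grade presents_twisted])
      (use fin twisted_kernel \<pi>_zero_iff in \<open>simp add: twisted_algebra_def\<close>)
  ultimately show ?thesis using tw alg by blast
qed

lemma twist_TS:
  assumes "\<theta> \<in> TS A"
  shows "\<exists>m. twist_family m \<and>
    (twisted_algebra A \<theta>, quadratic_algebra B {g \<in> tensor_grade B 2. letterwise B (shifted_family m 0) g \<in> R}) \<in> graded_iso_rel"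
proof -
  obtain \<theta>' \<eta> where \<theta>': "\<theta>' \<in> TS0 A" and \<eta>: "\<And>h. presents B h (twisted_algebra A \<theta>') \<Longrightarrow>
    presents B (\<lambda>f. \<eta> (h f)) (twisted_algebra A \<theta>) \<and>
    (\<forall>f\<in>tensor_carrier B. \<eta> (h f) = \<zero>\<^bsub>twisted_algebra A \<theta>\<^esub> \<longleftrightarrow> h f = \<zero>\<^bsub>twisted_algebra A \<theta>'\<^esub>)"
    using TS_normalise[OF assms] by blast
  obtain m where tw: "quadratic_twist B R \<theta>' m" using TS0_matrices[OF \<theta>'] by blast
  interpret quadratic_twist B R \<theta>' m by (rule tw)
  have "twist_family m" unfolding twist_family_def using m m_0 relations_invariant by blast
  moreover have "(twisted_algebra A \<theta>, quadratic_algebra B {g \<in> tensor_grade B 2. letterwise B (shifted_family m 0) g \<in> R}) \<in> graded_iso_rel"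
    unfolding twisted_relations_def[symmetric]
    by (rule graded_iso_rel_quadratic[OF fin twisted_relations_grade \<eta>[OF presents_twisted, THEN conjunct1]])
      (use fin \<eta>[OF presents_twisted, THEN conjunct2] twisted_kernel \<pi>_zero_iff in \<open>simp add: twisted_algebra_def\<close>)
  ultimately show ?thesis by blast
qed

end

context quadratic
begin

lemma \<pi>_coset: "\<pi> f = (\<lambda>i w. i w + f w) ` I"
  by (auto simp: \<pi>_def a_r_coset_def')

lemma twist_familyD:
  assumes "twist_family m"
  shows "m n \<in> carrier (GL B)" "m 0 = mat_one B"
    "g \<in> tensor_grade B 2 \<Longrightarrow> letterwise B (shifted_family m n) g \<in> R \<longleftrightarrow> letterwise B (shifted_family m 0) g \<in> R"
  using assms unfolding twist_family_def by blast+

text \<open>With \<open>P n\<close> the letterwise action of the family shifted by \<open>n\<close>,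
  this family acts as the inverse of \<open>P p\<close> followed by \<open>P q\<close>.\<close>

definition quotient_family :: "(int \<Rightarrow> 'x \<Rightarrow> 'x \<Rightarrow> 'k) \<Rightarrow> int \<Rightarrow> int \<Rightarrow> nat \<Rightarrow> 'x \<Rightarrow> 'x \<Rightarrow> 'k" where
  "quotient_family m p q = (\<lambda>j. mat_mult B (inv\<^bsub>GL B\<^esub> (m (p + int j))) (m (q + int j)))"

text \<open>The inverse of the action shifted by \<open>p\<close> takes \<open>R\<close> into the
  common pullback, and the action shifted by \<open>q\<close> takes that into \<open>R\<close>.
  Further shifts only move \<open>p\<close> and \<open>q\<close> together.\<close>

lemma quotient_family_I:
  assumes m: "twist_family m" and f: "f \<in> I"
  shows "letterwise B (quotient_family m p q) f \<in> I"
proof -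
  note D = twist_familyD[OF m]
  have fc: "shifted_family m n j \<in> carrier (GL B)" for n j using D(1) by (simp add: shifted_family_def)
  show ?thesis using f unfolding I_def
  proof (rule letterwise_Idl[OF fin R(1) R(1), rotated])
    fix i g assume g: "g \<in> R"
    then have g2: "g \<in> tensor_grade B 2" using R(1) by blast
    let ?g = "letterwise B (\<lambda>j. inv\<^bsub>GL B\<^esub> (shifted_family m (p + int i) j)) g"
    have g': "?g \<in> tensor_grade B 2" by (rule letterwise_grade[OF fin g2])
    have "letterwise B (shifted_family m (p + int i)) ?g = g" by (rule letterwise_inverse(1)[OF fin fc grade_carrier[OF g2]])
    then have "letterwise B (shifted_family m (q + int i)) ?g \<in> R" using D(3)[OF g'] g by metis
    moreover have "letterwise B (shifted_family m (q + int i)) ?g = letterwise B (\<lambda>j. quotient_family m p q (i + j)) g"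
      unfolding letterwise_letterwise by (simp add: quotient_family_def shifted_family_def add.assoc)
    ultimately show "letterwise B (\<lambda>j. quotient_family m p q (i + j)) g \<in> R" by simp
  qed
qed

lemma quotient_family_letterwise:
  assumes m: "twist_family m" and f: "f \<in> tensor_carrier B"
  shows "letterwise B (quotient_family m q r) (letterwise B (quotient_family m p q) f) = letterwise B (quotient_family m p r) f"
    and "letterwise B (quotient_family m p p) f = f"
proof -
  interpret G: group "GL B :: ('x \<Rightarrow> 'x \<Rightarrow> 'k) monoid" by (rule group_GL[OF fin])
  note c = twist_familyD(1)[OF m]
  have canc: "a \<otimes>\<^bsub>GL B\<^esub> (inv\<^bsub>GL B\<^esub> a \<otimes>\<^bsub>GL B\<^esub> b) = b"
    if "a \<in> carrier (GL B)" "b \<in> carrier (GL B)" for a b :: "'x \<Rightarrow> 'x \<Rightarrow> 'k"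
    using that by (simp add: G.m_assoc[symmetric])
  have "mat_mult B (quotient_family m p q j) (quotient_family m q r j) = quotient_family m p r j" for j
    using c by (simp add: quotient_family_def GL_simps[symmetric] G.m_assoc canc)
  then show "letterwise B (quotient_family m q r) (letterwise B (quotient_family m p q) f) = letterwise B (quotient_family m p r) f"
    by (simp add: letterwise_letterwise)
  have "quotient_family m p p = (\<lambda>j. mat_one B)" using c by (simp add: quotient_family_def GL_simps[symmetric])
  then show "letterwise B (quotient_family m p p) f = f" by (simp add: letterwise_id[OF fin f])
qed

text \<open>Both this family and the reversed one preserve \<open>I\<close>, so \<open>I\<close> is
  mapped onto itself. A map of the quotient can then be defined by taking images of cosets, without
  representatives.\<close>

lemma letterwise_coset:
  assumes m: "twist_family m" and f: "f \<in> tensor_carrier B"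
  shows "letterwise B (quotient_family m p q) ` \<pi> f = \<pi> (letterwise B (quotient_family m p q) f)"
proof -
  have I: "letterwise B (quotient_family m p q) ` I = I"
  proof
    show "letterwise B (quotient_family m p q) ` I \<subseteq> I" using quotient_family_I[OF m] by blast
    show "I \<subseteq> letterwise B (quotient_family m p q) ` I"
    proof
      fix i assume i: "i \<in> I"
      then have "i = letterwise B (quotient_family m p q) (letterwise B (quotient_family m q p) i)"
        using quotient_family_letterwise[OF m ideal_tensor_algebraD(1)[OF ideal_I]] by simp
      then show "i \<in> letterwise B (quotient_family m p q) ` I" using quotient_family_I[OF m i] by blast
    qed
  qed
  have "letterwise B (quotient_family m p q) ` \<pi> f = (\<lambda>i w. i w + letterwise B (quotient_family m p q) f w) ` letterwise B (quotient_family m p q) ` I"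
    unfolding \<pi>_coset image_image letterwise_add ..
  then show ?thesis unfolding I \<pi>_coset .
qed

text \<open>The equation \<open>\<theta>\<^sub>n P\<^sub>0 = P\<^sub>n\<close>, which holds for
  every system with these matrices, is turned into the definition of
  \<open>\<theta>\<^sub>n\<close>.\<close>

lemma twist_exists:
  assumes m: "twist_family m"
  shows "\<exists>\<theta>\<in>TS0 A. quadratic_twist B R \<theta> m \<and>
    ((\<forall>a b. m (a + b) = mat_mult B (m a) (m b)) \<longrightarrow> \<theta> \<in> TS_alg A)"
proof -
  interpret G: group "GL B :: ('x \<Rightarrow> 'x \<Rightarrow> 'k) monoid" by (rule group_GL[OF fin])
  note D = twist_familyD[OF m]
  define \<Theta> where "\<Theta> n = letterwise B (quotient_family m 0 n)" for n
  define \<theta> where "\<theta> n = restrict (\<lambda>Y. \<Theta> n ` Y) (carrier A)" for n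
  have \<Theta>c: "\<Theta> n f \<in> tensor_carrier B" if "f \<in> tensor_carrier B" for n f using that fin by (simp add: \<Theta>_def)
  have \<theta>: "\<theta> n (\<pi> f) = \<pi> (\<Theta> n f)" if "f \<in> tensor_carrier B" for n f
    using that letterwise_coset[OF m that] by (simp add: \<theta>_def \<Theta>_def)
  have onto: "\<exists>g\<in>tensor_grade B k. f = \<Theta> n g" if "f \<in> tensor_grade B k" for n k f
  proof
    show "f = \<Theta> n (letterwise B (quotient_family m n 0) f)" unfolding \<Theta>_def
      using quotient_family_letterwise[OF m grade_carrier[OF that]] by simp
  qed (rule letterwise_grade[OF fin that])
  have ontoc: "\<exists>g\<in>tensor_carrier B. f = \<Theta> n g" if "f \<in> tensor_carrier B" for n f
  proof
    show "f = \<Theta> n (letterwise B (quotient_family m n 0) f)" unfolding \<Theta>_def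
      using quotient_family_letterwise[OF m that] by simp
  qed (use that fin in simp)
  have inj: "\<pi> f = \<pi> g" if fg: "f \<in> tensor_carrier B" "g \<in> tensor_carrier B" and eq: "\<pi> (\<Theta> n f) = \<pi> (\<Theta> n g)" for n f g
  proof -
    have "letterwise B (quotient_family m n 0) ` \<pi> (\<Theta> n f) = letterwise B (quotient_family m n 0) ` \<pi> (\<Theta> n g)" using eq by simp
    then show ?thesis using fg quotient_family_letterwise[OF m] by (simp add: letterwise_coset[OF m \<Theta>c]) (simp add: \<Theta>_def)
  qed
  have aut: "\<theta> n \<in> graded_linear_aut A" for n
    unfolding graded_linear_aut_def
  proof (intro CollectI conjI ballI allI)
    have "inj_on (\<theta> n) (carrier A)"
    proof (rule inj_onI)
      fix a b assume "a \<in> carrier A" "b \<in> carrier A" and eq: "\<theta> n a = \<theta> n b"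
      then obtain f g where f: "f \<in> tensor_carrier B" "a = \<pi> f" and g: "g \<in> tensor_carrier B" "b = \<pi> g"
        by (auto simp: carrier)
      have "\<pi> (\<Theta> n f) = \<pi> (\<Theta> n g)" using eq \<theta>[OF f(1)] \<theta>[OF g(1)] f(2) g(2) by simp
      then show "a = b" unfolding f(2) g(2) by (rule inj[OF f(1) g(1)])
    qed
    moreover have "\<theta> n ` carrier A = carrier A"
    proof
      show "\<theta> n ` carrier A \<subseteq> carrier A" using \<Theta>c by (auto simp: carrier \<theta>)
      show "carrier A \<subseteq> \<theta> n ` carrier A"
      proof
        fix a assume "a \<in> carrier A"
        then obtain f where f: "f \<in> tensor_carrier B" "a = \<pi> f" by (auto simp: carrier)
        then obtain g where "g \<in> tensor_carrier B" "f = \<Theta> n g" using ontoc by blast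
        then have "a = \<theta> n (\<pi> g)" "\<pi> g \<in> carrier A" using f by (simp_all add: \<theta>)
        then show "a \<in> \<theta> n ` carrier A" by blast
      qed
    qed
    ultimately show "\<theta> n \<in> Bij (carrier A)" by (simp add: Bij_def bij_betw_def \<theta>_def)
    fix a assume "a \<in> carrier A"
    then obtain f where f: "f \<in> tensor_carrier B" "a = \<pi> f" by (auto simp: carrier)
    show "\<theta> n (c \<odot>\<^bsub>A\<^esub> a) = c \<odot>\<^bsub>A\<^esub> \<theta> n a" for c
      using f by (simp add: smult \<theta> \<Theta>c) (simp add: \<Theta>_def letterwise_scale)
    fix b assume "b \<in> carrier A"
    then obtain g where g: "g \<in> tensor_carrier B" "b = \<pi> g" by (auto simp: carrier)
    show "\<theta> n (a \<oplus>\<^bsub>A\<^esub> b) = \<theta> n a \<oplus>\<^bsub>A\<^esub> \<theta> n b"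
      using f g by (simp add: add \<theta> \<Theta>c) (simp add: \<Theta>_def letterwise_add)
  next
    fix k
    have "\<theta> n ` grade A k = (\<lambda>f. \<pi> (\<Theta> n f)) ` tensor_grade B k"
      unfolding grade image_image by (rule image_cong[OF refl]) (rule \<theta>[OF grade_carrier])
    also have "\<dots> = \<pi> ` \<Theta> n ` tensor_grade B k" by (simp add: image_image)
    also have "\<Theta> n ` tensor_grade B k = tensor_grade B k"
      using onto[of _ k n] letterwise_grade[OF fin] by (auto simp: \<Theta>_def image_iff)
    finally show "\<theta> n ` grade A k = grade A k" by (simp add: grade)
  qed
  \<comment> \<open>Shifted by \<open>k\<close>, the family from 0 to \<open>n\<close> becomes the
    one from \<open>k\<close> to \<open>n + k\<close>, which composes with \<open>\<Theta> k\<close>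
    to \<open>\<Theta> (n + k)\<close>. This is the right factor of the twisting identity.\<close>
  have quot: "letterwise B (\<lambda>j. quotient_family m 0 n (k + j)) (\<Theta> (int k) g) = \<Theta> (n + int k) g"
    if g: "g \<in> tensor_carrier B" for n k g
  proof -
    have "(\<lambda>j. quotient_family m 0 n (k + j)) = quotient_family m (int k) (n + int k)"
      by (simp add: quotient_family_def algebra_simps)
    then show ?thesis using quotient_family_letterwise(1)[OF m g] by (simp add: \<Theta>_def)
  qed
  have "\<theta> n (a \<otimes>\<^bsub>A\<^esub> \<theta> (int k) b) = \<theta> n a \<otimes>\<^bsub>A\<^esub> \<theta> (n + int k) b"
    if a: "a \<in> grade A k" and b: "b \<in> grade A l" for n k l a b
  proof -
    obtain f g where f: "f \<in> tensor_grade B k" "a = \<pi> f" and g: "g \<in> tensor_grade B l" "b = \<pi> g"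
      using a b by (auto simp: grade)
    note c = grade_carrier[OF f(1)] grade_carrier[OF g(1)]
    have "\<theta> n (a \<otimes>\<^bsub>A\<^esub> \<theta> (int k) b) = \<pi> (\<Theta> n (conv f (\<Theta> (int k) g)))"
      using c by (simp add: f g \<theta> \<Theta>c mult)
    also have "\<Theta> n (conv f (\<Theta> (int k) g)) = conv (\<Theta> n f) (\<Theta> (n + int k) g)"
      using letterwise_conv_grade[OF f(1) fin] quot[OF c(2)] by (simp add: \<Theta>_def)
    also have "\<pi> \<dots> = \<theta> n a \<otimes>\<^bsub>A\<^esub> \<theta> (n + int k) b" using c by (simp add: f g \<theta> \<Theta>c mult)
    finally show ?thesis .
  qed
  then have "\<theta> \<in> TS A" using aut by (auto simp: TS_def)
  moreover have "\<theta> 0 = (\<lambda>a\<in>carrier A. a)"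
  proof (rule extensionalityI[of _ "carrier A"])
    fix a assume "a \<in> carrier A"
    then obtain f where f: "f \<in> tensor_carrier B" "a = \<pi> f" by (auto simp: carrier)
    then show "\<theta> 0 a = (\<lambda>a\<in>carrier A. a) a" using quotient_family_letterwise(2)[OF m f(1)] by (simp add: \<theta>) (simp add: \<Theta>_def)
  qed (simp_all add: \<theta>_def)
  ultimately have TS0: "\<theta> \<in> TS0 A" by (simp add: TS0_def)
  have "quadratic_twist B R \<theta> m"
  proof (intro quadratic_twist.intro quadratic_twist_axioms.intro)
    show "quadratic B R" by (rule quadratic_axioms)
    show "\<theta> n (quadratic.\<pi> B R (single x)) = quadratic.\<pi> B R (row (m n) x)" if x: "x \<in> B" for n x
    proof -
      have q0: "quotient_family m 0 n 0 = m n" using D by (simp add: quotient_family_def GL_simps[symmetric])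
      have "\<Theta> n (single x) = row (quotient_family m 0 n 0) x" unfolding \<Theta>_def
        by (rule letterwise_single[OF fin x]) (use GL_support[OF D(1)] q0 in auto)
      then show ?thesis using \<theta>[OF grade_carrier[OF single_grade[OF x]]] q0 by simp
    qed
  qed (use TS0 D in auto)
  moreover have "\<theta> \<in> TS_alg A" if hom: "\<forall>a b. m (a + b) = mat_mult B (m a) (m b)"
  proof -
    have "\<theta> (a + b) = compose (carrier A) (\<theta> a) (\<theta> b)" for a b
    proof (rule extensionalityI[of _ "carrier A"])
      fix y assume y: "y \<in> carrier A"
      then obtain f where f: "f \<in> tensor_carrier B" "y = \<pi> f" by (auto simp: carrier)
      \<comment> \<open>If the matrices form a group indexed by the integers, the position of a
        letter no longer matters.\<close>
      have const: "quotient_family m 0 n j = m n" for n j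
      proof -
        have "m (n + int j) = m (int j) \<otimes>\<^bsub>GL B\<^esub> m n" using hom by (simp add: GL_simps add.commute[of n])
        then show ?thesis using D(1) by (simp add: quotient_family_def GL_simps[symmetric] G.m_assoc[symmetric])
      qed
      \<comment> \<open>The letterwise action reverses products, hence the exchanged order; the sum
        of the indices is symmetric.\<close>
      have "m (a + b) = mat_mult B (m b) (m a)" using hom by (simp add: add.commute[of a])
      moreover have "quotient_family m 0 n = (\<lambda>j. m n)" for n using const by blast
      ultimately have "\<Theta> a (\<Theta> b f) = \<Theta> (a + b) f" by (simp add: \<Theta>_def letterwise_letterwise)
      then show "\<theta> (a + b) y = compose (carrier A) (\<theta> a) (\<theta> b) y"
        using y f by (simp add: compose_eq \<theta> \<Theta>c)
    qed (simp_all add: \<theta>_def)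
    then show ?thesis using TS0 by (simp add: TS_alg_def)
  qed
  ultimately show ?thesis using TS0 by blast
qed

lemma twist_of_family:
  assumes m: "twist_family m"
  shows "\<exists>\<theta>\<in>TS0 A. ((\<forall>a b. m (a + b) = mat_mult B (m a) (m b)) \<longrightarrow> \<theta> \<in> TS_alg A) \<and>
    (twisted_algebra A \<theta>, quadratic_algebra B {g \<in> tensor_grade B 2. letterwise B (shifted_family m 0) g \<in> R}) \<in> graded_iso_rel"
proof -
  obtain \<theta> where \<theta>: "\<theta> \<in> TS0 A" and tw: "quadratic_twist B R \<theta> m"
    and alg: "(\<forall>a b. m (a + b) = mat_mult B (m a) (m b)) \<longrightarrow> \<theta> \<in> TS_alg A"
    using twist_exists[OF m] by blast
  interpret quadratic_twist B R \<theta> m by (rule tw)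
  have "(twisted_algebra A \<theta>, quadratic_algebra B {g \<in> tensor_grade B 2. letterwise B (shifted_family m 0) g \<in> R}) \<in> graded_iso_rel"
    unfolding twisted_relations_def[symmetric]
    by (rule graded_iso_rel_quadratic[OF fin twisted_relations_grade presents_twisted])
      (use fin twisted_kernel \<pi>_zero_iff in \<open>simp add: twisted_algebra_def\<close>)
  then show ?thesis using \<theta> alg by blast
qed

end

section \<open>Isomorphism classes of graded algebras\<close>

lemma graded_iso_sym:
  assumes A: "graded_algebra A" and \<phi>: "\<phi> \<in> graded_iso A A'"
  shows "inv_into (carrier A) \<phi> \<in> graded_iso A' A"
proof -
  interpret graded_algebra A by (rule A)
  have bij: "bij_betw \<phi> (carrier A) (carrier A')" and ri: "\<phi> \<in> ring_iso A A'"
    using \<phi> by (auto simp: graded_iso_def ring_iso_def)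
  have inv: "inv_into (carrier A) \<phi> \<in> ring_iso A' A" by (rule ring_iso_set_sym[OF graded_algebra.axioms(1)[OF A] ri])
  have left: "inv_into (carrier A) \<phi> (\<phi> a) = a" if "a \<in> carrier A" for a
    using bij that by (simp add: bij_betw_def)
  have im: "\<phi> ` carrier A = carrier A'" using bij by (simp add: bij_betw_def)
  have smc: "c \<odot>\<^bsub>A\<^esub> a \<in> carrier A" if "a \<in> carrier A" for c a
    using smult_closed[of c a] that by (simp add: ring_of_type_algebra_def)
  show ?thesis unfolding graded_iso_def
  proof (intro CollectI conjI allI ballI inv)
    fix c b assume "b \<in> carrier A'"
    then obtain a where a: "a \<in> carrier A" "b = \<phi> a" using im by blast
    have "c \<odot>\<^bsub>A'\<^esub> b = \<phi> (c \<odot>\<^bsub>A\<^esub> a)" using \<phi> a by (simp add: graded_iso_def)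
    then show "inv_into (carrier A) \<phi> (c \<odot>\<^bsub>A'\<^esub> b) = c \<odot>\<^bsub>A\<^esub> inv_into (carrier A) \<phi> b"
      using a smc by (simp add: left)
  next
    fix n
    have sub: "grade A n \<subseteq> carrier A" using grade_subgroup by (rule additive_subgroup.a_subset)
    have "grade A' n = \<phi> ` grade A n" using \<phi> by (simp add: graded_iso_def)
    then show "inv_into (carrier A) \<phi> ` grade A' n = grade A n"
      using sub left by (auto simp: image_image subset_iff image_iff)
  qed
qed

lemma graded_iso_trans:
  assumes sub: "\<And>n. grade A n \<subseteq> carrier A" and \<phi>: "\<phi> \<in> graded_iso A A'" and \<psi>: "\<psi> \<in> graded_iso A' A''"
  shows "\<psi> \<circ> \<phi> \<in> graded_iso A A''"
proof -
  have "\<phi> a \<in> carrier A'" if "a \<in> carrier A" for a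
    using \<phi> that by (auto simp: graded_iso_def ring_iso_def ring_hom_def)
  moreover have "\<psi> \<circ> \<phi> \<in> ring_iso A A''" using \<phi> \<psi> ring_iso_set_trans by (auto simp: graded_iso_def)
  moreover have "(\<psi> \<circ> \<phi>) ` grade A n = grade A'' n" for n
    unfolding image_comp[symmetric] using \<phi> \<psi> by (simp add: graded_iso_def)
  ultimately show ?thesis using \<phi> \<psi> by (simp add: graded_iso_def)
qed

lemma sym_graded_iso_rel: "sym graded_iso_rel"
  unfolding sym_def graded_iso_rel_def using graded_iso_sym by fast

lemma trans_graded_iso_rel: "trans graded_iso_rel"
proof (rule transI)
  fix A A' A'' :: "('k::field, 'a) graded_alg"
  assume 1: "(A, A') \<in> graded_iso_rel" and 2: "(A', A'') \<in> graded_iso_rel"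
  obtain \<phi> \<psi> where \<phi>: "\<phi> \<in> graded_iso A A'" and \<psi>: "\<psi> \<in> graded_iso A' A''"
    using 1 2 by (auto simp: graded_iso_rel_def)
  have "grade A n \<subseteq> carrier A" for n
  proof -
    have "graded_algebra A" using 1 by (simp add: graded_iso_rel_def)
    then show ?thesis by (rule additive_subgroup.a_subset[OF graded_algebra.grade_subgroup])
  qed
  from graded_iso_trans[OF this \<phi> \<psi>] show "(A, A'') \<in> graded_iso_rel"
    using 1 2 by (auto simp: graded_iso_rel_def)
qed

text \<open>Related algebras have the same class, by symmetry and transitivity, so it is enough to
  match representatives in both directions.\<close>

lemma quotient_graded_iso_rel_eqI:
  assumes 1: "\<And>C. C \<in> U \<Longrightarrow> \<exists>D\<in>W. (C, D) \<in> graded_iso_rel"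
    and 2: "\<And>D. D \<in> W \<Longrightarrow> \<exists>C\<in>U. (C, D) \<in> graded_iso_rel"
  shows "U // graded_iso_rel = W // graded_iso_rel"
proof -
  have eq: "graded_iso_rel `` {S} = graded_iso_rel `` {S'}" if "(S, S') \<in> graded_iso_rel" for S S'
    using that symD[OF sym_graded_iso_rel] transD[OF trans_graded_iso_rel] by blast
  show ?thesis
  proof
    show "U // graded_iso_rel \<subseteq> W // graded_iso_rel"
    proof
      fix K assume "K \<in> U // graded_iso_rel"
      then obtain C where C: "C \<in> U" "K = graded_iso_rel `` {C}" by (rule quotientE)
      obtain D where D: "D \<in> W" "(C, D) \<in> graded_iso_rel" using 1[OF C(1)] by blast
      show "K \<in> W // graded_iso_rel" unfolding C(2) eq[OF D(2)] by (rule quotientI[OF D(1)])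
    qed
    show "W // graded_iso_rel \<subseteq> U // graded_iso_rel"
    proof
      fix K assume "K \<in> W // graded_iso_rel"
      then obtain D where D: "D \<in> W" "K = graded_iso_rel `` {D}" by (rule quotientE)
      obtain C where C: "C \<in> U" "(C, D) \<in> graded_iso_rel" using 2[OF D(1)] by blast
      show "K \<in> U // graded_iso_rel" unfolding D(2) eq[OF C(2), symmetric] by (rule quotientI[OF C(1)])
    qed
  qed
qed

section \<open>Twists of geometric algebras\<close>

lemma act_dual [simp]: "act B m u \<in> dual_space B"
  by (simp add: act_def dual_space_def)

lemma act_scale: "act B m (\<lambda>x. c * u x) = (\<lambda>x. c * act B m u x)"
  by (auto simp: act_def sum_distrib_left mult.left_commute)

lemma act_mat_mult: "act B (mat_mult B N M) u = act B N (act B M u)"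
  by (auto simp: act_def mat_mult_def sum_distrib_left sum_distrib_right mult.assoc fun_eq_iff intro: sum.swap)

lemma act_mat_one:
  assumes "finite B" "u \<in> dual_space B"
  shows "act B (mat_one B) u = u"
proof
  fix x
  have "(\<Sum>y\<in>B. mat_one B x y * u y) = (\<Sum>y\<in>B. if y = x then u x else 0)" by (rule sum.cong) (auto simp: mat_one_def)
  then show "act B (mat_one B) u x = u x" using assms by (auto simp: act_def dual_space_def)
qed

text \<open>Points are lines, so the image of the set is the image point, without a choice of
  coordinates.\<close>

definition proj_map :: "'x set \<Rightarrow> ('x \<Rightarrow> 'x \<Rightarrow> 'k::field) \<Rightarrow> ('x \<Rightarrow> 'k) set \<Rightarrow> ('x \<Rightarrow> 'k) set" where
  "proj_map B m p = act B m ` p"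

lemma proj_map_line: "proj_map B m (line u) = line (act B m u)"
proof -
  have range: "line v = range (\<lambda>c x. c * v x)" for v :: "'a \<Rightarrow> 'b" by (auto simp: line_def)
  show ?thesis unfolding range proj_map_def image_image act_scale ..
qed

lemma proj_map_mat_mult: "proj_map B (mat_mult B N M) p = proj_map B N (proj_map B M p)"
  by (simp add: proj_map_def image_image act_mat_mult)

lemma proj_map_mat_one: "finite B \<Longrightarrow> p \<in> proj_space B \<Longrightarrow> proj_map B (mat_one B) p = p"
  by (auto simp: proj_space_def proj_map_line act_mat_one)

lemma act_nonzero:
  assumes "finite B" "m \<in> carrier (GL B)" "u \<in> dual_space B" "u \<noteq> (\<lambda>x. 0)"
  shows "act B m u \<noteq> (\<lambda>x. 0)"
proof
  assume "act B m u = (\<lambda>x. 0)"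
  then have "act B (inv\<^bsub>GL B\<^esub> m) (act B m u) = (\<lambda>x. 0)" by (simp add: act_def fun_eq_iff)
  then show False using assms by (simp add: act_mat_mult[symmetric] GL_inv act_mat_one)
qed

lemma proj_map_proj:
  assumes "finite B" "m \<in> carrier (GL B)" "p \<in> proj_space B"
  shows "proj_map B m p \<in> proj_space B"
proof -
  obtain u where u: "u \<in> dual_space B" "u \<noteq> (\<lambda>x. 0)" "p = line u" using assms(3) by (rule proj_spaceE)
  show ?thesis unfolding u(3) proj_map_line by (rule line_in_proj[OF act_dual act_nonzero[OF assms(1,2) u(1,2)]])
qed

lemma proj_map_inv:
  assumes "finite B" "m \<in> carrier (GL B)" "p \<in> proj_space B"
  shows "proj_map B (inv\<^bsub>GL B\<^esub> m) (proj_map B m p) = p" "proj_map B m (proj_map B (inv\<^bsub>GL B\<^esub> m) p) = p"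
  using assms by (simp_all add: proj_map_mat_mult[symmetric] GL_inv proj_map_mat_one)

lemma projective_variety_empty: "finite B \<Longrightarrow> projective_variety B ({} :: ('x \<Rightarrow> 'k::field) set set)"
proof -
  assume B: "finite B"
  have "{m. (\<forall>x. x \<notin> B \<longrightarrow> m x = 0) \<and> (\<Sum>x\<in>B. m x) = 0} = {\<lambda>x. 0 :: nat}"
    using B by (auto simp: fun_eq_iff)
  then have "(\<lambda>u. 1 :: 'k) \<in> homogeneous_poly B 0"
    unfolding homogeneous_poly_def by (intro CollectI exI[of _ "\<lambda>m. 1"]) simp
  then show ?thesis unfolding projective_variety_def
    by (intro exI[of _ "{\<lambda>u. 1}"]) (auto simp: proj_space_def dest: spec[of _ "_"] intro: mem_line)
qed

text \<open>The exponent functions of total degree 1 are the indicator functions \<open>e y\<close>,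
  which turns the sum over monomials into a sum over \<open>B\<close>.\<close>

lemma linear_form_homogeneous:
  fixes c :: "'x \<Rightarrow> 'k::field"
  assumes B: "finite B"
  shows "(\<lambda>u. \<Sum>y\<in>B. c y * u y) \<in> homogeneous_poly B 1"
proof -
  define e where "e y = (\<lambda>z. if z = y then 1 else 0 :: nat)" for y :: 'x
  have e_inj: "inj_on e B" by (auto simp: inj_on_def e_def fun_eq_iff split: if_splits)
  have set: "{m. (\<forall>x. x \<notin> B \<longrightarrow> m x = 0) \<and> (\<Sum>x\<in>B. m x) = 1} = e ` B"
  proof
    show "e ` B \<subseteq> {m. (\<forall>x. x \<notin> B \<longrightarrow> m x = 0) \<and> (\<Sum>x\<in>B. m x) = 1}"
      using B by (auto simp: e_def)
    show "{m. (\<forall>x. x \<notin> B \<longrightarrow> m x = 0) \<and> (\<Sum>x\<in>B. m x) = 1} \<subseteq> e ` B"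
    proof
      fix m :: "'x \<Rightarrow> nat" assume m: "m \<in> {m. (\<forall>x. x \<notin> B \<longrightarrow> m x = 0) \<and> (\<Sum>x\<in>B. m x) = 1}"
      then have "(\<Sum>x\<in>B. m x) = 1" by blast
      then obtain y where y: "y \<in> B" "m y = 1" "\<forall>z\<in>B. z \<noteq> y \<longrightarrow> m z = 0"
        using sum_eq_1_iff[OF B, of m] by auto
      then have "m = e y" using m by (auto simp: e_def fun_eq_iff)
      then show "m \<in> e ` B" using y by blast
    qed
  qed
  have pr: "(\<Prod>x\<in>B. u x ^ e y x) = u y" if "y \<in> B" for u :: "'x \<Rightarrow> 'k" and y
  proof -
    have "(\<Prod>x\<in>B. u x ^ e y x) = (\<Prod>x\<in>B. if x = y then u x else 1)" by (rule prod.cong) (auto simp: e_def)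
    then show ?thesis using B that by simp
  qed
  have "(\<lambda>u. \<Sum>y\<in>B. c y * u y) = (\<lambda>u. \<Sum>m\<in>e ` B. c (inv_into B e m) * (\<Prod>x\<in>B. u x ^ m x))"
    by (rule ext, subst sum.reindex[OF e_inj]) (auto simp: pr e_inj intro!: sum.cong)
  then show ?thesis unfolding homogeneous_poly_def set
    by (intro CollectI exI[of _ "\<lambda>m. c (inv_into B e m)"]) simp
qed

text \<open>The rows of \<open>m\<close> are linear forms that describe the map globally, so the
  exceptional set is empty at every point.\<close>

lemma regular_map_proj_map:
  fixes m :: "'x \<Rightarrow> 'x \<Rightarrow> 'k::field"
  assumes B: "finite B" and m: "m \<in> carrier (GL B)" and E: "E \<subseteq> proj_space B" "proj_map B m ` E \<subseteq> E"
  shows "regular_map B E E (restrict (proj_map B m) E)"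
  unfolding regular_map_def
proof (intro conjI ballI)
  show "restrict (proj_map B m) E \<in> E \<rightarrow> E" using E(2) by auto
  fix p assume "p \<in> E"
  let ?F = "\<lambda>x u. \<Sum>y\<in>B. m x y * u y"
  have "(\<exists>x\<in>B. ?F x u \<noteq> 0) \<and> restrict (proj_map B m) E q = line (\<lambda>x. if x \<in> B then ?F x u else 0)"
    if q: "q \<in> E - {}" and u: "u \<in> q" "u \<noteq> (\<lambda>x. 0)" for q u
  proof -
    obtain v where v: "v \<in> dual_space B" "q = line v" using q E(1) by (auto elim!: proj_spaceE)
    have q': "q = line u" using line_cong_mem[of u v] u v by simp
    have "u \<in> dual_space B" using u(1) v by (auto simp: line_def dual_space_def)
    then have "act B m u \<noteq> (\<lambda>x. 0)" using act_nonzero[OF B m] u by blast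
    then have "\<exists>x\<in>B. ?F x u \<noteq> 0" by (auto simp: act_def fun_eq_iff split: if_splits)
    then show ?thesis using q by (simp add: q' proj_map_line) (simp add: act_def)
  qed
  then show "\<exists>Z d F. projective_variety B Z \<and> p \<notin> Z \<and> (\<forall>x\<in>B. F x \<in> homogeneous_poly B d) \<and>
      (\<forall>q\<in>E - Z. \<forall>u\<in>q. u \<noteq> (\<lambda>x. 0) \<longrightarrow> (\<exists>x\<in>B. F x u \<noteq> 0) \<and> restrict (proj_map B m) E q = line (\<lambda>x. if x \<in> B then F x u else 0))"
    using projective_variety_empty[OF B] linear_form_homogeneous[OF B]
    by (intro exI[of _ "{}"] exI[of _ 1] exI[of _ ?F]) blast
qed

lemma BijGroup_simps:
  "carrier (BijGroup E) = Bij E" "\<lbrakk>f \<in> Bij E; g \<in> Bij E\<rbrakk> \<Longrightarrow> f \<otimes>\<^bsub>BijGroup E\<^esub> g = compose E f g"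
  "\<one>\<^bsub>BijGroup E\<^esub> = (\<lambda>x\<in>E. x)"
  by (simp_all add: BijGroup_def)

lemma Bij_apply: "f \<in> Bij E \<Longrightarrow> p \<in> E \<Longrightarrow> f p \<in> E"
  by (auto simp: Bij_def bij_betw_def)

lemma Bij_eqI: "\<lbrakk>f \<in> Bij E; g \<in> Bij E; \<And>p. p \<in> E \<Longrightarrow> f p = g p\<rbrakk> \<Longrightarrow> f = g"
  by (rule extensionalityI[of _ E]) (auto simp: Bij_def)

lemma proj_map_image_inv:
  assumes B: "finite B" and m: "m \<in> carrier (GL B)" and E: "E \<subseteq> proj_space B" "proj_map B m ` E = E"
  shows "proj_map B (inv\<^bsub>GL B\<^esub> m) ` E = E"
proof -
  have "proj_map B (inv\<^bsub>GL B\<^esub> m) ` proj_map B m ` E = E"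
    unfolding image_image using proj_map_inv(1)[OF B m] E(1) by (auto simp: image_iff subset_iff)
  then show ?thesis using E(2) by simp
qed

lemma proj_map_Bij:
  assumes B: "finite B" and m: "m \<in> carrier (GL B)" and E: "E \<subseteq> proj_space B" "proj_map B m ` E = E"
  shows "restrict (proj_map B m) E \<in> Bij E"
proof -
  have "inj_on (proj_map B m) E" by (rule inj_on_inverseI[of _ "proj_map B (inv\<^bsub>GL B\<^esub> m)"]) (use proj_map_inv(1)[OF B m] E in blast)
  then show ?thesis using E(2) by (simp add: Bij_def bij_betw_def)
qed

lemma proj_map_Aut_var:
  assumes B: "finite B" and m: "m \<in> carrier (GL B)" and E: "E \<subseteq> proj_space B" "proj_map B m ` E = E"
  shows "restrict (proj_map B m) E \<in> Aut_var B E"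
proof -
  interpret group "BijGroup E" by (rule group_BijGroup)
  note m' = GL_inv(3)[OF B m] and E' = proj_map_image_inv[OF B m E]
  have "restrict (proj_map B (inv\<^bsub>GL B\<^esub> m)) E \<otimes>\<^bsub>BijGroup E\<^esub> restrict (proj_map B m) E = \<one>\<^bsub>BijGroup E\<^esub>"
    unfolding BijGroup_simps(2)[OF proj_map_Bij[OF B m' E(1) E'] proj_map_Bij[OF B m E]] BijGroup_simps(3) compose_def
    using E proj_map_inv(1)[OF B m] by (auto simp: fun_eq_iff)
  then have "inv\<^bsub>BijGroup E\<^esub> (restrict (proj_map B m) E) = restrict (proj_map B (inv\<^bsub>GL B\<^esub> m)) E"
    by (rule inv_equality) (simp_all add: BijGroup_simps proj_map_Bij[OF B m E] proj_map_Bij[OF B m' E(1) E'])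
  then show ?thesis unfolding Aut_var_def
    using regular_map_proj_map[OF B m E(1)] regular_map_proj_map[OF B m' E(1)] E E' proj_map_Bij[OF B m E]
    by (simp add: BijGroup_simps)
qed

lemma proj_map_image_proj_space:
  assumes "finite B" "m \<in> carrier (GL B)"
  shows "proj_map B m ` proj_space B = proj_space B"
proof
  show "proj_map B m ` proj_space B \<subseteq> proj_space B" using proj_map_proj[OF assms] by blast
  show "proj_space B \<subseteq> proj_map B m ` proj_space B"
    using proj_map_proj[OF assms(1) GL_inv(3)[OF assms]] proj_map_inv(2)[OF assms] by (metis image_eqI subsetI)
qed

text \<open>Every coordinate vector is an eigenvector, which removes the entries off the diagonal;
  the sum of two of them is an eigenvector as well, which makes the diagonal entries equal.\<close>

lemma scalar_matrix:
  fixes K :: "'x \<Rightarrow> 'x \<Rightarrow> 'k::field"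
  assumes B: "finite B" and K: "\<And>u. u \<in> dual_space B \<Longrightarrow> u \<noteq> (\<lambda>x. 0) \<Longrightarrow> \<exists>c. c \<noteq> 0 \<and> u = (\<lambda>x. c * act B K u x)"
  shows "\<exists>c. \<forall>x\<in>B. \<forall>z\<in>B. c * K x z = mat_one B x z"
proof (cases "B = {}")
  case False
  then obtain y0 where y0: "y0 \<in> B" by blast
  define e where "e y = (\<lambda>x. if x = y then 1 else (0::'k))" for y :: 'x
  have actK: "act B K (\<lambda>x. \<Sum>y\<in>S. e y x) x = (\<Sum>y\<in>S. K x y)" if "x \<in> B" "S \<subseteq> B" for x S
  proof -
    have "finite S" using that(2) B finite_subset by blast
    then have "(\<Sum>y\<in>B. K x y * (\<Sum>z\<in>S. e z y)) = (\<Sum>y\<in>B. if y \<in> S then K x y else 0)"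
      by (intro sum.cong) (auto simp: e_def)
    also have "\<dots> = (\<Sum>y\<in>S. K x y)" using that B by (simp add: sum.If_cases Int_absorb1)
    finally show ?thesis using that by (simp add: act_def)
  qed
  have ex: "\<exists>c. c \<noteq> 0 \<and> (\<forall>x\<in>B. (\<Sum>y\<in>S. e y x) = c * (\<Sum>y\<in>S. K x y))" if S: "S \<subseteq> B" "S \<noteq> {}" for S
  proof -
    let ?u = "\<lambda>x. \<Sum>y\<in>S. e y x"
    have fS: "finite S" using S B finite_subset by blast
    have u: "?u x = (if x \<in> S then 1 else 0)" for x using fS by (simp add: e_def)
    have "?u \<in> dual_space B" "?u \<noteq> (\<lambda>x. 0)" using S by (auto simp: u dual_space_def fun_eq_iff)
    from K[OF this] obtain c where c: "c \<noteq> 0" "?u = (\<lambda>x. c * act B K ?u x)" by blast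
    have "(\<Sum>y\<in>S. e y x) = c * (\<Sum>y\<in>S. K x y)" if "x \<in> B" for x
      using fun_cong[OF c(2), of x] actK[OF that S(1)] by simp
    with c(1) show ?thesis by blast
  qed
  obtain c where c: "c \<noteq> 0" "\<forall>x\<in>B. e y0 x = c * K x y0" using ex[of "{y0}"] y0 by auto
  have "c * K x z = mat_one B x z" if xz: "x \<in> B" "z \<in> B" for x z
  proof (cases "z = y0")
    case True
    then show ?thesis using c xz by (auto simp: e_def mat_one_def split: if_splits)
  next
    case False
    obtain d where d: "d \<noteq> 0" "\<forall>x\<in>B. e z x = d * K x z" using ex[of "{z}"] xz by auto
    obtain b where b: "b \<noteq> 0" "\<forall>x\<in>B. e y0 x + e z x = b * (K x y0 + K x z)" using ex[of "{y0, z}"] xz y0 False by auto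
    have "K z y0 = 0" "K y0 z = 0" using c d y0 xz False by (auto simp: e_def split: if_splits)
    then have "b * K y0 y0 = 1" "b * K z z = 1" using b(2) y0 xz False by (auto simp: e_def split: if_splits)
    moreover have "c * K y0 y0 = 1" "d * K z z = 1" using c d y0 xz by (auto simp: e_def)
    ultimately have "c = b" "d = b" by (metis mult_right_cancel mult_zero_right zero_neq_one)+
    then show ?thesis using d xz by (auto simp: e_def mat_one_def split: if_splits)
  qed
  then show ?thesis by blast
qed simp

text \<open>Both \<open>f\<close> and its inverse are induced by matrices \<open>m\<close> and
  \<open>n\<close>. The products \<open>n m\<close> and \<open>m n\<close> fix every point, so they
  are nonzero scalars, and \<open>m\<close> is invertible.\<close>

lemma Aut_proj_space:
  fixes f :: "('x \<Rightarrow> 'k::{alg_closed_field, field_char_0}) set \<Rightarrow> ('x \<Rightarrow> 'k) set"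
  assumes B: "finite B" and f: "f \<in> Aut_var B (proj_space B)"
  shows "\<exists>m\<in>carrier (GL B). \<forall>p\<in>proj_space B. f p = proj_map B m p"
proof -
  let ?P = "proj_space B :: ('x \<Rightarrow> 'k) set set"
  interpret group "BijGroup ?P" by (rule group_BijGroup)
  define g where "g = inv\<^bsub>BijGroup ?P\<^esub> f"
  have fg: "f \<in> Bij ?P" "g \<in> Bij ?P" "regular_map B ?P ?P f" "regular_map B ?P ?P g"
    using f unfolding g_def Aut_var_def by (auto simp: BijGroup_simps(1)[symmetric])
  have gf: "g (f p) = p" if "p \<in> ?P" for p
  proof -
    have "g \<otimes>\<^bsub>BijGroup ?P\<^esub> f = \<one>\<^bsub>BijGroup ?P\<^esub>" using fg by (simp add: g_def BijGroup_simps(1))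
    then show ?thesis using that fg by (simp add: BijGroup_simps compose_def fun_eq_iff) meson
  qed
  have fg': "f (g p) = p" if "p \<in> ?P" for p
  proof -
    have "f \<otimes>\<^bsub>BijGroup ?P\<^esub> g = \<one>\<^bsub>BijGroup ?P\<^esub>" using fg by (simp add: g_def BijGroup_simps(1))
    then show ?thesis using that fg by (simp add: BijGroup_simps compose_def fun_eq_iff) meson
  qed
  obtain m where m: "\<forall>u\<in>dual_space B. u \<noteq> (\<lambda>x. 0) \<longrightarrow> act B m u \<noteq> (\<lambda>x. 0) \<and> f (line u) = line (act B m u)"
    using regular_inverse_linear[OF fg(3,4) gf B] by blast
  obtain n where n: "\<forall>u\<in>dual_space B. u \<noteq> (\<lambda>x. 0) \<longrightarrow> act B n u \<noteq> (\<lambda>x. 0) \<and> g (line u) = line (act B n u)"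
    using regular_inverse_linear[OF fg(4,3) fg' B] by blast
  have "\<exists>c. c \<noteq> 0 \<and> u = (\<lambda>x. c * act B (mat_mult B n m) u x)" if u: "u \<in> dual_space B" "u \<noteq> (\<lambda>x. 0)" for u
  proof (rule line_eqD)
    show "line (act B (mat_mult B n m) u) = line u" unfolding act_mat_mult using m n gf[OF line_in_proj[OF u]] u by simp
  qed (rule u)
  from scalar_matrix[OF B this] obtain c where c: "\<forall>x\<in>B. \<forall>z\<in>B. c * mat_mult B n m x z = mat_one B x z" by blast
  have "\<exists>c. c \<noteq> 0 \<and> u = (\<lambda>x. c * act B (mat_mult B m n) u x)" if u: "u \<in> dual_space B" "u \<noteq> (\<lambda>x. 0)" for u
  proof (rule line_eqD)
    show "line (act B (mat_mult B m n) u) = line u" unfolding act_mat_mult using m n fg'[OF line_in_proj[OF u]] u by simp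
  qed (rule u)
  from scalar_matrix[OF B this] obtain d where d: "\<forall>x\<in>B. \<forall>z\<in>B. d * mat_mult B m n x z = mat_one B x z" by blast
  \<comment> \<open>Cutting off the entries outside \<open>B\<close>, as \<open>GL\<close> demands,
    does not change the action.\<close>
  define M where "M x y = (if x \<in> B \<and> y \<in> B then m x y else 0)" for x y
  have actM: "act B M u = act B m u" for u by (auto simp: act_def M_def fun_eq_iff intro!: sum.cong)
  have "M \<in> carrier (GL B)"
  proof (rule GLI[OF B])
    show "\<And>x y. M x y \<noteq> 0 \<Longrightarrow> x \<in> B \<and> y \<in> B" by (auto simp: M_def split: if_splits)
    have "(\<Sum>y\<in>B. c * n x y * M y z) = mat_one B x z" if "x \<in> B" "z \<in> B" for x z
    proof -
      have "(\<Sum>y\<in>B. c * n x y * M y z) = (\<Sum>y\<in>B. c * (n x y * m y z))" using that by (intro sum.cong) (auto simp: M_def)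
      then show ?thesis using c that by (simp add: mat_mult_def sum_distrib_left)
    qed
    then show "\<exists>l. \<forall>x\<in>B. \<forall>z\<in>B. (\<Sum>y\<in>B. l x y * M y z) = mat_one B x z" by (intro exI[of _ "\<lambda>x y. c * n x y"]) blast
    have "(\<Sum>y\<in>B. M x y * (d * n y z)) = mat_one B x z" if "x \<in> B" "z \<in> B" for x z
    proof -
      have "(\<Sum>y\<in>B. M x y * (d * n y z)) = (\<Sum>y\<in>B. d * (m x y * n y z))" using that by (intro sum.cong) (auto simp: M_def)
      then show ?thesis using d that by (simp add: mat_mult_def sum_distrib_left)
    qed
    then show "\<exists>r. \<forall>x\<in>B. \<forall>z\<in>B. (\<Sum>y\<in>B. M x y * r y z) = mat_one B x z" by (intro exI[of _ "\<lambda>y z. d * n y z"]) blast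
  qed
  moreover have "f p = proj_map B M p" if "p \<in> ?P" for p
    using that m by (auto elim!: proj_spaceE simp: proj_map_line actM)
  ultimately show ?thesis by blast
qed

text \<open>\<open>act\<close> is the transpose of the letterwise action; the fourfold sum only has
  to be reordered.\<close>

lemma bilinear_letterwise:
  "bilinear_value B (letterwise B M g) u v = bilinear_value B g (act B (M 0) u) (act B (M 1) v)"
proof -
  have "bilinear_value B (letterwise B M g) u v =
    (\<Sum>y1\<in>B. \<Sum>y2\<in>B. \<Sum>x1\<in>B. \<Sum>x2\<in>B. g [x1, x2] * (M 0 x1 y1 * u y1) * (M 1 x2 y2 * v y2))"
    unfolding bilinear_value_def
    by (intro sum.cong refl) (simp add: sum_distrib_left sum_distrib_right mult.assoc mult.left_commute mult.commute)
  also have "\<dots> = (\<Sum>y1\<in>B. \<Sum>x1\<in>B. \<Sum>y2\<in>B. \<Sum>x2\<in>B. g [x1, x2] * (M 0 x1 y1 * u y1) * (M 1 x2 y2 * v y2))"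
    by (rule sum.cong[OF refl], rule sum.swap)
  also have "\<dots> = (\<Sum>x1\<in>B. \<Sum>y1\<in>B. \<Sum>y2\<in>B. \<Sum>x2\<in>B. g [x1, x2] * (M 0 x1 y1 * u y1) * (M 1 x2 y2 * v y2))"
    by (rule sum.swap)
  also have "\<dots> = (\<Sum>x1\<in>B. \<Sum>y1\<in>B. \<Sum>x2\<in>B. \<Sum>y2\<in>B. g [x1, x2] * (M 0 x1 y1 * u y1) * (M 1 x2 y2 * v y2))"
    by (rule sum.cong[OF refl], rule sum.cong[OF refl], rule sum.swap)
  also have "\<dots> = (\<Sum>x1\<in>B. \<Sum>x2\<in>B. \<Sum>y1\<in>B. \<Sum>y2\<in>B. g [x1, x2] * (M 0 x1 y1 * u y1) * (M 1 x2 y2 * v y2))"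
    by (rule sum.cong[OF refl], rule sum.swap)
  also have "\<dots> = bilinear_value B g (act B (M 0) u) (act B (M 1) v)"
    unfolding bilinear_value_def
    by (intro sum.cong refl) (simp only: act_def if_True mult.assoc sum_product, simp only: sum_distrib_left mult.assoc)
  finally show ?thesis .
qed

lemma vanishes_letterwise:
  "vanishes_at B (letterwise B M g) p q \<longleftrightarrow> vanishes_at B g (proj_map B (M 0) p) (proj_map B (M 1) q)"
  by (auto simp: vanishes_at_def bilinear_letterwise proj_map_def)

lemma geometric_relations_grade: "geometric_relations B E \<sigma> \<subseteq> tensor_grade B 2"
  by (auto simp: geometric_relations_def)

lemma subspace_geometric_relations: "subspace (geometric_relations B E \<sigma>)"
proof -
  have add: "bilinear_value B (\<lambda>w. f w + g w) u v = bilinear_value B f u v + bilinear_value B g u v" for f g u v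
    by (simp add: bilinear_value_def distrib_right sum.distrib)
  have scale: "bilinear_value B (\<lambda>w. c * f w) u v = c * bilinear_value B f u v" for c f u v
    by (simp add: bilinear_value_def sum_distrib_left mult.assoc)
  have "bilinear_value B (\<lambda>w. 0) u v = 0" for u v by (simp add: bilinear_value_def)
  then show ?thesis
    unfolding subspace_def geometric_relations_def vanishes_at_def
    by (auto simp: add scale tensor_grade_def) (metis add_0)
qed

text \<open>The pair of matrices in positions \<open>n\<close> and \<open>n + 1\<close> carries the
  graph of \<open>\<sigma>\<close> onto the graph of \<open>\<rho>\<close>, because the first one
  permutes \<open>E\<close>.\<close>

lemma relations_pullback:
  assumes B: "finite B" and g: "g \<in> tensor_grade B 2" and E: "proj_map B (m n) ` E = E"
    and \<rho>: "\<And>p. p \<in> E \<Longrightarrow> proj_map B (m (n + 1)) (\<sigma> p) = \<rho> (proj_map B (m n) p)"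
  shows "letterwise B (shifted_family m n) g \<in> geometric_relations B E \<sigma> \<longleftrightarrow> g \<in> geometric_relations B E \<rho>"
proof -
  have "letterwise B (shifted_family m n) g \<in> geometric_relations B E \<sigma> \<longleftrightarrow> (\<forall>p\<in>E. vanishes_at B g (proj_map B (m n) p) (\<rho> (proj_map B (m n) p)))"
    using letterwise_grade[OF B g] \<rho> by (simp add: geometric_relations_def vanishes_letterwise shifted_family_def)
  also have "\<dots> \<longleftrightarrow> (\<forall>p\<in>proj_map B (m n) ` E. vanishes_at B g p (\<rho> p))" by blast
  also have "\<dots> \<longleftrightarrow> g \<in> geometric_relations B E \<rho>" unfolding E using g by (simp add: geometric_relations_def)
  finally show ?thesis .
qed

section \<open>Powers of a product compared with powers of a factor\<close>

context group
begin

lemma twisted_power_rec: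
  assumes "t \<in> carrier G" "s \<in> carrier G"
  shows "t [^] (n + 1 :: int) \<otimes> s [^] (- (n + 1)) = t \<otimes> (t [^] n \<otimes> s [^] (- n)) \<otimes> inv s"
proof -
  have "t [^] (n + 1) = t \<otimes> t [^] n" using assms int_pow_mult[of t 1 n] by (simp add: add.commute)
  moreover have "s [^] (- (n + 1)) = s [^] (- n) \<otimes> inv s"
    using assms int_pow_mult[of s "- n" "- 1"] by (simp add: int_pow_neg)
  ultimately show ?thesis using assms by (simp add: m_assoc)
qed

text \<open>The sequence \<open>t^n s^(-n)\<close> obeys the same recursion, by
  \<open>twisted_power_rec\<close>. In the downward induction \<open>t\<close> is cancelled on the
  left.\<close>

lemma twisted_power_unique:
  assumes c: "\<And>n::int. c n \<in> carrier G" and t: "t \<in> carrier G" and s: "s \<in> carrier G"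
    and 0: "c 0 = \<one>" and rec: "\<And>n. c (n + 1) \<otimes> s = t \<otimes> c n"
  shows "t [^] n \<otimes> s [^] (- n) = c n"
proof (induction n rule: int_induct[of _ 0])
  case base
  show ?case using 0 by simp
next
  case (step1 i)
  have "c (i + 1) = c (i + 1) \<otimes> s \<otimes> inv s" using c s by (simp add: m_assoc)
  then have "c (i + 1) = t \<otimes> c i \<otimes> inv s" unfolding rec .
  then show ?case unfolding twisted_power_rec[OF t s] step1 ..
next
  case (step2 i)
  let ?D = "t [^] (i - 1) \<otimes> s [^] (- (i - 1))"
  have D: "?D \<in> carrier G" using t s by simp
  have "c i = t \<otimes> ?D \<otimes> inv s" using twisted_power_rec[OF t s, of "i - 1"] step2 by simp
  then have "c i \<otimes> s = t \<otimes> ?D" using t s D by (simp add: m_assoc)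
  then have "t \<otimes> c (i - 1) = t \<otimes> ?D" using rec[of "i - 1"] by simp
  then show ?case using t D c by simp
qed

text \<open>Conjugation by \<open>s\<close> commutes with powers and fixes \<open>a\<close>.\<close>

lemma commute_int_pow:
  assumes "a \<in> carrier G" "s \<in> carrier G" "s \<otimes> a = a \<otimes> s"
  shows "s \<otimes> a [^] (n::int) = a [^] n \<otimes> s"
proof -
  have "(s \<otimes> a \<otimes> inv s) [^] n = s \<otimes> a [^] n \<otimes> inv s"
  proof (induction n rule: int_induct[of _ 0])
    case (step1 i)
    then show ?case using assms(1,2) by (simp add: int_pow_mult m_assoc) (simp add: m_assoc[symmetric])
  next
    case (step2 i)
    have e: "x [^] (i - 1) = x [^] i \<otimes> inv x" if "x \<in> carrier G" for x
      using int_pow_mult[OF that, of i "- 1"] that by (simp add: int_pow_neg)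
    show ?case using assms(1,2) step2 by (simp add: e inv_mult_group m_assoc) (simp add: m_assoc[symmetric])
  qed (use assms in simp)
  moreover have "s \<otimes> a \<otimes> inv s = a" using assms by (simp add: m_assoc)
  ultimately have "a [^] n \<otimes> s = s \<otimes> a [^] n \<otimes> inv s \<otimes> s" by simp
  then show ?thesis using assms by (simp add: m_assoc)
qed

end

section \<open>Families of matrices and automorphisms of \<open>E\<close>\<close>

locale geometric_setting =
  fixes B :: "'x set" and R :: "('x list \<Rightarrow> 'k::{alg_closed_field, field_char_0}) set"
    and E :: "('x \<Rightarrow> 'k) set set" and \<sigma> :: "('x \<Rightarrow> 'k) set \<Rightarrow> ('x \<Rightarrow> 'k) set"
  assumes B: "finite B" and geom: "is_geometric B R E \<sigma>"
begin

lemma R_eq: "R = geometric_relations B E \<sigma>" and zl: "zero_locus B R = {(p, \<sigma> p) | p. p \<in> E}"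
  and \<sigma>: "\<sigma> \<in> Bij E" and E: "E \<subseteq> proj_space B"
  using geom by (auto simp: is_geometric_def geometric_pair_def Aut_var_def BijGroup_simps projective_variety_def)

sublocale quadratic B R
  using B geometric_relations_grade subspace_geometric_relations by unfold_locales (simp_all add: R_eq)

abbreviation "twist_by \<tau> \<equiv> restrict \<tau> E \<otimes>\<^bsub>BijGroup E\<^esub> \<sigma>"

lemma \<sigma>_E: "p \<in> E \<Longrightarrow> \<sigma> p \<in> E" "p \<in> E \<Longrightarrow> \<sigma> p \<in> proj_space B"
  using Bij_apply[OF \<sigma>] E by blast+

text \<open>The relations of the twist, and hence their zero locus, can be computed from \<open>R\<close> via any
  two consecutive members of the family.\<close>

lemma zero_locus_twist:
  assumes m: "twist_family m"
  shows "zero_locus B {g \<in> tensor_grade B 2. letterwise B (shifted_family m 0) g \<in> R} =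
    {(proj_map B (m n) p, proj_map B (m (n + 1)) (\<sigma> p)) | p. p \<in> E}"
proof -
  note D = twist_familyD[OF m]
  have fc: "shifted_family m n j \<in> carrier (GL B)" for j using D(1) by (simp add: shifted_family_def)
  let ?R' = "{g \<in> tensor_grade B 2. letterwise B (shifted_family m n) g \<in> R}"
  have "{g \<in> tensor_grade B 2. letterwise B (shifted_family m 0) g \<in> R} = ?R'" using D(3) by blast
  moreover have "zero_locus B ?R' = {(proj_map B (m n) p, proj_map B (m (n + 1)) (\<sigma> p)) | p. p \<in> E}"
  proof
    show "{(proj_map B (m n) p, proj_map B (m (n + 1)) (\<sigma> p)) | p. p \<in> E} \<subseteq> zero_locus B ?R'"
    proof
      fix x assume "x \<in> {(proj_map B (m n) p, proj_map B (m (n + 1)) (\<sigma> p)) | p. p \<in> E}"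
      then obtain p where p: "p \<in> E" "x = (proj_map B (m n) p, proj_map B (m (n + 1)) (\<sigma> p))" by blast
      have "vanishes_at B g (proj_map B (m n) p) (proj_map B (m (n + 1)) (\<sigma> p))" if "g \<in> ?R'" for g
      proof -
        have "vanishes_at B (letterwise B (shifted_family m n) g) p (\<sigma> p)" using that p(1) by (simp add: R_eq geometric_relations_def)
        then show ?thesis by (simp add: vanishes_letterwise shifted_family_def)
      qed
      then show "x \<in> zero_locus B ?R'" using p E \<sigma>_E proj_map_proj[OF B D(1)] by (auto simp: zero_locus_def)
    qed
    show "zero_locus B ?R' \<subseteq> {(proj_map B (m n) p, proj_map B (m (n + 1)) (\<sigma> p)) | p. p \<in> E}"
    proof
      fix x assume "x \<in> zero_locus B ?R'"
      then obtain p' q' where x: "x = (p', q')" and p': "p' \<in> proj_space B" "q' \<in> proj_space B"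
        and van: "\<And>g. g \<in> ?R' \<Longrightarrow> vanishes_at B g p' q'" by (auto simp: zero_locus_def)
      define p q where "p = proj_map B (inv\<^bsub>GL B\<^esub> (m n)) p'" and "q = proj_map B (inv\<^bsub>GL B\<^esub> (m (n + 1))) q'"
      have pq: "p \<in> proj_space B" "q \<in> proj_space B" "proj_map B (m n) p = p'" "proj_map B (m (n + 1)) q = q'"
        using p' proj_map_proj[OF B GL_inv(3)[OF B D(1)]] proj_map_inv(2)[OF B D(1)] by (simp_all add: p_def q_def)
      \<comment> \<open>As the matrices are invertible, every \<open>h\<close> in \<open>R\<close>
        is the transform of a relation of the twist, so the preimage point \<open>(p, q)\<close> is
        a zero of all of \<open>R\<close>.\<close>
      have "vanishes_at B h p q" if h: "h \<in> R" for h
      proof -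
        have h2: "h \<in> tensor_grade B 2" using h R(1) by blast
        let ?g = "letterwise B (\<lambda>j. inv\<^bsub>GL B\<^esub> (shifted_family m n j)) h"
        have h': "letterwise B (shifted_family m n) ?g = h" by (rule letterwise_inverse(1)[OF B fc grade_carrier[OF h2]])
        then have "?g \<in> ?R'" using h letterwise_grade[OF B h2] by simp
        then have "vanishes_at B ?g p' q'" by (rule van)
        then have "vanishes_at B (letterwise B (shifted_family m n) ?g) p q" unfolding vanishes_letterwise using pq(3,4) by (simp add: shifted_family_def)
        then show ?thesis by (simp add: h')
      qed
      \<comment> \<open>Geometricity enters here: the zero locus of \<open>R\<close> is no larger
        than the graph of \<open>\<sigma>\<close>.\<close>
      then have "(p, q) \<in> zero_locus B R" using pq by (simp add: zero_locus_def)
      then have "p \<in> E" "q = \<sigma> p" using zl by auto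
      then show "x \<in> {(proj_map B (m n) p, proj_map B (m (n + 1)) (\<sigma> p)) | p. p \<in> E}" using x pq by auto
    qed
  qed
  ultimately show ?thesis by simp
qed

text \<open>Every \<open>n\<close> parametrises the same zero locus, and \<open>n = 0\<close>
  exhibits it as the graph of \<open>m\<^sub>1 \<sigma>\<close> on \<open>E\<close>. Its first
  projection gives the stability of \<open>E\<close>; its being a graph gives the recursion.\<close>

lemma twist_family_E:
  assumes m: "twist_family m"
  shows "proj_map B (m n) ` E = E"
    and "p \<in> E \<Longrightarrow> proj_map B (m (n + 1)) (\<sigma> p) = proj_map B (m 1) (\<sigma> (proj_map B (m n) p))"
proof -
  have id: "proj_map B (m 0) p = p" if "p \<in> E" for p
    using that E twist_familyD(2)[OF m] proj_map_mat_one[OF B] by auto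
  have eq: "{(proj_map B (m n) p, proj_map B (m (n + 1)) (\<sigma> p)) | p. p \<in> E} = {(p, proj_map B (m 1) (\<sigma> p)) | p. p \<in> E}" for n
  proof -
    have "{(proj_map B (m 0) p, proj_map B (m (0 + 1)) (\<sigma> p)) | p. p \<in> E} = {(p, proj_map B (m 1) (\<sigma> p)) | p. p \<in> E}"
      using id by auto
    then show ?thesis using zero_locus_twist[OF m, of n] zero_locus_twist[OF m, of 0] by simp
  qed
  have "proj_map B (m n) ` E = fst ` {(proj_map B (m n) p, proj_map B (m (n + 1)) (\<sigma> p)) | p. p \<in> E}" by force
  also have "\<dots> = E" unfolding eq by force
  finally show "proj_map B (m n) ` E = E" .
  assume "p \<in> E"
  then have "(proj_map B (m n) p, proj_map B (m (n + 1)) (\<sigma> p)) \<in> {(p, proj_map B (m 1) (\<sigma> p)) | p. p \<in> E}"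
    unfolding eq[of n, symmetric] by blast
  then show "proj_map B (m (n + 1)) (\<sigma> p) = proj_map B (m 1) (\<sigma> (proj_map B (m n) p))" by auto
qed

lemma restrict_proj: "restrict (restrict f (proj_space B)) E = restrict f E"
  using E by (auto simp: fun_eq_iff)

text \<open>The restrictions \<open>c n\<close> of the matrices to \<open>E\<close> satisfy the
  recursion of \<open>twisted_power_unique\<close>, so each twisted power extends to projective
  space. If \<open>m\<^sub>2\<close> is the square of \<open>m\<^sub>1\<close>, the recursion at
  \<open>n = 1\<close> reads
  \<open>m\<^sub>1 m\<^sub>1 \<sigma> = m\<^sub>1 \<sigma> m\<^sub>1\<close>, and cancelling
  \<open>m\<^sub>1\<close> on the left gives commutation.\<close>

lemma family_M_set:
  assumes m: "twist_family m"
  defines "\<tau> \<equiv> restrict (proj_map B (m 1)) (proj_space B)"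
  shows "\<tau> \<in> M_set B E \<sigma>"
    and "{g \<in> tensor_grade B 2. letterwise B (shifted_family m 0) g \<in> R} = geometric_relations B E (twist_by \<tau>)"
    and "m 2 = mat_mult B (m 1) (m 1) \<Longrightarrow> \<tau> \<in> Z_set B E \<sigma>"
proof -
  interpret G: group "BijGroup E" by (rule group_BijGroup)
  note D = twist_familyD[OF m] and mE = twist_family_E[OF m]
  have \<tau>E: "restrict \<tau> E = restrict (proj_map B (m 1)) E" unfolding \<tau>_def by (rule restrict_proj)
  define c where "c n = restrict (proj_map B (m n)) E" for n
  have c: "c n \<in> Bij E" for n unfolding c_def by (rule proj_map_Bij[OF B D(1) E mE(1)])
  have cA: "c n \<in> Aut_var B E" for n unfolding c_def by (rule proj_map_Aut_var[OF B D(1) E mE(1)])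
  have down: "\<tau> \<in> Aut_down B E"
    unfolding Aut_down_def using proj_map_Aut_var[OF B D(1) order_refl proj_map_image_proj_space[OF B D(1)]] cA[of 1]
    by (simp add: \<tau>E c_def) (simp add: \<tau>_def)
  have c0: "c 0 = \<one>\<^bsub>BijGroup E\<^esub>" unfolding c_def D(2) BijGroup_simps
    by (rule restrict_ext) (use E proj_map_mat_one[OF B] in blast)
  have rec: "c (n + 1) \<otimes>\<^bsub>BijGroup E\<^esub> \<sigma> = (c 1 \<otimes>\<^bsub>BijGroup E\<^esub> \<sigma>) \<otimes>\<^bsub>BijGroup E\<^esub> c n" for n
  proof (rule Bij_eqI)
    fix p assume p: "p \<in> E"
    have "proj_map B (m n) p \<in> E" using mE(1)[of n] p by blast
    then show "(c (n + 1) \<otimes>\<^bsub>BijGroup E\<^esub> \<sigma>) p = (c 1 \<otimes>\<^bsub>BijGroup E\<^esub> \<sigma> \<otimes>\<^bsub>BijGroup E\<^esub> c n) p"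
      using p mE(2)[OF p, of n] c \<sigma> by (simp add: BijGroup_simps compose_Bij compose_eq \<sigma>_E) (simp add: c_def \<sigma>_E compose_eq)
  qed (use c \<sigma> in \<open>simp_all add: BijGroup_simps compose_Bij\<close>)
  have "(c 1 \<otimes>\<^bsub>BijGroup E\<^esub> \<sigma>) [^]\<^bsub>BijGroup E\<^esub> n \<otimes>\<^bsub>BijGroup E\<^esub> \<sigma> [^]\<^bsub>BijGroup E\<^esub> (- n) = c n" for n
    by (rule G.twisted_power_unique[OF _ _ _ c0 rec]) (use c \<sigma> in \<open>simp_all add: BijGroup_simps compose_Bij\<close>)
  moreover have "c n \<in> Aut_up B E" for n
    unfolding Aut_up_def using cA[of n] proj_map_Aut_var[OF B D(1) order_refl proj_map_image_proj_space[OF B D(1)], of n]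
      restrict_proj[of "proj_map B (m n)", symmetric] unfolding c_def by blast
  ultimately show "\<tau> \<in> M_set B E \<sigma>" using down by (simp add: M_set_def \<tau>E c_def)
  have "letterwise B (shifted_family m 0) g \<in> R \<longleftrightarrow> g \<in> geometric_relations B E (twist_by \<tau>)" if g: "g \<in> tensor_grade B 2" for g
    unfolding R_eq
  proof (rule relations_pullback[OF B g mE(1)])
    fix p assume p: "p \<in> E"
    then have "proj_map B (m 0) p = p" using D(2) proj_map_mat_one[OF B] E by auto
    then show "proj_map B (m (0 + 1)) (\<sigma> p) = twist_by \<tau> (proj_map B (m 0) p)"
      using p c[of 1] \<sigma> by (simp add: \<tau>E c_def BijGroup_simps compose_eq \<sigma>_E)
  qed
  then show "{g \<in> tensor_grade B 2. letterwise B (shifted_family m 0) g \<in> R} = geometric_relations B E (twist_by \<tau>)"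
    using geometric_relations_grade by blast
  assume m2: "m 2 = mat_mult B (m 1) (m 1)"
  have "\<sigma> \<otimes>\<^bsub>BijGroup E\<^esub> c 1 = c 1 \<otimes>\<^bsub>BijGroup E\<^esub> \<sigma>"
  proof (rule Bij_eqI)
    fix p assume p: "p \<in> E"
    have p1: "proj_map B (m 1) p \<in> E" using mE(1)[of 1] p by blast
    have "proj_map B (m 1) (proj_map B (m 1) (\<sigma> p)) = proj_map B (m 1) (\<sigma> (proj_map B (m 1) p))"
      using mE(2)[OF p, of 1] m2 by (simp add: proj_map_mat_mult)
    then have "proj_map B (m 1) (\<sigma> p) = \<sigma> (proj_map B (m 1) p)"
      using proj_map_inv(1)[OF B D(1)] proj_map_proj[OF B D(1)] \<sigma>_E(2)[OF p] \<sigma>_E(2)[OF p1] by metis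
    then show "(\<sigma> \<otimes>\<^bsub>BijGroup E\<^esub> c 1) p = (c 1 \<otimes>\<^bsub>BijGroup E\<^esub> \<sigma>) p"
      using p c \<sigma> by (simp add: BijGroup_simps compose_eq) (simp add: c_def \<sigma>_E)
  qed (use c \<sigma> in \<open>simp_all add: BijGroup_simps compose_Bij\<close>)
  then have "\<sigma> \<otimes>\<^bsub>BijGroup E\<^esub> c 1 \<otimes>\<^bsub>BijGroup E\<^esub> inv\<^bsub>BijGroup E\<^esub> \<sigma> = c 1"
    using c[of 1] \<sigma> by (simp add: BijGroup_simps(1)[symmetric] G.m_assoc)
  then show "\<tau> \<in> Z_set B E \<sigma>" using down by (simp add: Z_set_def \<tau>E c_def)
qed

text \<open>Only the action of the matrices on \<open>E\<close> enters. The recursion of the twisted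
  powers says that \<open>m\<^sub>n\<close> and \<open>m\<^sub>n\<^sub>+\<^sub>1\<close> carry the
  graph of \<open>\<sigma>\<close> to that of \<open>\<tau> \<sigma>\<close>, for every
  \<open>n\<close>, so all pullbacks of \<open>R\<close> coincide.\<close>

lemma twist_familyI:
  assumes \<tau>: "restrict \<tau> E \<in> Bij E" and m: "\<And>n. m n \<in> carrier (GL B)" "m 0 = mat_one B"
    and d: "\<And>n p. p \<in> E \<Longrightarrow> proj_map B (m n) p = (twist_by \<tau> [^]\<^bsub>BijGroup E\<^esub> n \<otimes>\<^bsub>BijGroup E\<^esub> \<sigma> [^]\<^bsub>BijGroup E\<^esub> (- n)) p"
  shows "twist_family m" "{g \<in> tensor_grade B 2. letterwise B (shifted_family m 0) g \<in> R} = geometric_relations B E (twist_by \<tau>)"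
proof -
  interpret G: group "BijGroup E" by (rule group_BijGroup)
  define t where "t = twist_by \<tau>"
  define D where "D n = t [^]\<^bsub>BijGroup E\<^esub> n \<otimes>\<^bsub>BijGroup E\<^esub> \<sigma> [^]\<^bsub>BijGroup E\<^esub> (- n)" for n :: int
  have s: "\<sigma> \<in> carrier (BijGroup E)" and t: "t \<in> carrier (BijGroup E)"
    using \<sigma> \<tau> G.m_closed by (simp_all add: t_def BijGroup_simps(1))
  have Dc: "D n \<in> Bij E" for n unfolding D_def BijGroup_simps(1)[symmetric] using s t by simp
  have pD: "proj_map B (m n) p = D n p" if "p \<in> E" for n p using d[OF that] by (simp add: D_def t_def)
  have mE: "proj_map B (m n) ` E = E" for n
  proof -
    have "proj_map B (m n) ` E = D n ` E" using pD by (intro image_cong) auto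
    then show ?thesis using Dc[of n] by (simp add: Bij_def bij_betw_def)
  qed
  have "D (n + 1) \<otimes>\<^bsub>BijGroup E\<^esub> \<sigma> = t \<otimes>\<^bsub>BijGroup E\<^esub> D n" for n
    unfolding D_def G.twisted_power_rec[OF t s] using s t by (simp add: G.m_assoc)
  then have rec: "D (n + 1) (\<sigma> p) = t (D n p)" if "p \<in> E" for n p
    using that Dc \<sigma> t by (metis BijGroup_simps(1,2) compose_eq)
  have *: "letterwise B (shifted_family m n) g \<in> R \<longleftrightarrow> g \<in> geometric_relations B E t" if g: "g \<in> tensor_grade B 2" for n g
    unfolding R_eq
    by (rule relations_pullback[OF B g mE]) (use pD rec \<sigma>_E in simp)
  show "twist_family m" unfolding twist_family_def using m * by blast
  show "{g \<in> tensor_grade B 2. letterwise B (shifted_family m 0) g \<in> R} = geometric_relations B E (twist_by \<tau>)"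
    using * geometric_relations_grade t_def by blast
qed

text \<open>Each twisted power extends to an automorphism of projective space and is therefore
  induced by a matrix; the choices for different \<open>n\<close> need not be related.\<close>

lemma M_set_family:
  assumes \<tau>: "\<tau> \<in> M_set B E \<sigma>"
  shows "\<exists>m. twist_family m \<and> {g \<in> tensor_grade B 2. letterwise B (shifted_family m 0) g \<in> R} = geometric_relations B E (twist_by \<tau>)"
proof -
  interpret G: group "BijGroup E" by (rule group_BijGroup)
  interpret L: group "GL B :: ('x \<Rightarrow> 'x \<Rightarrow> 'k) monoid" by (rule group_GL[OF B])
  define D where "D n = twist_by \<tau> [^]\<^bsub>BijGroup E\<^esub> n \<otimes>\<^bsub>BijGroup E\<^esub> \<sigma> [^]\<^bsub>BijGroup E\<^esub> (- n)" for n :: int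
  have \<tau>E: "restrict \<tau> E \<in> Bij E" using \<tau> by (simp add: M_set_def Aut_down_def Aut_var_def BijGroup_simps)
  have "\<exists>k\<in>carrier (GL B). \<forall>p\<in>E. proj_map B k p = D n p" for n
  proof -
    have "D n \<in> Aut_up B E" using \<tau> by (simp add: M_set_def D_def)
    then obtain f where f: "f \<in> Aut_var B (proj_space B)" "D n = restrict f E" by (auto simp: Aut_up_def)
    obtain k where "k \<in> carrier (GL B)" "\<forall>p\<in>proj_space B. f p = proj_map B k p" using Aut_proj_space[OF B f(1)] by blast
    then show ?thesis using f(2) E by (intro bexI[of _ k]) auto
  qed
  then obtain k where k: "\<And>n. k n \<in> carrier (GL B)" "\<And>n p. p \<in> E \<Longrightarrow> proj_map B (k n) p = D n p" by metis
  \<comment> \<open>The matrix chosen for \<open>n = 0\<close> acts as the identity on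
    \<open>E\<close> but may differ from the identity matrix, which is put in its place.\<close>
  define m where "m n = (if n = 0 then mat_one B else k n)" for n
  have m: "m n \<in> carrier (GL B)" for n using k L.one_closed by (simp add: m_def GL_simps)
  have "D 0 = \<one>\<^bsub>BijGroup E\<^esub>" by (simp add: D_def)
  then have d: "proj_map B (m n) p = D n p" if "p \<in> E" for n p
    using that k E proj_map_mat_one[OF B, of p] by (auto simp: m_def BijGroup_simps)
  have "m 0 = mat_one B" by (simp add: m_def)
  from twist_familyI[OF \<tau>E m this d[unfolded D_def]] show ?thesis by blast
qed

text \<open>As \<open>\<tau>\<close> and \<open>\<sigma>\<close> commute on \<open>E\<close>, the
  twisted power is just the power of \<open>\<tau>\<close>. It is induced by the power of one matrix
  \<open>k\<close> of \<open>\<tau>\<close>, and these powers multiply exactly and not only up to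
  scalars.\<close>

lemma Z_set_family:
  assumes \<tau>: "\<tau> \<in> Z_set B E \<sigma>"
  shows "\<exists>m. twist_family m \<and> {g \<in> tensor_grade B 2. letterwise B (shifted_family m 0) g \<in> R} = geometric_relations B E (twist_by \<tau>) \<and>
    (\<forall>a b. m (a + b) = mat_mult B (m a) (m b))"
proof -
  interpret G: group "BijGroup E" by (rule group_BijGroup)
  interpret L: group "GL B :: ('x \<Rightarrow> 'x \<Rightarrow> 'k) monoid" by (rule group_GL[OF B])
  define a where "a = restrict \<tau> E"
  have down: "\<tau> \<in> Aut_down B E" and comm: "\<sigma> \<otimes>\<^bsub>BijGroup E\<^esub> a \<otimes>\<^bsub>BijGroup E\<^esub> inv\<^bsub>BijGroup E\<^esub> \<sigma> = a"
    using \<tau> by (simp_all add: Z_set_def a_def)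
  have a: "a \<in> carrier (BijGroup E)" and s: "\<sigma> \<in> carrier (BijGroup E)"
    using down \<sigma> by (simp_all add: Aut_down_def Aut_var_def BijGroup_simps a_def)
  obtain k where k: "k \<in> carrier (GL B)" "\<forall>p\<in>proj_space B. \<tau> p = proj_map B k p"
    using Aut_proj_space[OF B, of \<tau>] down unfolding Aut_down_def by blast
  have ka: "proj_map B k p = a p" if "p \<in> E" for p using that k E by (auto simp: a_def)
  define m where "m n = k [^]\<^bsub>GL B\<^esub> n" for n :: int
  have m: "m n \<in> carrier (GL B)" "m 0 = mat_one B" for n using k by (simp_all add: m_def GL_simps[symmetric])
  have hom: "m (i + j) = mat_mult B (m i) (m j)" for i j using k by (simp add: m_def L.int_pow_mult GL_simps[symmetric])
  have m1: "m 1 = k" using k by (simp add: m_def)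
  have aE: "(a [^]\<^bsub>BijGroup E\<^esub> n) p \<in> E" if "p \<in> E" for p and n :: int
    using Bij_apply[of "a [^]\<^bsub>BijGroup E\<^esub> n" E p] that a by (simp add: BijGroup_simps(1)[symmetric])
  have astep: "(a [^]\<^bsub>BijGroup E\<^esub> (n + 1)) p = a ((a [^]\<^bsub>BijGroup E\<^esub> n) p)" if "p \<in> E" for p and n :: int
  proof -
    have "a [^]\<^bsub>BijGroup E\<^esub> (n + 1) = a \<otimes>\<^bsub>BijGroup E\<^esub> a [^]\<^bsub>BijGroup E\<^esub> n"
      using a G.int_pow_mult[of a 1 n] by (simp add: add.commute)
    then show ?thesis using that a G.int_pow_closed[OF a, of n] by (simp add: BijGroup_simps compose_eq)
  qed
  have mstep: "proj_map B (m (n + 1)) p = proj_map B k (proj_map B (m n) p)" for n p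
    using hom[of 1 n] by (simp add: m1 proj_map_mat_mult add.commute)
  have ma: "proj_map B (m n) p = (a [^]\<^bsub>BijGroup E\<^esub> n) p" if p: "p \<in> E" for n p
  proof (induction n rule: int_induct[of _ 0])
    case base
    show ?case using p E m(2) proj_map_mat_one[OF B] by (auto simp: BijGroup_simps)
  next
    case (step1 i)
    then show ?case using ka[OF aE[OF p, of i]] by (simp add: mstep astep[OF p])
  next
    case (step2 i)
    let ?q = "(a [^]\<^bsub>BijGroup E\<^esub> (i - 1)) p"
    have q: "?q \<in> E" by (rule aE[OF p])
    \<comment> \<open>In the downward step \<open>k\<close> is cancelled, being injective on
      projective space.\<close>
    have "proj_map B k (proj_map B (m (i - 1)) p) = proj_map B k ?q"
      using step2 mstep[of "i - 1" p] astep[OF p, of "i - 1"] ka[OF q] by simp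
    then show ?case
      using proj_map_inv(1)[OF B k(1)] proj_map_proj[OF B m(1), of p "i - 1"] p q E by (metis subsetD)
  qed
  have sa: "\<sigma> \<otimes>\<^bsub>BijGroup E\<^esub> a = a \<otimes>\<^bsub>BijGroup E\<^esub> \<sigma>"
  proof -
    have "\<sigma> \<otimes>\<^bsub>BijGroup E\<^esub> a \<otimes>\<^bsub>BijGroup E\<^esub> inv\<^bsub>BijGroup E\<^esub> \<sigma> \<otimes>\<^bsub>BijGroup E\<^esub> \<sigma> = a \<otimes>\<^bsub>BijGroup E\<^esub> \<sigma>" using comm by simp
    then show ?thesis using a s by (simp add: G.m_assoc)
  qed
  have pow: "(a \<otimes>\<^bsub>BijGroup E\<^esub> \<sigma>) [^]\<^bsub>BijGroup E\<^esub> n \<otimes>\<^bsub>BijGroup E\<^esub> \<sigma> [^]\<^bsub>BijGroup E\<^esub> (- n) = a [^]\<^bsub>BijGroup E\<^esub> n" for n :: int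
  proof (rule G.twisted_power_unique)
    fix n :: int
    have "a [^]\<^bsub>BijGroup E\<^esub> (n + 1) \<otimes>\<^bsub>BijGroup E\<^esub> \<sigma> = a \<otimes>\<^bsub>BijGroup E\<^esub> (a [^]\<^bsub>BijGroup E\<^esub> n \<otimes>\<^bsub>BijGroup E\<^esub> \<sigma>)"
      using a s G.int_pow_mult[of a 1 n] by (simp add: add.commute G.m_assoc)
    then show "a [^]\<^bsub>BijGroup E\<^esub> (n + 1) \<otimes>\<^bsub>BijGroup E\<^esub> \<sigma> = a \<otimes>\<^bsub>BijGroup E\<^esub> \<sigma> \<otimes>\<^bsub>BijGroup E\<^esub> a [^]\<^bsub>BijGroup E\<^esub> n"
      using a s G.commute_int_pow[OF a s sa, of n] by (simp add: G.m_assoc)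
  qed (use a s in simp_all)
  have "twist_family m" "{g \<in> tensor_grade B 2. letterwise B (shifted_family m 0) g \<in> R} = geometric_relations B E (twist_by \<tau>)"
    using twist_familyI[of \<tau> m] a m ma pow by (simp_all add: a_def BijGroup_simps(1))
  then show ?thesis using hom by blast
qed

lemma TS0_sub: "\<theta> \<in> TS0 A \<Longrightarrow> \<theta> \<in> TS A" and TS_alg_sub: "\<theta> \<in> TS_alg A \<Longrightarrow> \<theta> \<in> TS0 A"
  by (simp_all add: TS0_def TS_alg_def)

text \<open>An arbitrary system yields a family through its normalisation; in the other direction
  the system that is found is already normalised.\<close>

lemma Twist_eq:
  "Twist A = {geometric_alg B E (twist_by \<tau>) | \<tau>. \<tau> \<in> M_set B E \<sigma>} // graded_iso_rel"
  unfolding Twist_def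
proof (rule quotient_graded_iso_rel_eqI)
  fix C assume "C \<in> {twisted_algebra A \<theta> | \<theta>. \<theta> \<in> TS A}"
  then obtain \<theta> where \<theta>: "\<theta> \<in> TS A" "C = twisted_algebra A \<theta>" by blast
  obtain m where m: "twist_family m"
    "(C, quadratic_algebra B {g \<in> tensor_grade B 2. letterwise B (shifted_family m 0) g \<in> R}) \<in> graded_iso_rel"
    using twist_TS[OF \<theta>(1)] \<theta>(2) by blast
  then show "\<exists>D\<in>{geometric_alg B E (twist_by \<tau>) | \<tau>. \<tau> \<in> M_set B E \<sigma>}. (C, D) \<in> graded_iso_rel"
    using family_M_set(1,2)[OF m(1)] unfolding geometric_alg_def by auto
next
  fix D assume "D \<in> {geometric_alg B E (twist_by \<tau>) | \<tau>. \<tau> \<in> M_set B E \<sigma>}"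
  then obtain \<tau> where \<tau>: "\<tau> \<in> M_set B E \<sigma>" "D = geometric_alg B E (twist_by \<tau>)" by blast
  obtain m where m: "twist_family m"
    "{g \<in> tensor_grade B 2. letterwise B (shifted_family m 0) g \<in> R} = geometric_relations B E (twist_by \<tau>)"
    using M_set_family[OF \<tau>(1)] by blast
  then show "\<exists>C\<in>{twisted_algebra A \<theta> | \<theta>. \<theta> \<in> TS A}. (C, D) \<in> graded_iso_rel"
    using twist_of_family[OF m(1)] TS0_sub \<tau>(2) unfolding geometric_alg_def by auto
qed

text \<open>The square relation \<open>m 2 = (m 1)^2\<close> leads into \<open>Z_set\<close>, and
  the group law of the powers leads back to an algebraic system.\<close>

lemma Twist_alg_eq:
  "Twist_alg A = {geometric_alg B E (twist_by \<tau>) | \<tau>. \<tau> \<in> Z_set B E \<sigma>} // graded_iso_rel"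
  unfolding Twist_alg_def
proof (rule quotient_graded_iso_rel_eqI)
  fix C assume "C \<in> {twisted_algebra A \<theta> | \<theta>. \<theta> \<in> TS_alg A}"
  then obtain \<theta> where \<theta>: "\<theta> \<in> TS_alg A" "C = twisted_algebra A \<theta>" by blast
  obtain m where m: "twist_family m" "m 2 = mat_mult B (m 1) (m 1)"
    "(C, quadratic_algebra B {g \<in> tensor_grade B 2. letterwise B (shifted_family m 0) g \<in> R}) \<in> graded_iso_rel"
    using twist_TS0[OF TS_alg_sub[OF \<theta>(1)]] \<theta> by blast
  then show "\<exists>D\<in>{geometric_alg B E (twist_by \<tau>) | \<tau>. \<tau> \<in> Z_set B E \<sigma>}. (C, D) \<in> graded_iso_rel"
    using family_M_set(2,3)[OF m(1)] unfolding geometric_alg_def by auto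
next
  fix D assume "D \<in> {geometric_alg B E (twist_by \<tau>) | \<tau>. \<tau> \<in> Z_set B E \<sigma>}"
  then obtain \<tau> where \<tau>: "\<tau> \<in> Z_set B E \<sigma>" "D = geometric_alg B E (twist_by \<tau>)" by blast
  obtain m where m: "twist_family m" "\<forall>a b. m (a + b) = mat_mult B (m a) (m b)"
    "{g \<in> tensor_grade B 2. letterwise B (shifted_family m 0) g \<in> R} = geometric_relations B E (twist_by \<tau>)"
    using Z_set_family[OF \<tau>(1)] by blast
  then show "\<exists>C\<in>{twisted_algebra A \<theta> | \<theta>. \<theta> \<in> TS_alg A}. (C, D) \<in> graded_iso_rel"
    using twist_of_family[OF m(1)] \<tau>(2) unfolding geometric_alg_def by auto
qed

end

theorem theorem3p5:
  fixes B :: "'x set"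
    and R :: "('x list \<Rightarrow> 'k::{alg_closed_field, field_char_0}) set"
    and E :: "('x \<Rightarrow> 'k) set set"
    and \<sigma> :: "('x \<Rightarrow> 'k) set \<Rightarrow> ('x \<Rightarrow> 'k) set"
    and A :: "('k, ('x list \<Rightarrow> 'k) set) graded_alg"
  assumes "finite B"
    and "A = quadratic_algebra B R"
    and "is_geometric B R E \<sigma>"
  shows "Twist A =
           {geometric_alg B E (restrict \<tau> E \<otimes>\<^bsub>BijGroup E\<^esub> \<sigma>) | \<tau>. \<tau> \<in> M_set B E \<sigma>}
           // graded_iso_rel \<and>
         Twist_alg A =
           {geometric_alg B E (restrict \<tau> E \<otimes>\<^bsub>BijGroup E\<^esub> \<sigma>) | \<tau>. \<tau> \<in> Z_set B E \<sigma>}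
           // graded_iso_rel"
proof -
  interpret geometric_setting B R E \<sigma> using assms by unfold_locales
  show ?thesis unfolding assms(2) using Twist_eq Twist_alg_eq by blast
qed

end
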